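(* There are absolute constants $C_+>0$ and $C_->0$ such that the following holds. Let $w$ be the reduced word (in the generators $a_1,a_2$) representing an element of $\pi_1=\pi_1(\mathbb{C}\setminus\{-1,1\},0)$. Then: (1) $C_-\cdot\Lambda(w)\le\lambda_{tr}(w)\le C_+\cdot\Lambda(w)$, except in the following cases: $w=a_1^n$ or $w=a_2^n$ for an integer $n$. In these exceptional cases $\lambda_{tr}(w)=0$. (2) $C_-\cdot\Lambda(w)\le\lambda_{pb}(w)\le C_+\cdot\Lambda(w)$, except in the following case: each term in the reduced word $w$ has the same power, which equals either $+1$ or $-1$. In these exceptional cases $\lambda_{pb}(w)=0$.
   Context: Generators. $\pi_1=\pi_1(\mathbb{C}\setminus\{-1,1\},0)$ is the free group on $a_1,a_2$, where $a_1$ is represented by a simple closed curve based at $0$ which surrounds $-1$ counterclockwise and whose image except the point $0$ is contained in the open left half-plane, and $a_2$ is represented by a simple closed curve based at $0$ which surrounds $1$ counterclockwise and whose image except the point $0$ is contained in the open right half-plane. Boundary values. $\pi_1^{tr}=\pi_1(\mathbb{C}\setminus\{-1,1\},(-1,1))$ is the set of homotopy classes of curves in $\mathbb{C}\setminus\{-1,1\}$ with endpoints on the interval $(-1,1)$ (the endpoints stay in $(-1,1)$ during homotopies). $\pi_1^{pb}=\pi_1(\mathbb{C}\setminus\{-1,1\},i\mathbb{R})$ is the set of homotopy classes of curves in $\mathbb{C}\setminus\{-1,1\}$ with endpoints on the imaginary axis $i\mathbb{R}$ (the endpoints stay in $i\mathbb{R}$ during homotopies). Since $(-1,1)$ and $i\mathbb{R}$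 are connected, simply connected and contain $0$, both are canonically identified with $\pi_1$; for $w\in\pi_1$ the corresponding classes are denoted $w_{tr}$ and $w_{pb}$. Extremal length. For an open rectangle $\mathcal{R}$ with sides parallel to the axes, with horizontal side length $\mathsf{b}$ and vertical side length $\mathsf{a}$, put $\lambda(\mathcal{R})=\mathsf{a}/\mathsf{b}$. A continuous map $\mathcal{R}\to\mathbb{C}\setminus\{-1,1\}$ represents $w_{tr}$ (respectively $w_{pb}$) if it has a continuous extension to the closure $\overline{\mathcal{R}}$ (with values in $\mathbb{C}\setminus\{-1,1\}$) which maps the horizontal sides into $(-1,1)$ (respectively into $i\mathbb{R}$) and whose restriction to each vertical side represents $w_{tr}$ (respectively $w_{pb}$). Then $\lambda_{tr}(w)$ (respectively $\lambda_{pb}(w)$) is the infimum of $\lambda(\mathcal{R})$ over all rectangles $\mathcal{R}$ which admit a holomorphic map to $\mathbb{C}\setminus\{-1,1\}$ that represents $w_{tr}$ (respectively $w_{pb}$). Reduced words and syllables. Elements of $\pi_1$ are identified with reduced words, i.e. products of nonzero integer powers of generators in which consecutive terms are powers of different generators (the empty word is the identity); a "term" is one of these factors $a_j^{n}$ and $n$ is its power. The syllables of a reduced word are: (i) each term $a_j^{n}$ with $|n|\ge 2$; (ii) each maximal sequence of (at least two) consecutive terms which all have equal power, equal to either $+1$ or $-1$; (iii) each remaining term, i.e. each term with power $+1$ or $-1$ such that the neighbouring term on the right (if there is one) and the neighbouring term on the left (if there is one) have power different from that of the given term; such a syllable is called a singleton. The degree $\deg$ of a syllable is the sum of the absolute values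 of the powers of the terms entering it. Finally $$\Lambda(w)=\sum_{\text{syllables of } w}\log\bigl(1+\deg(\text{syllable})\bigr).$$ *)

theory Defs
  imports "HOL-Complex_Analysis.Complex_Analysis"
begin

datatype gen = A1 | A2

text \<open>A term \<open>a_j ^ n\<close> is a pair of a generator and an integer power; a word is a list of terms.\<close>

type_synonym word = "(gen \<times> int) list"

definition reduced_word :: "word \<Rightarrow> bool" where
  "reduced_word w \<longleftrightarrow> (\<forall>(g, n) \<in> set w. n \<noteq> 0) \<and> successively (\<lambda>s t. fst s \<noteq> fst t) w"

definition gen_power :: "gen \<Rightarrow> int \<Rightarrow> word" where
  "gen_power g n = (if n = 0 then [] else [(g, n)])"

abbreviation power_at :: "word \<Rightarrow> nat \<Rightarrow> int" where
  "power_at w k \<equiv> snd (w ! k)"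

text \<open>A syllable is represented by the set of positions of the terms entering it.\<close>

definition big_syllables :: "word \<Rightarrow> nat set set" where
  "big_syllables w = {{k} | k. k < length w \<and> \<bar>power_at w k\<bar> \<ge> 2}"

definition run_syllables :: "word \<Rightarrow> nat set set" where
  "run_syllables w = {{i..j} | i j. i < j \<and> j < length w \<and>
     (\<exists>e \<in> {1, -1}. (\<forall>k \<in> {i..j}. power_at w k = e) \<and>
        (i > 0 \<longrightarrow> power_at w (i - 1) \<noteq> e) \<and>
        (Suc j < length w \<longrightarrow> power_at w (Suc j) \<noteq> e))}"

definition singleton_syllables :: "word \<Rightarrow> nat set set" where
  "singleton_syllables w = {{k} | k. k < length w \<and> power_at w k \<in> {1, -1} \<and>
     (k > 0 \<longrightarrow> power_at w (k - 1) \<noteq> power_at w k) \<and>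
     (Suc k < length w \<longrightarrow> power_at w (Suc k) \<noteq> power_at w k)}"

definition syllables :: "word \<Rightarrow> nat set set" where
  "syllables w = big_syllables w \<union> run_syllables w \<union> singleton_syllables w"

definition syllable_deg :: "word \<Rightarrow> nat set \<Rightarrow> int" where
  "syllable_deg w S = (\<Sum>k\<in>S. \<bar>power_at w k\<bar>)"

definition Lambda :: "word \<Rightarrow> real" where
  "Lambda w = (\<Sum>S\<in>syllables w. ln (1 + real_of_int (syllable_deg w S)))"

lemma finite_syllables: "finite (syllables w)"
proof -
  have "syllables w \<subseteq> Pow {..<length w}"
    by (auto simp: syllables_def big_syllables_def run_syllables_def singleton_syllables_def)
  thus ?thesis
    by (rule finite_subset) simp
qed

definition twice_punctured :: "complex set" where
  "twice_punctured = - {-1, 1}"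

text \<open>The two circles below are specific representatives of the generators; the lemmas up to
  \<open>winding_number_gen_loop\<close> check that they have the required properties.\<close>

fun gen_loop :: "gen \<Rightarrow> real \<Rightarrow> complex" where
  "gen_loop A1 = part_circlepath (-1) 1 0 (2 * pi)"
| "gen_loop A2 = part_circlepath 1 1 pi (3 * pi)"

lemma pathstart_gen_loop: "pathstart (gen_loop g) = 0"
  and pathfinish_gen_loop: "pathfinish (gen_loop g) = 0"
proof -
  have "exp (\<i> * complex_of_real (3 * pi)) = exp (\<i> * complex_of_real pi)"
    unfolding exp_eq by (intro exI[of _ 1]) (simp add: algebra_simps)
  hence e: "exp (\<i> * complex_of_real (3 * pi)) = -1"
    by (simp only: exp_pi_i')
  show "pathstart (gen_loop g) = 0"
    by (cases g) (simp_all add: exp_pi_i')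
  have "exp (\<i> * complex_of_real (2 * pi)) = 1"
    unfolding mult.commute[of \<i>] of_real_mult of_real_numeral by (rule exp_two_pi_i)
  with e show "pathfinish (gen_loop g) = 0"
    by (cases g) (simp_all del: of_real_mult)
qed

lemma simple_path_gen_loop: "simple_path (gen_loop g)"
  by (cases g) (simp_all add: simple_path_part_circlepath)

lemma path_image_gen_loop:
  "path_image (gen_loop A1) - {0} \<subseteq> {z. Re z < 0}"
  "path_image (gen_loop A2) - {0} \<subseteq> {z. Re z > 0}"
proof -
  have *: "s * Re z < 0" if "norm (z + of_real s) = 1" "z \<noteq> 0" "s \<in> {1, -1}" for z s
  proof -
    have "(Re z + s)\<^sup>2 + (Im z)\<^sup>2 = 1"
      using that(1) by (simp add: cmod_def)
    moreover have "(Re z)\<^sup>2 + (Im z)\<^sup>2 > 0"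
      using that(2) by (metis complex_neq_0)
    ultimately show ?thesis
      using that(3) by (auto simp: power2_eq_square algebra_simps)
  qed
  show "path_image (gen_loop A1) - {0} \<subseteq> {z. Re z < 0}"
    using *[of _ 1] by (auto dest!: in_path_image_part_circlepath)
  show "path_image (gen_loop A2) - {0} \<subseteq> {z. Re z > 0}"
    using *[of _ "-1"] by (auto dest!: in_path_image_part_circlepath)
qed

lemma winding_number_gen_loop:
  "winding_number (gen_loop A1) (-1) = 1"
  "winding_number (gen_loop A2) 1 = 1"
proof -
  have *: "winding_number (part_circlepath c 1 s (s + 2 * pi)) c = 1" for c s
  proof -
    have c: "c \<notin> path_image (part_circlepath c 1 s (s + 2 * pi))"
      using in_path_image_part_circlepath[of c c 1 s "s + 2 * pi"] by auto
    have "winding_number (part_circlepath c 1 s (s + 2 * pi)) c =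
            1 / (2 * pi * \<i>) * integral {s..s + 2 * pi} (\<lambda>t. \<i>)"
      using c by (simp add: winding_number_valid_path contour_integral_part_circlepath_eq)
    thus ?thesis
      by (simp add: scaleR_conv_of_real)
  qed
  show "winding_number (gen_loop A1) (-1) = 1" "winding_number (gen_loop A2) 1 = 1"
    using *[of "-1" 0] *[of 1 pi] by simp_all
qed

primrec loop_power :: "(real \<Rightarrow> complex) \<Rightarrow> nat \<Rightarrow> real \<Rightarrow> complex" where
  "loop_power p 0 = linepath (pathstart p) (pathstart p)"
| "loop_power p (Suc n) = p +++ loop_power p n"

definition term_path :: "gen \<Rightarrow> int \<Rightarrow> real \<Rightarrow> complex" where
  "term_path g n = (if n \<ge> 0 then loop_power (gen_loop g) (nat n)
                    else loop_power (reversepath (gen_loop g)) (nat (- n)))"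

fun word_path :: "word \<Rightarrow> real \<Rightarrow> complex" where
  "word_path [] = linepath 0 0"
| "word_path ((g, n) # w) = term_path g n +++ word_path w"

lemma word_path_loop:
  "path (word_path w)" "path_image (word_path w) \<subseteq> twice_punctured"
  "pathstart (word_path w) = 0" "pathfinish (word_path w) = 0"
proof -
  let ?P = "\<lambda>p. path p \<and> path_image p \<subseteq> twice_punctured \<and> pathstart p = 0 \<and> pathfinish p = 0"
  have image: "path_image (gen_loop g) \<subseteq> twice_punctured" for g
  proof -
    have "norm (z - of_real s) \<noteq> 1" if "z \<in> {-1, 1}" "s \<in> {-1, 1}" for z :: complex and s
      using that by auto
    thus ?thesis
      using in_path_image_part_circlepath[of _ "-1" 1 0 "2 * pi"]
        in_path_image_part_circlepath[of _ 1 1 pi "3 * pi"]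
      by (cases g) (fastforce simp: twice_punctured_def)+
  qed
  have gen: "?P (gen_loop g)" for g
    using image simple_path_gen_loop
    by (simp add: pathstart_gen_loop pathfinish_gen_loop simple_path_imp_path)
  have power: "?P (loop_power p n)" if "?P p" for p n
    using that by (induction n) (auto simp: path_image_join twice_punctured_def)
  have "?P (term_path g n)" for g n
    using power[of "gen_loop g"] power[of "reversepath (gen_loop g)"] gen[of g]
    by (simp add: term_path_def)
  hence "?P (word_path w)"
    by (induction w rule: word_path.induct) (auto simp: path_image_join twice_punctured_def)
  thus "path (word_path w)" "path_image (word_path w) \<subseteq> twice_punctured"
    "pathstart (word_path w) = 0" "pathfinish (word_path w) = 0"
    by auto
qed

text \<open>The endpoints of a curve may move within \<open>A\<close> during the homotopy.\<close>

definition bv_class :: "complex set \<Rightarrow> (real \<Rightarrow> complex) \<Rightarrow> (real \<Rightarrow> complex) set" where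
  "bv_class A p = {q. homotopic_with_canon (\<lambda>h. pathstart h \<in> A \<and> pathfinish h \<in> A)
                        {0..1} twice_punctured p q}"

definition interval_tr :: "complex set" where
  "interval_tr = complex_of_real ` {-1<..<1}"

definition axis_pb :: "complex set" where
  "axis_pb = {z. Re z = 0}"

definition class_tr :: "word \<Rightarrow> (real \<Rightarrow> complex) set" where
  "class_tr w = bv_class interval_tr (word_path w)"

definition class_pb :: "word \<Rightarrow> (real \<Rightarrow> complex) set" where
  "class_pb w = bv_class axis_pb (word_path w)"

text \<open>An open rectangle with sides parallel to the axes is \<open>box z z'\<close> with lower left corner \<open>z\<close>
  and upper right corner \<open>z'\<close>. Its vertical sides are parametrized upwards.\<close>

definition rect_ratio :: "complex \<Rightarrow> complex \<Rightarrow> real" where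
  "rect_ratio z z' = (Im z' - Im z) / (Re z' - Re z)"

definition represents ::
  "complex set \<Rightarrow> (real \<Rightarrow> complex) set \<Rightarrow> complex \<Rightarrow> complex \<Rightarrow> (complex \<Rightarrow> complex) \<Rightarrow> bool" where
  "represents A c z z' f \<longleftrightarrow>
     (\<exists>F. continuous_on (cbox z z') F \<and> F ` cbox z z' \<subseteq> twice_punctured \<and>
          (\<forall>\<zeta> \<in> box z z'. F \<zeta> = f \<zeta>) \<and>
          (\<forall>\<zeta> \<in> cbox z z'. Im \<zeta> = Im z \<or> Im \<zeta> = Im z' \<longrightarrow> F \<zeta> \<in> A) \<and>
          F \<circ> linepath z (Complex (Re z) (Im z')) \<in> c \<and>
          F \<circ> linepath (Complex (Re z') (Im z)) z' \<in> c)"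

text \<open>The value is \<open>\<infinity>\<close> if no rectangle admits such a map.\<close>

definition extremal_length :: "complex set \<Rightarrow> (real \<Rightarrow> complex) set \<Rightarrow> ereal" where
  "extremal_length A c = Inf {ereal (rect_ratio z z') | z z'.
     Re z < Re z' \<and> Im z < Im z' \<and>
     (\<exists>f. f holomorphic_on box z z' \<and> f ` box z z' \<subseteq> twice_punctured \<and> represents A c z z' f)}"

definition lambda_tr :: "word \<Rightarrow> ereal" where
  "lambda_tr w = extremal_length interval_tr (class_tr w)"

definition lambda_pb :: "word \<Rightarrow> ereal" where
  "lambda_pb w = extremal_length axis_pb (class_pb w)"

end

(*
  The complement of -1 and 1 is covered by the upper half-plane through a modular function for
  Gamma(2), which is constructed from the half-period values of the Weierstrass function.  The
  interval (-1,1) and the imaginary axis lift to the imaginary axis and to the unit half circle, both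
  hyperbolic geodesics L through i.  A map of a rectangle represents w exactly if it lifts to a map
  that takes the horizontal sides to L and to the image of L under the matrix of w.  The extremal
  length therefore depends only on the hyperbolic distance of these two geodesics.  If Q > 1 is the
  hyperbolic cosine of the distance, then, after moving the geodesics to concentric half circles and
  taking logarithms, Cauchy's theorem gives the lower bound ln Q / pi and an explicit exponential map
  the upper bound 2 ln (2 Q) / pi.  If Q = 1, the geodesics coincide or have a common endpoint, and
  the extremal length is 0.

  Q is a quadratic polynomial in the entries of the matrix of w, a product of factors
  (2n, -1; 1, 0), one for each power n.  The entries grow by a factor comparable with |n| if |n| > 1,
  but only linearly in the length of a block of equal powers +1 or -1, along which the product is
  parabolic.  So ln Q is comparable with the sum of the logarithms of the degrees of the syllables.
*)

theory Submission
  imports Defs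
begin

text \<open>The analytic obstacle is the covering property: all branches of the inverse of
  \<open>u\<close> near a given point must exist on one common disc, although the fibre is infinite.
  The anharmonic group reduces them to branches at points of a fundamental domain, and as
  \<open>u\<close> tends to 1 at the cusp, only a compact part of that domain matters. There it
  suffices that \<open>u\<close> has no critical point, which follows from a combination of weight 0
  that is forced to be constant. The elliptic functions are handled by Liouville's theorem instead
  of product formulas. The arithmetic obstacle is the lower bound for the entries. A run of powers
  +1 or -1 changes a vector only linearly, and only by a sign on its fixed line, spanned by (1, 1)
  or (1, -1). A different power applied just before keeps the vector off that line. Of the start
  vectors, (1, 0) is harmless, but the unit half circle leads to (1, 1) and (1, -1) themselves, of
  which at least one suits the given word. As a run of degree k is only shown to multiply an entry
  by 1 + 2 k / 3, squares of entries are compared with the product of the numbers 1 +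
  degree.\<close>

section \<open>Lambert series in a multiplicative variable\<close>

definition lambert_term :: "complex \<Rightarrow> complex" where
  "lambert_term X = X / (1 - X)\<^sup>2"

text \<open>With \<open>Z\<close> and \<open>Q\<close> the exponentials of the argument and of the
  second period, this sums a double pole over half of its translates in the direction of that
  period. A term at a pole counts as 0, because division by 0 gives 0, so the shift identities hold
  without exceptions.\<close>

definition lambert_sum :: "complex \<Rightarrow> complex \<Rightarrow> complex" where
  "lambert_sum Q Z = (\<Sum>n. lambert_term (Z * Q ^ n))"

lemma norm_lambert_term_le:
  assumes "norm X \<le> 1 / 2"
  shows "norm (lambert_term X) \<le> 4 * norm X"
proof -
  have "1 / 2 \<le> norm (1 - X)"
    using assms norm_triangle_ineq2[of 1 X] by simp
  hence "(1 / 2)\<^sup>2 \<le> (norm (1 - X))\<^sup>2"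
    by (intro power_mono) auto
  hence "1 / 4 \<le> norm ((1 - X)\<^sup>2)"
    by (simp add: norm_power power_divide)
  hence "norm X / norm ((1 - X)\<^sup>2) \<le> norm X / (1 / 4)"
    by (intro divide_left_mono) (auto intro: mult_pos_pos)
  thus ?thesis
    by (simp add: lambert_term_def norm_divide)
qed

text \<open>The bound is uniform in \<open>Q\<close> and \<open>Z\<close>, so that the M-test
  applies when both vary with a parameter. It holds only from some index on, as the first terms may
  be large.\<close>

lemma lambert_sum_majorant:
  assumes "0 \<le> r" "r < 1"
  shows "\<forall>\<^sub>F n in sequentially. \<forall>Q Z. norm Q \<le> r \<longrightarrow> norm Z \<le> R \<longrightarrow>
           norm (lambert_term (Z * Q ^ n)) \<le> 4 * (\<bar>R\<bar> * r ^ n)"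
proof -
  have "(\<lambda>n. \<bar>R\<bar> * r ^ n) \<longlonglongrightarrow> \<bar>R\<bar> * 0"
    by (intro tendsto_intros LIMSEQ_power_zero) (use assms in auto)
  hence "\<forall>\<^sub>F n in sequentially. \<bar>R\<bar> * r ^ n < 1 / 2"
    by (auto dest: order_tendstoD(2)[where a = "1/2"])
  thus ?thesis
  proof eventually_elim
    case (elim n)
    show ?case
    proof (intro allI impI)
      fix Q Z :: complex assume QZ: "norm Q \<le> r" "norm Z \<le> R"
      have le: "norm (Z * Q ^ n) \<le> \<bar>R\<bar> * r ^ n"
        unfolding norm_mult norm_power using QZ assms by (intro mult_mono power_mono) auto
      with elim have "norm (lambert_term (Z * Q ^ n)) \<le> 4 * norm (Z * Q ^ n)"
        by (intro norm_lambert_term_le) auto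
      with le show "norm (lambert_term (Z * Q ^ n)) \<le> 4 * (\<bar>R\<bar> * r ^ n)"
        by linarith
    qed
  qed
qed

lemma summable_lambert_majorant:
  assumes "0 \<le> r" "r < 1"
  shows "summable (\<lambda>n. 4 * (\<bar>R :: real\<bar> * r ^ n))"
  using assms by (intro summable_mult summable_geometric) auto

lemma summable_lambert:
  assumes "norm Q < 1"
  shows "summable (\<lambda>n. lambert_term (Z * Q ^ n))"
  using lambert_sum_majorant[of "norm Q" "norm Z"] assms
  by (intro summable_comparison_test_ev[OF _ summable_lambert_majorant[of "norm Q" "norm Z"]])
     (auto elim: eventually_mono)

lemma lambert_sum_shift:
  assumes "norm Q < 1"
  shows "lambert_sum Q (Z * Q) = lambert_sum Q Z - lambert_term Z"
  using suminf_split_head[OF summable_lambert[OF assms, of Z]]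
  by (simp add: lambert_sum_def mult_ac)

lemma lambert_sum_cnj:
  assumes "norm Q < 1"
  shows "lambert_sum (cnj Q) (cnj Z) = cnj (lambert_sum Q Z)"
proof -
  have "(\<lambda>n. cnj (lambert_term (Z * Q ^ n))) sums cnj (lambert_sum Q Z)"
    unfolding sums_cnj lambert_sum_def using summable_lambert[OF assms] by (rule summable_sums)
  thus ?thesis
    by (auto simp: lambert_sum_def lambert_term_def dest: sums_unique)
qed

lemma lambert_sum_zero: "lambert_sum 0 Z = lambert_term Z"
  using suminf_finite[of "{0}" "\<lambda>n. lambert_term (Z * 0 ^ n)"]
  by (simp add: lambert_sum_def lambert_term_def)

lemma holomorphic_lambert_sum:
  assumes S: "open S" and Q: "Q holomorphic_on S" and Z: "Z holomorphic_on S"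
    and lt: "\<And>x. x \<in> S \<Longrightarrow> norm (Q x) < 1"
    and neq: "\<And>x n. x \<in> S \<Longrightarrow> Z x * Q x ^ n \<noteq> 1"
  shows "(\<lambda>x. lambert_sum (Q x) (Z x)) holomorphic_on S"
proof (rule holomorphic_uniform_sequence[OF S, where f = "\<lambda>n x. \<Sum>i<n. lambert_term (Z x * Q x ^ i)"])
  show "(\<lambda>x. \<Sum>i<n. lambert_term (Z x * Q x ^ i)) holomorphic_on S" for n
    unfolding lambert_term_def using neq
    by (intro holomorphic_intros Q Z) (metis cancel_comm_monoid_add_class.diff_cancel eq_iff_diff_eq_0 power2_eq_square mult_eq_0_iff)
next
  fix x assume "x \<in> S"
  then obtain d where d: "d > 0" "cball x d \<subseteq> S"
    using S open_contains_cball by blast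
  \<comment> \<open>Maxima over the closed disc supply one ratio below 1 and one bound for
    \<open>Z\<close> that serve at all of its points.\<close>
  have cont: "continuous_on (cball x d) (\<lambda>x. norm (Q x))" "continuous_on (cball x d) (\<lambda>x. norm (Z x))"
    using continuous_on_subset[OF holomorphic_on_imp_continuous_on[OF Q] d(2)]
      continuous_on_subset[OF holomorphic_on_imp_continuous_on[OF Z] d(2)]
    by (auto intro: continuous_on_norm)
  obtain y where y: "y \<in> cball x d" "\<And>t. t \<in> cball x d \<Longrightarrow> norm (Q t) \<le> norm (Q y)"
    using continuous_attains_sup[OF compact_cball _ cont(1)] d by auto
  obtain y' where y': "y' \<in> cball x d" "\<And>t. t \<in> cball x d \<Longrightarrow> norm (Z t) \<le> norm (Z y')"
    using continuous_attains_sup[OF compact_cball _ cont(2)] d by auto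
  have r: "0 \<le> norm (Q y)" "norm (Q y) < 1"
    using lt y d by auto
  have "uniform_limit (cball x d) (\<lambda>n x. \<Sum>i<n. lambert_term (Z x * Q x ^ i))
          (\<lambda>x. \<Sum>i. lambert_term (Z x * Q x ^ i)) sequentially"
    by (rule Weierstrass_m_test_ev[OF _ summable_lambert_majorant[OF r, of "norm (Z y')"]])
       (use lambert_sum_majorant[OF r, of "norm (Z y')"] y y' in \<open>auto elim!: eventually_mono\<close>)
  with d show "\<exists>d>0. cball x d \<subseteq> S \<and> uniform_limit (cball x d)
      (\<lambda>n x. \<Sum>i<n. lambert_term (Z x * Q x ^ i)) (\<lambda>x. lambert_sum (Q x) (Z x)) sequentially"
    unfolding lambert_sum_def by blast
qed

subsection \<open>Elliptic functions\<close>

text \<open>The real period is a parameter because the half-period values are separated below by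
  means of a function of period 1/2.\<close>

definition lattice :: "real \<Rightarrow> complex \<Rightarrow> complex set" where
  "lattice r \<tau> = {of_int m * of_real r + of_int n * \<tau> | m n. True}"

text \<open>The imaginary part of the difference fixes the multiple of \<open>\<tau>\<close>; then
  the real part fixes the multiple of \<open>r\<close>.\<close>

lemma lattice_discrete:
  assumes "r > 0" "Im \<tau> > 0" "x \<in> lattice r \<tau>" "y \<in> lattice r \<tau>" "dist y x < min r (Im \<tau>)"
  shows "y = x"
proof -
  obtain m n m' n' where x: "x = of_int m * of_real r + of_int n * \<tau>"
    and y: "y = of_int m' * of_real r + of_int n' * \<tau>"
    using assms by (auto simp: lattice_def)
  have d: "y - x = of_int (m' - m) * of_real r + of_int (n' - n) * \<tau>"
    by (simp add: x y algebra_simps)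
  have "\<bar>Im (y - x)\<bar> < Im \<tau>"
    using assms(5) abs_Im_le_cmod[of "y - x"] by (simp add: dist_norm)
  hence "\<bar>of_int (n' - n)\<bar> * Im \<tau> < 1 * Im \<tau>"
    using assms(2) unfolding d by (simp add: abs_mult)
  hence "\<bar>of_int (n' - n) :: real\<bar> < 1"
    using assms(2) by (simp add: mult_less_cancel_right_pos)
  hence n: "n' = n" by linarith
  have "\<bar>Re (y - x)\<bar> < r"
    using assms(5) abs_Re_le_cmod[of "y - x"] by (simp add: dist_norm)
  hence "\<bar>of_int (m' - m)\<bar> * r < 1 * r"
    using assms(1) n unfolding d by (simp add: abs_mult)
  hence "\<bar>of_int (m' - m) :: real\<bar> < 1"
    using assms(1) by (simp add: mult_less_cancel_right_pos)
  hence "m' = m" by linarith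
  with n show ?thesis by (simp add: x y)
qed

lemma not_islimpt_lattice: "r > 0 \<Longrightarrow> Im \<tau> > 0 \<Longrightarrow> \<not> z islimpt lattice r \<tau>"
  using discrete_imp_not_islimpt[of "min r (Im \<tau>)" "lattice r \<tau>" z] lattice_discrete[of r \<tau>] by auto

lemma closed_lattice: "r > 0 \<Longrightarrow> Im \<tau> > 0 \<Longrightarrow> closed (lattice r \<tau>)"
  using closed_limpt not_islimpt_lattice by blast

lemma eventually_notin_lattice:
  "r > 0 \<Longrightarrow> Im \<tau> > 0 \<Longrightarrow> \<forall>\<^sub>F w in at z. w \<notin> lattice r \<tau>"
  using not_islimpt_lattice islimpt_iff_eventually by blast

lemma countable_lattice: "countable (lattice r \<tau>)"
proof -
  have "lattice r \<tau> = (\<lambda>(m, n). of_int m * of_real r + of_int n * \<tau>) ` (UNIV :: (int \<times> int) set)"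
    by (auto simp: lattice_def image_def)
  thus ?thesis by simp
qed

lemma lattice_add_period1: "z + of_real r \<in> lattice r \<tau> \<longleftrightarrow> z \<in> lattice r \<tau>"
proof
  assume "z + of_real r \<in> lattice r \<tau>"
  then obtain m n where "z + of_real r = of_int m * of_real r + of_int n * \<tau>" by (auto simp: lattice_def)
  hence "z = of_int (m - 1) * of_real r + of_int n * \<tau>" by (simp add: algebra_simps)
  thus "z \<in> lattice r \<tau>" unfolding lattice_def by blast
next
  assume "z \<in> lattice r \<tau>"
  then obtain m n where "z = of_int m * of_real r + of_int n * \<tau>" by (auto simp: lattice_def)
  hence "z + of_real r = of_int (m + 1) * of_real r + of_int n * \<tau>" by (simp add: algebra_simps)
  thus "z + of_real r \<in> lattice r \<tau>" unfolding lattice_def by blast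
qed

lemma int_periodic:
  fixes g :: "complex \<Rightarrow> complex"
  assumes "\<And>z. g (z + w) = g z"
  shows "g (z + of_int m * w) = g z"
proof (induction m rule: int_induct[of _ 0])
  case base thus ?case by simp
next
  case (step1 i)
  have "g (z + of_int (i + 1) * w) = g ((z + of_int i * w) + w)" by (simp add: algebra_simps)
  thus ?case using assms step1 by simp
next
  case (step2 i)
  have "g (z + of_int i * w) = g ((z + of_int (i - 1) * w) + w)" by (simp add: algebra_simps)
  thus ?case using assms step2 by simp
qed

lemma lattice_fundamental_domain:
  assumes "r > 0" "Im \<tau> > 0"
  obtains a b m n where "a \<in> {0..1::real}" "b \<in> {0..1::real}"
    "z = (of_real (a * r) + of_real b * \<tau>) + of_int m * of_real r + of_int n * \<tau>"
proof -
  define y where "y = Im z / Im \<tau>"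
  define x where "x = (Re z - y * Re \<tau>) / r"
  have z: "z = of_real (x * r) + of_real y * \<tau>"
    using assms by (simp add: complex_eq_iff x_def y_def)
  have "z = (of_real (frac x * r) + of_real (frac y) * \<tau>) + of_int \<lfloor>x\<rfloor> * of_real r + of_int \<lfloor>y\<rfloor> * \<tau>"
    unfolding z frac_def by (simp add: algebra_simps)
  moreover have "frac x \<in> {0..1}" "frac y \<in> {0..1}"
    using frac_lt_1[of x] frac_lt_1[of y] by (auto intro: less_imp_le)
  ultimately show ?thesis using that by blast
qed

text \<open>Boundedness removes the singularity at 0, and the periods carry this to every lattice
  point. The resulting entire function takes all its values on a compact parallelogram, so
  Liouville's theorem applies.\<close>

lemma bounded_elliptic_constant:
  assumes \<tau>: "r > 0" "Im \<tau> > 0"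
    and holo: "f holomorphic_on - lattice r \<tau>"
    and per1: "\<And>z. z \<notin> lattice r \<tau> \<Longrightarrow> f (z + of_real r) = f z"
    and per2: "\<And>z. z \<notin> lattice r \<tau> \<Longrightarrow> f (z + \<tau>) = f z"
    and bdd: "\<forall>\<^sub>F z in at 0. norm (f z) \<le> B"
  obtains c where "\<And>z. z \<notin> lattice r \<tau> \<Longrightarrow> f z = c"
proof -
  let ?L = "lattice r \<tau>"
  \<comment> \<open>\<open>remove_sings\<close> depends only on punctured neighbourhoods, so
    \<open>g\<close> has the periods at lattice points as well, where nothing is known about
    \<open>f\<close>.\<close>
  define g where "g = remove_sings f"
  have openL: "open (- ?L)"
    using closed_lattice[OF \<tau>] by auto
  have an: "f analytic_on {z}" if "z \<notin> ?L" for z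
    using that openL holo analytic_at by blast
  have per: "g (z + w) = g z" if "\<And>z. z \<notin> ?L \<Longrightarrow> f (z + w) = f z" for w z
  proof -
    have "remove_sings f (z + w) = remove_sings (\<lambda>x. f (x + w)) z"
    proof -
      have "filtermap (\<lambda>x. x + w) (at z) = at (z + w)"
        using filtermap_at_shift[of "-w" z] by simp
      from remove_sings_compose[OF this, of f] show ?thesis by (simp add: o_def)
    qed
    also have "\<dots> = remove_sings f z"
      by (rule remove_sings_cong) (use eventually_notin_lattice[OF \<tau>, of z] that in \<open>auto elim: eventually_mono\<close>)
    finally show ?thesis by (simp add: g_def)
  qed
  have p1: "g (z + of_int m * of_real r) = g z" for m z
    using int_periodic[of g "of_real r" z m] per[OF per1] by blast
  have p2: "g (z + of_int m * \<tau>) = g z" for m z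
    using int_periodic[of g \<tau> z m] per[OF per2] by blast
  have g0: "g analytic_on {0}"
  proof -
    obtain e where e: "e > 0" "\<And>w. w \<noteq> 0 \<Longrightarrow> dist w 0 < e \<Longrightarrow> w \<notin> ?L"
      using eventually_notin_lattice[OF \<tau>, of 0] by (auto simp: eventually_at)
    have "f holomorphic_on (ball 0 e - {0})"
      using e by (intro holomorphic_on_subset[OF holo]) (auto simp: dist_commute)
    moreover have "0 \<in> interior (ball 0 e)" using e by simp
    ultimately obtain h where h: "h holomorphic_on ball 0 e" "\<forall>z\<in>ball 0 e - {0}. h z = f z"
      using holomorphic_on_extend_bounded[of f "ball 0 e" 0] bdd by blast
    have h0: "h analytic_on {0}" using h e analytic_at[of h 0] by auto
    have evh: "\<forall>\<^sub>F z in nhds 0. g z = h z"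
    proof -
      have "remove_sings f z = remove_sings h z" if "z \<in> ball 0 e" for z
      proof (rule remove_sings_cong)
        have "\<forall>\<^sub>F x in at z. x \<in> ball 0 e - {0}"
        proof (cases "z = 0")
          case True thus ?thesis using that eventually_at_in_open[of "ball 0 e" z] by auto
        next
          case False
          have "\<forall>\<^sub>F x in at z. x \<in> (ball 0 e - {0}) - {z}"
            using that False by (intro eventually_at_in_open) auto
          thus ?thesis by eventually_elim auto
        qed
        thus "\<forall>\<^sub>F x in at z. f x = h x" by eventually_elim (use h in auto)
      qed auto
      moreover have "remove_sings h z = h z" if "z \<in> ball 0 e" for z
        using that h analytic_at[of h z] by (intro remove_sings_at_analytic) auto
      moreover have "\<forall>\<^sub>F z in nhds 0. z \<in> ball (0::complex) e"
        using e by (intro eventually_nhds_in_open) auto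
      ultimately show ?thesis unfolding g_def by (auto elim: eventually_mono)
    qed
    show ?thesis using h0 analytic_at_cong[OF evh refl] by simp
  qed
  have entire: "g holomorphic_on UNIV"
  proof -
    have "g analytic_on {z}" for z
    proof (cases "z \<in> ?L")
      case False
      have "g analytic_on {z} \<longleftrightarrow> f analytic_on {z}"
        unfolding g_def by (rule analytic_at_cong[OF eventually_remove_sings_eq_nhds[OF an[OF False]] refl])
      thus ?thesis using an[OF False] by simp
    next
      case True
      then obtain m n where z: "z = of_int m * of_real r + of_int n * \<tau>" by (auto simp: lattice_def)
      have eq: "g x = (g \<circ> (\<lambda>x. x - z)) x" for x
        using p1[of "x - z" m] p2[of "x - z + of_int m * of_real r" n] z by (simp add: algebra_simps)
      have "(g \<circ> (\<lambda>x. x - z)) analytic_on {z}"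
        by (rule analytic_on_compose) (use g0 in \<open>auto intro!: analytic_intros\<close>)
      moreover have "g = g \<circ> (\<lambda>x. x - z)" using eq by (rule ext)
      ultimately show ?thesis by metis
    qed
    hence "g analytic_on UNIV" using analytic_on_analytic_at[of g UNIV] by blast
    thus ?thesis by (rule analytic_imp_holomorphic)
  qed
  have "bounded (range g)"
  proof -
    define K where "K = (\<lambda>(a, b). of_real (a * r) + of_real b * \<tau>) ` ({0..1::real} \<times> {0..1::real})"
    have "compact K" unfolding K_def
      by (intro compact_continuous_image compact_Times) (auto intro!: continuous_intros simp: case_prod_unfold)
    hence "compact (g ` K)"
      using continuous_on_subset[OF holomorphic_on_imp_continuous_on[OF entire] subset_UNIV]
      by (rule compact_continuous_image[rotated])
    moreover have "range g \<subseteq> g ` K"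
    proof clarify
      fix z
      obtain a b m n where ab: "a \<in> {0..1::real}" "b \<in> {0..1::real}"
        "z = (of_real (a * r) + of_real b * \<tau>) + of_int m * of_real r + of_int n * \<tau>"
        using lattice_fundamental_domain[OF \<tau>] by metis
      have "g z = g (of_real (a * r) + of_real b * \<tau>)" by (simp only: ab(3) p1 p2)
      thus "g z \<in> g ` K" using ab unfolding K_def by force
    qed
    ultimately show ?thesis using bounded_subset compact_imp_bounded by blast
  qed
  from Liouville_theorem[OF entire this] obtain c where c: "\<And>z. g z = c"
    unfolding constant_on_def by blast
  have "f z = c" if "z \<notin> ?L" for z
    using c[of z] remove_sings_at_analytic[OF an[OF that]] by (simp add: g_def)
  thus ?thesis using that by blast
qed

section \<open>The Weierstrass function as a sum over multiplicative translates\<close>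

definition elliptic_sum :: "complex \<Rightarrow> complex \<Rightarrow> complex" where
  "elliptic_sum Q Z = lambert_sum Q Z + lambert_sum Q (Q / Z)"

definition expi2 :: "complex \<Rightarrow> complex" where
  "expi2 z = exp (2 * of_real pi * \<i> * z)"

text \<open>The Weierstrass function of the lattice spanned by \<open>1\<close> and \<open>\<tau>\<close>, multiplied by
  \<open>- 1 / (4 * pi\<^sup>2)\<close> and up to an additive constant.\<close>

definition wp :: "complex \<Rightarrow> complex \<Rightarrow> complex" where
  "wp \<tau> z = elliptic_sum (expi2 \<tau>) (expi2 z)"

lemma lambert_term_inverse: "lambert_term (1 / X) = lambert_term X"
proof (cases "X = 0 \<or> X = 1")
  case False
  hence "1 - X \<noteq> 0" "X - 1 \<noteq> 0" by auto
  moreover have "(1 - 1 / X)\<^sup>2 = (1 - X)\<^sup>2 / X\<^sup>2"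
    using False by (simp add: field_simps power2_eq_square)
  ultimately show ?thesis
    using False by (simp add: lambert_term_def field_simps power2_eq_square)
qed (auto simp: lambert_term_def)

text \<open>The shift removes the first term of one series and adds one in front of the other; the
  two are equal because \<open>lambert_term\<close> is invariant under inversion.\<close>

lemma elliptic_sum_shift:
  assumes "norm Q < 1" "Q \<noteq> 0"
  shows "elliptic_sum Q (Z * Q) = elliptic_sum Q Z"
proof -
  have "Q / (Z * Q) = 1 / Z" "1 / Z * Q = Q / Z" using assms(2) by simp_all
  thus ?thesis
    using lambert_sum_shift[OF assms(1), of Z] lambert_sum_shift[OF assms(1), of "1 / Z"]
      lambert_term_inverse[of Z] by (simp add: elliptic_sum_def)
qed

lemma elliptic_sum_inverse:
  assumes "norm Q < 1"
  shows "elliptic_sum Q (1 / Z) = elliptic_sum Q Z"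
  using lambert_sum_shift[OF assms, of Z] lambert_sum_shift[OF assms, of "1 / Z"]
  by (simp add: elliptic_sum_def lambert_term_inverse mult.commute)

lemma expi2_nonzero [simp]: "expi2 z \<noteq> 0"
  by (simp add: expi2_def)

lemma expi2_add: "expi2 (z + w) = expi2 z * expi2 w"
  by (simp add: expi2_def ring_distribs exp_add)

lemma expi2_minus: "expi2 (- z) = 1 / expi2 z"
  by (simp add: expi2_def exp_minus field_simps)

lemma expi2_one [simp]: "expi2 1 = 1"
  by (simp add: expi2_def)

lemma norm_expi2: "norm (expi2 z) = exp (- 2 * pi * Im z)"
  by (simp add: expi2_def)

lemma norm_expi2_less_1 [simp]: "Im z > 0 \<Longrightarrow> norm (expi2 z) < 1"
  by (simp add: norm_expi2)

lemma holomorphic_expi2 [holomorphic_intros]: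
  "f holomorphic_on S \<Longrightarrow> (\<lambda>x. expi2 (f x)) holomorphic_on S"
  unfolding expi2_def by (intro holomorphic_intros)

lemma expi2_power: "expi2 z ^ n = expi2 (of_nat n * z)"
  by (simp add: expi2_def exp_of_nat_mult[symmetric] mult_ac)

lemma expi2_eq_1_iff: "expi2 z = 1 \<longleftrightarrow> (\<exists>m. z = of_int m)"
proof
  assume "expi2 z = 1"
  then obtain n where n: "- (2 * pi * Im z) = 0" "2 * pi * Re z = of_int (2 * n) * pi"
    by (auto simp: expi2_def exp_eq_1)
  hence "Im z = 0" "Re z = of_int n" by auto
  hence "z = of_int n" by (simp add: complex_eq_iff)
  thus "\<exists>m. z = of_int m" ..
next
  assume "\<exists>m. z = of_int m"
  then obtain m where m: "z = of_int m" by blast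
  have "Im (2 * complex_of_real pi * \<i> * of_int m) = of_int (2 * m) * pi" by simp
  thus "expi2 z = 1"
    unfolding m expi2_def exp_eq_1 by (auto intro!: exI[of _ m])
qed

lemma wp_add_1: "wp \<tau> (z + 1) = wp \<tau> z"
  by (simp add: wp_def expi2_add)

lemma wp_add_\<tau>: "Im \<tau> > 0 \<Longrightarrow> wp \<tau> (z + \<tau>) = wp \<tau> z"
  by (simp add: wp_def expi2_add elliptic_sum_shift)

lemma wp_minus: "Im \<tau> > 0 \<Longrightarrow> wp \<tau> (- z) = wp \<tau> z"
  by (simp add: wp_def expi2_minus elliptic_sum_inverse)

lemma lattice_1_I: "of_int m + of_int n * \<tau> \<in> lattice 1 \<tau>"
  unfolding lattice_def by force

lemma holomorphic_wp:
  assumes "Im \<tau> > 0"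
  shows "wp \<tau> holomorphic_on - lattice 1 \<tau>"
  unfolding wp_def[abs_def] elliptic_sum_def
proof (intro holomorphic_on_add holomorphic_lambert_sum)
  show op: "open (- lattice 1 \<tau>)" using closed_lattice assms by auto
  show "open (- lattice 1 \<tau>)" by (fact op)
  fix x n assume x: "x \<in> - lattice 1 \<tau>"
  show "expi2 x * expi2 \<tau> ^ n \<noteq> 1"
  proof
    assume "expi2 x * expi2 \<tau> ^ n = 1"
    then obtain m where "x + of_nat n * \<tau> = of_int m"
      unfolding expi2_power expi2_add[symmetric] expi2_eq_1_iff by blast
    hence "x = of_int m + of_int (- int n) * \<tau>" by (simp add: algebra_simps)
    thus False using x lattice_1_I[of m "- int n" \<tau>] by simp
  qed
  show "expi2 \<tau> / expi2 x * expi2 \<tau> ^ n \<noteq> 1"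
  proof
    assume "expi2 \<tau> / expi2 x * expi2 \<tau> ^ n = 1"
    hence "expi2 (\<tau> + (- x) + of_nat n * \<tau>) = 1"
      unfolding expi2_add expi2_minus expi2_power by simp
    then obtain m where "\<tau> + (- x) + of_nat n * \<tau> = of_int m" unfolding expi2_eq_1_iff by blast
    hence "x = of_int (- m) + of_int (int (Suc n)) * \<tau>" by (simp add: algebra_simps)
    thus False using x lattice_1_I[of "-m" "int (Suc n)" \<tau>] by simp
  qed
qed (use assms in \<open>auto intro!: holomorphic_intros\<close>)

lemma lambert_term_expi2:
  "lambert_term (expi2 z) = - 1 / (4 * (sin (of_real pi * z))\<^sup>2)"
proof -
  define w where "w = exp (\<i> * (of_real pi * z))"
  have w: "w \<noteq> 0" "expi2 z = w\<^sup>2"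
    by (simp_all add: w_def expi2_def exp_double[symmetric] mult_ac)
  have w3: "exp (- (\<i> * (of_real pi * z))) = 1 / w"
    unfolding w_def exp_minus by (rule inverse_eq_divide)
  have s: "sin (of_real pi * z) = (w - 1 / w) / (2 * \<i>)"
    unfolding sin_exp_eq w3 w_def[symmetric] by (rule refl)
  have "(sin (of_real pi * z))\<^sup>2 = - ((w - 1 / w)\<^sup>2) / 4"
    unfolding s power_divide by (simp add: power_mult_distrib)
  also have "(w - 1 / w)\<^sup>2 = (1 - w\<^sup>2)\<^sup>2 / w\<^sup>2"
    using w(1) by (simp add: field_simps power2_eq_square)
  finally show ?thesis
    by (simp add: lambert_term_def w(2))
qed

text \<open>The numerator factors as (sin w - w) (sin w + w), of orders 3 and 1, against a
  denominator of order 4. The factor 4 in the bound comes from the estimate of |sin w| below by |w|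
  / 2.\<close>

lemma inverse_sin_square_bounded:
  "\<exists>B. \<forall>\<^sub>F w in at (0::complex). norm (1 / (sin w)\<^sup>2 - 1 / w\<^sup>2) \<le> B"
proof -
  have "(\<lambda>w. sin w / w) \<midarrow>0\<rightarrow> (1::complex)"
    using DERIV_sin[of "0::complex"] by (simp add: has_field_derivative_iff)
  hence "((\<lambda>w. cmod (sin w / w)) \<longlongrightarrow> cmod 1) (at 0)" by (rule tendsto_norm)
  hence ev1: "\<forall>\<^sub>F w in at (0::complex). 1 / 2 < cmod (sin w / w)"
    by (rule order_tendstoD) simp
  have ev2: "\<forall>\<^sub>F w in at (0::complex). norm w < 1"
    using eventually_at_in_open'[of "ball 0 1" "0::complex"] by simp
  have ev3: "\<forall>\<^sub>F w in at (0::complex). w \<noteq> 0" by (rule eventually_neq_at_within)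
  have "\<forall>\<^sub>F w in at (0::complex). norm (1 / (sin w)\<^sup>2 - 1 / w\<^sup>2) \<le> 4 * (exp 1 * (2 + exp 1))"
    using ev1 ev2 ev3
  proof eventually_elim
    case (elim w)
    have "norm (sin w - (\<Sum>k\<le>2. complex_of_real (sin_coeff k) * w ^ k))
       \<le> exp\<bar>Im w\<bar> * (norm w) ^ (Suc 2) / (fact 2)" by (rule Taylor_sin)
    also have "(\<Sum>k\<le>2. complex_of_real (sin_coeff k) * w ^ k) = w"
      by (simp add: sin_coeff_def numeral_2_eq_2)
    also have "exp\<bar>Im w\<bar> * (norm w) ^ (Suc 2) / (fact 2) \<le> exp 1 * (norm w) ^ 3"
    proof -
      have "exp \<bar>Im w\<bar> \<le> exp 1" using abs_Im_le_cmod[of w] elim(2) by simp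
      moreover have "norm w ^ 3 / fact 2 \<le> norm w ^ 3" by (simp add: fact_2)
      ultimately have "exp \<bar>Im w\<bar> * (norm w ^ 3 / fact 2) \<le> exp 1 * norm w ^ 3"
        by (intro mult_mono) auto
      thus ?thesis by (simp add: numeral_3_eq_3)
    qed
    finally have d: "norm (sin w - w) \<le> exp 1 * norm w ^ 3" .
    also have "\<dots> \<le> exp 1 * norm w"
      using elim(2) power_decreasing[of 1 3 "norm w"] by simp
    finally have d2: "norm (sin w - w) \<le> exp 1 * norm w" .
    have s: "norm (sin w + w) \<le> (2 + exp 1) * norm w"
    proof -
      have "sin w + w = (sin w - w) + 2 * w" by simp
      hence "norm (sin w + w) \<le> norm (sin w - w) + norm (2 * w)" by (metis norm_triangle_ineq)
      with d2 show ?thesis by (simp add: norm_mult algebra_simps)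
    qed
    have lo: "norm w / 2 < norm (sin w)"
      using elim by (simp add: norm_divide field_simps)
    hence sn: "sin w \<noteq> 0" by auto
    have "norm (1 / (sin w)\<^sup>2 - 1 / w\<^sup>2) = norm ((sin w - w) * (sin w + w)) / (norm (sin w) ^ 2 * norm w ^ 2)"
    proof -
      have "1 / (sin w)\<^sup>2 - 1 / w\<^sup>2 = - ((sin w - w) * (sin w + w)) / ((sin w)\<^sup>2 * w\<^sup>2)"
        using sn elim(3) by (simp add: field_simps power2_eq_square)
      thus ?thesis by (simp add: norm_divide norm_mult norm_power)
    qed
    also have "\<dots> \<le> (exp 1 * norm w ^ 3) * ((2 + exp 1) * norm w) / ((norm w / 2) ^ 2 * norm w ^ 2)"
      unfolding norm_mult using elim(3) lo
      by (intro frac_le mult_mono d s power_mono) auto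
    also have "\<dots> = 4 * (exp 1 * (2 + exp 1))"
      using elim(3) by (simp add: field_simps power2_eq_square power3_eq_cube)
    finally show ?case .
  qed
  thus ?thesis by blast
qed

text \<open>Without the first term of one series the sum is holomorphic on the strip |Im z| < Im
  \<tau>, where all remaining arguments have modulus below 1. The removed term is
  \<open>- 1 / (4 * (sin (of_real pi * z))\<^sup>2)\<close> and carries the pole.\<close>

lemma wp_principal_part:
  assumes "Im \<tau> > 0"
  shows "\<exists>B. \<forall>\<^sub>F z in at 0. norm (wp \<tau> z + 1 / (4 * of_real pi ^ 2 * z\<^sup>2)) \<le> B"
proof -
  define h where "h = (\<lambda>z. lambert_sum (expi2 \<tau>) (expi2 z * expi2 \<tau>) + lambert_sum (expi2 \<tau>) (expi2 \<tau> / expi2 z))"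
  define S where "S = {z. \<bar>Im z\<bar> < Im \<tau>}"
  have S: "open S"
    unfolding S_def by (intro open_Collect_less continuous_intros)
  have ne1: "w \<noteq> 1" if "norm w < 1" for w :: complex using that by auto
  have lt: "norm (expi2 (z + \<tau>)) * norm (expi2 \<tau>) ^ n < 1" if "- Im z < Im \<tau>" for z n
  proof -
    have "norm (expi2 (z + \<tau>)) < 1" using that by (simp add: norm_expi2)
    moreover have "norm (expi2 \<tau>) ^ n \<le> 1" using assms by (intro power_le_one) (auto intro: less_imp_le)
    ultimately show ?thesis
      using mult_left_le[of "norm (expi2 \<tau>) ^ n" "norm (expi2 (z + \<tau>))"] by (smt (verit) norm_ge_zero)
  qed
  have "h holomorphic_on S"
    unfolding h_def
  proof (intro holomorphic_on_add holomorphic_lambert_sum S)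
    fix x n assume x: "x \<in> S"
    show "expi2 x * expi2 \<tau> * expi2 \<tau> ^ n \<noteq> 1"
      using lt[of x n] x by (intro ne1) (auto simp: S_def norm_mult norm_power expi2_add)
    have "expi2 \<tau> / expi2 x = expi2 (- x + \<tau>)" by (simp only: expi2_add expi2_minus) simp
    thus "expi2 \<tau> / expi2 x * expi2 \<tau> ^ n \<noteq> 1"
      using lt[of "-x" n] x by (intro ne1) (auto simp: S_def norm_mult norm_power)
  qed (use assms in \<open>auto intro!: holomorphic_intros\<close>)
  hence "isCont h 0"
    using S assms by (auto simp: S_def dest!: holomorphic_on_imp_continuous_on simp: continuous_on_eq_continuous_at)
  hence "((\<lambda>z. norm (h z)) \<longlongrightarrow> norm (h 0)) (at 0)" by (intro tendsto_norm) (simp add: isCont_def)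
  hence ev1: "\<forall>\<^sub>F z in at 0. norm (h z) < norm (h 0) + 1" by (rule order_tendstoD) simp
  obtain B where B: "\<forall>\<^sub>F w in at (0::complex). norm (1 / (sin w)\<^sup>2 - 1 / w\<^sup>2) \<le> B"
    using inverse_sin_square_bounded by blast
  have "filterlim (\<lambda>z. of_real pi * z) (at (0::complex)) (at 0)"
    by (intro filterlim_atI tendsto_eq_intros) (auto simp: eventually_at_filter)
  with B have ev2: "\<forall>\<^sub>F z in at (0::complex). norm (1 / (sin (of_real pi * z))\<^sup>2 - 1 / (of_real pi * z)\<^sup>2) \<le> B"
    by (auto simp: filterlim_iff)
  have "\<forall>\<^sub>F z in at 0. norm (wp \<tau> z + 1 / (4 * of_real pi ^ 2 * z\<^sup>2)) \<le> norm (h 0) + 1 + B / 4"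
    using ev1 ev2
  proof eventually_elim
    case (elim z)
    have "wp \<tau> z = h z + lambert_term (expi2 z)"
      using lambert_sum_shift[of "expi2 \<tau>" "expi2 z"] assms
      by (simp add: wp_def elliptic_sum_def h_def)
    hence "wp \<tau> z + 1 / (4 * of_real pi ^ 2 * z\<^sup>2)
       = h z - (1 / (sin (of_real pi * z))\<^sup>2 - 1 / (of_real pi * z)\<^sup>2) / 4"
      by (simp add: lambert_term_expi2 power_mult_distrib diff_divide_distrib mult_ac)
    also have "norm \<dots> \<le> norm (h z) + norm ((1 / (sin (of_real pi * z))\<^sup>2 - 1 / (of_real pi * z)\<^sup>2) / 4)"
      by (rule norm_triangle_ineq4)
    also have "\<dots> \<le> norm (h 0) + 1 + B / 4"
      using elim by (simp add: norm_divide)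
    finally show ?case .
  qed
  thus ?thesis by blast
qed

lemma lattice_S:
  assumes "Im \<tau> > 0"
  shows "z / \<tau> \<in> lattice 1 (- 1 / \<tau>) \<longleftrightarrow> z \<in> lattice 1 \<tau>"
proof -
  have t: "\<tau> \<noteq> 0" using assms by auto
  show ?thesis
  proof
    assume "z / \<tau> \<in> lattice 1 (- 1 / \<tau>)"
    then obtain m n where "z / \<tau> = of_int m + of_int n * (- 1 / \<tau>)" by (auto simp: lattice_def)
    hence "z = of_int (- n) + of_int m * \<tau>" using t by (simp add: field_simps)
    thus "z \<in> lattice 1 \<tau>" using lattice_1_I[of "- n" m \<tau>] by simp
  next
    assume "z \<in> lattice 1 \<tau>"
    then obtain m n where "z = of_int m + of_int n * \<tau>" by (auto simp: lattice_def)
    hence "z / \<tau> = of_int n + of_int (- m) * (- 1 / \<tau>)" using t by (simp add: field_simps)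
    thus "z / \<tau> \<in> lattice 1 (- 1 / \<tau>)" using lattice_1_I[of n "- m" "- 1 / \<tau>"] by (simp only:)
  qed
qed

lemma Im_S: "Im \<tau> > 0 \<Longrightarrow> Im (- 1 / \<tau>) > 0"
  by (auto simp: Im_divide intro!: divide_pos_pos add_nonneg_pos)

text \<open>Both functions have the periods 1 and \<tau> and the same principal part at 0, so their
  difference is bounded there and hence constant. The constant disappears from differences of
  half-period values.\<close>

lemma wp_S:
  assumes \<tau>: "Im \<tau> > 0"
  obtains c where "\<And>z. z \<notin> lattice 1 \<tau> \<Longrightarrow> wp \<tau> z = wp (- 1 / \<tau>) (z / \<tau>) / \<tau>\<^sup>2 + c"
proof -
  have t: "\<tau> \<noteq> 0" using assms by auto
  define \<sigma> where "\<sigma> = - 1 / \<tau>"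
  have \<sigma>: "Im \<sigma> > 0" using Im_S[OF \<tau>] by (simp add: \<sigma>_def)
  define f where "f = (\<lambda>z. wp \<tau> z - wp \<sigma> (z / \<tau>) / \<tau>\<^sup>2)"
  have holo: "f holomorphic_on - lattice 1 \<tau>"
  proof -
    have "(\<lambda>z. wp \<sigma> (z / \<tau>)) = wp \<sigma> \<circ> (\<lambda>z. z / \<tau>)" by auto
    moreover have "(wp \<sigma> \<circ> (\<lambda>z. z / \<tau>)) holomorphic_on - lattice 1 \<tau>"
      by (rule holomorphic_on_compose_gen[OF _ holomorphic_wp[OF \<sigma>]])
         (use t lattice_S[OF \<tau>] in \<open>auto intro!: holomorphic_intros simp: \<sigma>_def\<close>)
    ultimately show ?thesis
      unfolding f_def using t by (intro holomorphic_intros holomorphic_wp[OF \<tau>]) auto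
  qed
  obtain B1 where B1: "\<forall>\<^sub>F z in at 0. norm (wp \<tau> z + 1 / (4 * of_real pi ^ 2 * z\<^sup>2)) \<le> B1"
    using wp_principal_part[OF \<tau>] by blast
  obtain B2 where B2: "\<forall>\<^sub>F z in at 0. norm (wp \<sigma> z + 1 / (4 * of_real pi ^ 2 * z\<^sup>2)) \<le> B2"
    using wp_principal_part[OF \<sigma>] by blast
  have "filterlim (\<lambda>z. z / \<tau>) (at (0::complex)) (at 0)"
    using t by (intro filterlim_atI tendsto_eq_intros) (auto simp: eventually_at_filter)
  with B2 have B2': "\<forall>\<^sub>F z in at 0. norm (wp \<sigma> (z / \<tau>) + 1 / (4 * of_real pi ^ 2 * (z / \<tau>)\<^sup>2)) \<le> B2"
    by (auto simp: filterlim_iff)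
  have bdd: "\<forall>\<^sub>F z in at 0. norm (f z) \<le> B1 + B2 / norm (\<tau>\<^sup>2)"
    using B1 B2'
  proof eventually_elim
    case (elim z)
    have "f z = (wp \<tau> z + 1 / (4 * of_real pi ^ 2 * z\<^sup>2))
        - (wp \<sigma> (z / \<tau>) + 1 / (4 * of_real pi ^ 2 * (z / \<tau>)\<^sup>2)) / \<tau>\<^sup>2"
      using t by (simp add: f_def field_simps)
    also have "norm \<dots> \<le> norm (wp \<tau> z + 1 / (4 * of_real pi ^ 2 * z\<^sup>2))
        + norm ((wp \<sigma> (z / \<tau>) + 1 / (4 * of_real pi ^ 2 * (z / \<tau>)\<^sup>2)) / \<tau>\<^sup>2)"
      by (rule norm_triangle_ineq4)
    also have "\<dots> \<le> B1 + B2 / norm (\<tau>\<^sup>2)"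
      unfolding norm_divide using elim t by (intro add_mono divide_right_mono) auto
    finally show ?case .
  qed
  have p1: "f (z + of_real 1) = f z" for z
  proof -
    have "wp \<sigma> ((z + 1) / \<tau>) = wp \<sigma> (z / \<tau>)"
      using wp_add_\<tau>[OF \<sigma>, of "(z + 1) / \<tau>"] t by (simp add: \<sigma>_def field_simps)
    thus ?thesis by (simp add: f_def wp_add_1)
  qed
  have p2: "f (z + \<tau>) = f z" for z
  proof -
    have "(z + \<tau>) / \<tau> = z / \<tau> + 1" using t by (simp add: field_simps)
    thus ?thesis by (simp add: f_def wp_add_1 wp_add_\<tau>[OF \<tau>])
  qed
  obtain c where c: "\<And>z. z \<notin> lattice 1 \<tau> \<Longrightarrow> f z = c"
    using bounded_elliptic_constant[OF _ \<tau> holo p1 p2 bdd] by auto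
  show ?thesis
    by (rule that[of c]) (use c in \<open>auto simp: f_def \<sigma>_def algebra_simps\<close>)
qed

text \<open>The derivative of an even function is odd, so a zero at 0 is at least double. This is
  the order needed to cancel the pole of \<open>wp\<close>.\<close>

lemma even_zero_order:
  fixes k :: "complex \<Rightarrow> complex"
  assumes "k holomorphic_on ball 0 r" "r > 0" "k 0 = 0" "\<And>z. k (- z) = k z"
  shows "\<exists>B. \<forall>\<^sub>F z in at 0. norm (k z / z\<^sup>2) \<le> B"
proof -
  have d: "(k has_field_derivative deriv k 0) (at 0)"
    using assms by (intro holomorphic_derivI[of k "ball 0 r"]) auto
  have "((\<lambda>z. k (- z)) has_field_derivative deriv k 0 * (- 1)) (at 0)"
    by (rule DERIV_chain2[of k _ uminus]) (use d in \<open>auto intro!: derivative_eq_intros\<close>)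
  hence "(k has_field_derivative - deriv k 0) (at 0)" using assms(4) by simp
  with d have "deriv k 0 = - deriv k 0" by (rule DERIV_unique)
  hence "deriv k 0 = 0" by simp
  with d have lim: "(\<lambda>z. k z / z) \<midarrow>0\<rightarrow> 0"
    using assms(3) by (simp add: has_field_derivative_iff)
  have "(\<lambda>z. (z - 0) * (k z / z\<^sup>2)) \<midarrow>0\<rightarrow> 0"
    by (rule Lim_transform_eventually[OF lim]) (auto simp: eventually_at_filter power2_eq_square)
  moreover have "(\<lambda>z. k z / z\<^sup>2) holomorphic_on ball 0 r - {0}"
    by (intro holomorphic_intros holomorphic_on_subset[OF assms(1)]) auto
  moreover have "0 \<in> interior (ball (0::complex) r)" using assms(2) by simp
  ultimately show ?thesis
    using holomorphic_on_extend_lim[of "\<lambda>z. k z / z\<^sup>2" "ball 0 r" 0]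
      holomorphic_on_extend_bounded[of "\<lambda>z. k z / z\<^sup>2" "ball 0 r" 0] by blast
qed

lemma half_period_notin:
  assumes "Im \<tau> > 0"
  shows "1 / 2 \<notin> lattice 1 \<tau>" "\<tau> / 2 \<notin> lattice r \<tau>" "\<tau> / 2 + 1 / 2 \<notin> lattice 1 \<tau>"
proof -
  show "\<tau> / 2 \<notin> lattice r \<tau>"
  proof
    assume "\<tau> / 2 \<in> lattice r \<tau>"
    then obtain m n where "\<tau> / 2 = of_int m * of_real r + of_int n * \<tau>" by (auto simp: lattice_def)
    hence "Im (\<tau> / 2) = Im (of_int m * of_real r + of_int n * \<tau>)" by (simp only:)
    hence "Im \<tau> / 2 = of_int n * Im \<tau>" by simp
    hence "(1/2 :: real) = of_int n" using assms by simp
    hence "(1 :: real) = of_int (2 * n)" by simp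
    hence "1 = 2 * n" by linarith
    thus False by presburger
  qed
  show "\<tau> / 2 + 1 / 2 \<notin> lattice 1 \<tau>"
  proof
    assume "\<tau> / 2 + 1 / 2 \<in> lattice 1 \<tau>"
    then obtain m n where e: "\<tau> / 2 + 1 / 2 = of_int m + of_int n * \<tau>" by (auto simp: lattice_def)
    have "Im (\<tau> / 2 + 1 / 2) = Im (of_int m + of_int n * \<tau>)" by (simp only: e)
    hence "Im \<tau> / 2 = of_int n * Im \<tau>" by simp
    hence "(1/2 :: real) = of_int n" using assms by simp
    hence "(1 :: real) = of_int (2 * n)" by simp
    hence "1 = 2 * n" by linarith
    thus False by presburger
  qed
  show "1 / 2 \<notin> lattice 1 \<tau>"
  proof
    assume "1 / 2 \<in> lattice 1 \<tau>"
    then obtain m n where e: "1 / 2 = of_int m + of_int n * \<tau>" by (auto simp: lattice_def)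
    have "Im (1 / 2) = Im (of_int m + of_int n * \<tau>)" "Re (1 / 2) = Re (of_int m + of_int n * \<tau>)" by (simp_all only: e)
    hence "n = 0" "(1/2 :: real) = of_int m + of_int n * Re \<tau>" using assms by simp_all
    hence "(1 :: real) = of_int (2 * m)" by simp
    hence "1 = 2 * m" by linarith
    thus False by presburger
  qed
qed

section \<open>Half-period values and the modular function\<close>

definition nome :: "complex \<Rightarrow> complex" where
  "nome \<tau> = exp (of_real pi * \<i> * \<tau>)"

definition e1 :: "complex \<Rightarrow> complex" where
  "e1 q = lambert_sum (q\<^sup>2) (- 1) + lambert_sum (q\<^sup>2) (- (q\<^sup>2))"

text \<open>Translation of \<tau> by 1 changes the sign of the nome, so the third half-period value
  is \<open>e2 (- q)\<close>.\<close>

definition e2 :: "complex \<Rightarrow> complex" where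
  "e2 q = 2 * lambert_sum (q\<^sup>2) q"

text \<open>This is 1 minus the classical modular function lambda, the cross ratio of the three
  half-period values and infinity. In terms of the nome the cusp becomes an interior point of the
  disc.\<close>

definition U :: "complex \<Rightarrow> complex" where
  "U q = (e1 q - e2 (- q)) / (e1 q - e2 q)"

lemma nome_nonzero [simp]: "nome \<tau> \<noteq> 0"
  by (simp add: nome_def)

lemma norm_nome: "norm (nome \<tau>) = exp (- pi * Im \<tau>)"
  by (simp add: nome_def)

lemma norm_nome_less_1 [simp]: "Im \<tau> > 0 \<Longrightarrow> norm (nome \<tau>) < 1"
  by (simp add: norm_nome)

lemma nome_square: "(nome \<tau>)\<^sup>2 = expi2 \<tau>"
  by (simp add: nome_def expi2_def exp_double[symmetric] mult_ac)

lemma nome_add_1: "nome (\<tau> + 1) = - nome \<tau>"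
proof -
  have "of_real pi * \<i> * (\<tau> + 1) = of_real pi * \<i> * \<tau> + of_real pi * \<i>"
    by (simp add: ring_distribs)
  thus ?thesis unfolding nome_def by (simp only: exp_add exp_pi_i mult_minus1_right)
qed

lemma nome_cnj: "nome (- cnj \<tau>) = cnj (nome \<tau>)"
  by (simp add: nome_def exp_cnj)

lemma wp_half_periods:
  assumes "Im \<tau> > 0"
  shows "wp \<tau> (1 / 2) = e1 (nome \<tau>)" "wp \<tau> (\<tau> / 2) = e2 (nome \<tau>)"
    "wp \<tau> (\<tau> / 2 + 1 / 2) = e2 (- nome \<tau>)"
proof -
  have h: "expi2 (1 / 2) = - 1" "expi2 (\<tau> / 2) = nome \<tau>"
    by (simp_all add: expi2_def nome_def exp_pi_i mult.assoc)
  have q: "nome \<tau> * nome \<tau> = expi2 \<tau>" using nome_square[of \<tau>] by (simp add: power2_eq_square)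
  show w1: "wp \<tau> (1 / 2) = e1 (nome \<tau>)"
    by (simp add: wp_def elliptic_sum_def e1_def h nome_square)
  show "wp \<tau> (\<tau> / 2) = e2 (nome \<tau>)"
    by (simp add: wp_def elliptic_sum_def e2_def h nome_square q[symmetric])
  show "wp \<tau> (\<tau> / 2 + 1 / 2) = e2 (- nome \<tau>)"
    unfolding wp_def expi2_add h
    by (simp add: elliptic_sum_def e2_def nome_square q[symmetric])
qed

lemma e1_minus: "e1 (- q) = e1 q"
  by (simp add: e1_def)

lemma norm_power_less_1:
  fixes q :: complex
  assumes "norm q < 1"
  shows "norm (q\<^sup>2) < 1" "norm (q * (q\<^sup>2) ^ n) < 1"
proof -
  show lt: "norm (q\<^sup>2) < 1" using assms by (simp add: norm_power power_less_one_iff)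
  have "norm ((q\<^sup>2) ^ n) \<le> 1" unfolding norm_power[of "q\<^sup>2"] using lt by (intro power_le_one) auto
  hence "norm q * norm ((q\<^sup>2) ^ n) \<le> norm q * 1" by (intro mult_left_mono) auto
  with assms show "norm (q * (q\<^sup>2) ^ n) < 1" by (simp add: norm_mult)
qed

lemma holomorphic_e2: "e2 holomorphic_on ball 0 1"
proof -
  have "(\<lambda>q. lambert_sum (q\<^sup>2) q) holomorphic_on ball 0 1"
  proof (rule holomorphic_lambert_sum)
    show "x * (x\<^sup>2) ^ n \<noteq> 1" if "x \<in> ball 0 1" for x :: complex and n
      using norm_power_less_1(2)[of x n] that by auto
  qed (use norm_power_less_1 in \<open>auto intro!: holomorphic_intros\<close>)
  thus ?thesis unfolding e2_def[abs_def] by (intro holomorphic_intros)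
qed

lemma holomorphic_e1: "e1 holomorphic_on ball 0 1"
  unfolding e1_def[abs_def]
proof (intro holomorphic_on_add holomorphic_lambert_sum)
  fix x :: complex and n assume x: "x \<in> ball 0 1"
  show "- 1 * (x\<^sup>2) ^ n \<noteq> 1"
  proof (cases n)
    case (Suc m)
    have "norm ((x\<^sup>2) ^ n) < 1"
      unfolding norm_power[of "x\<^sup>2"] using norm_power_less_1(1)[of x] x Suc by (subst power_less_one_iff) auto
    thus ?thesis by (metis mult_minus1 norm_minus_cancel norm_one less_irrefl)
  qed auto
  show "- (x\<^sup>2) * (x\<^sup>2) ^ n \<noteq> 1"
  proof -
    have "norm ((x\<^sup>2) ^ Suc n) < 1"
      unfolding norm_power[of "x\<^sup>2"] using norm_power_less_1(1)[of x] x by (subst power_less_one_iff) auto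
    thus ?thesis by (metis mult_minus_left power_Suc norm_minus_cancel norm_one less_irrefl)
  qed
qed (use norm_power_less_1 in \<open>auto intro!: holomorphic_intros\<close>)

lemma e_values_0: "e1 0 = - 1 / 4" "e2 0 = 0"
  by (simp_all add: e1_def e2_def lambert_sum_zero lambert_term_def)

text \<open>The argument replaces a count of zeros. The product \<open>R\<close> of
  \<open>wp - e\<close> with its translate by 1/2 has no pole left: the double pole of one factor
  meets the double zero of the other. So \<open>R\<close> is constant, and if the two values were
  equal, it would vanish at \<tau> / 2 and hence identically. Near 0 the factor with the pole is
  nonzero, so \<open>wp\<close> would equal e near 1/2 and, by analytic continuation, everywhere,
  against its pole.\<close>

lemma wp_values_distinct:
  assumes \<tau>: "Im \<tau> > 0"
  shows "wp \<tau> (\<tau> / 2) \<noteq> wp \<tau> (1 / 2)"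
proof
  let ?e = "wp \<tau> (1 / 2)"
  assume eq: "wp \<tau> (\<tau> / 2) = ?e"
  define R where "R = (\<lambda>z. (wp \<tau> z - ?e) * (wp \<tau> (z + 1 / 2) - ?e))"
  have sub: "z \<in> lattice (1 / 2) \<tau>" if "z \<in> lattice 1 \<tau>" for z
  proof -
    obtain m n where "z = of_int m + of_int n * \<tau>" using \<open>z \<in> lattice 1 \<tau>\<close> by (auto simp: lattice_def)
    hence "z = of_int (2 * m) * of_real (1/2) + of_int n * \<tau>" by simp
    thus ?thesis unfolding lattice_def by blast
  qed
  have sub2: "z + 1 / 2 \<notin> lattice 1 \<tau>" if "z \<notin> lattice (1 / 2) \<tau>" for z
    using sub[of "z + 1 / 2"] lattice_add_period1[of z "1/2" \<tau>] that by auto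
  have op: "open (- lattice 1 \<tau>)" using closed_lattice[OF _ \<tau>, of 1] by auto
  have holo2: "(\<lambda>z. wp \<tau> (z + 1 / 2)) holomorphic_on S" if "(\<lambda>z. z + 1 / 2) ` S \<subseteq> - lattice 1 \<tau>" for S
  proof -
    have "(wp \<tau> \<circ> (\<lambda>z. z + 1 / 2)) holomorphic_on S"
      by (rule holomorphic_on_compose_gen[OF _ holomorphic_wp[OF \<tau>] that]) (intro holomorphic_intros)
    thus ?thesis by (simp add: o_def)
  qed
  have holo: "R holomorphic_on - lattice (1 / 2) \<tau>"
    unfolding R_def
    by (intro holomorphic_intros holomorphic_on_subset[OF holomorphic_wp[OF \<tau>]] holo2)
       (use sub sub2 in auto)
  obtain r where r: "r > 0" "ball (1 / 2) r \<subseteq> - lattice 1 \<tau>"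
    using op half_period_notin(1)[OF \<tau>] open_contains_ball by (metis ComplI)
  \<comment> \<open>As \<open>wp\<close> is even with period 1, it is even about 1/2, so the zero of
    \<open>k\<close> at 0 is at least double.\<close>
  define k where "k = (\<lambda>z. wp \<tau> (z + 1 / 2) - ?e)"
  have k: "k holomorphic_on ball 0 r"
    unfolding k_def
  proof (intro holomorphic_intros holo2 image_subsetI)
    fix z :: complex assume "z \<in> ball 0 r"
    hence "z + 1 / 2 \<in> ball (1 / 2) r" by (simp add: dist_norm)
    thus "z + 1 / 2 \<in> - lattice 1 \<tau>" using r(2) by blast
  qed
  have "k (- z) = k z" for z
    using wp_minus[OF \<tau>, of "z - 1 / 2"] wp_add_1[of \<tau> "z - 1 / 2"]
    by (simp add: k_def) (simp add: algebra_simps)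
  then obtain B2 where B2: "\<forall>\<^sub>F z in at 0. norm (k z / z\<^sup>2) \<le> B2"
    using even_zero_order[OF k r(1)] by (auto simp: k_def)
  obtain B1 where B1: "\<forall>\<^sub>F z in at 0. norm (wp \<tau> z + 1 / (4 * of_real pi ^ 2 * z\<^sup>2)) \<le> B1"
    using wp_principal_part[OF \<tau>] by blast
  have lt1: "\<forall>\<^sub>F z in at (0::complex). norm z < 1"
    using eventually_at_in_open'[of "ball 0 1" "0::complex"] by simp
  have nz: "\<forall>\<^sub>F z in at (0::complex). z \<noteq> 0" by (rule eventually_neq_at_within)
  define C where "C = 1 / (4 * pi ^ 2)"
  have pb: "norm (z\<^sup>2 * (wp \<tau> z - ?e)) \<le> B1 + C + norm ?e"
    if "norm z < 1" "z \<noteq> 0" "norm (wp \<tau> z + 1 / (4 * of_real pi ^ 2 * z\<^sup>2)) \<le> B1" for z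
  proof -
    have "z\<^sup>2 * (wp \<tau> z - ?e) = z\<^sup>2 * ((wp \<tau> z + 1 / (4 * of_real pi ^ 2 * z\<^sup>2)) - ?e) - of_real C"
      using that(2) by (simp add: C_def field_simps)
    also have "norm \<dots> \<le> norm (z\<^sup>2 * ((wp \<tau> z + 1 / (4 * of_real pi ^ 2 * z\<^sup>2)) - ?e)) + norm (complex_of_real C)"
      by (rule norm_triangle_ineq4)
    also have "norm (complex_of_real C) = C" by (simp add: C_def norm_divide norm_mult norm_power)
    also have "norm (z\<^sup>2 * ((wp \<tau> z + 1 / (4 * of_real pi ^ 2 * z\<^sup>2)) - ?e)) \<le> 1 * (B1 + norm ?e)"
      unfolding norm_mult
    proof (rule mult_mono)
      show "norm (z\<^sup>2) \<le> 1" using that(1) by (simp add: norm_power abs_square_le_1)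
      show "norm ((wp \<tau> z + 1 / (4 * of_real pi ^ 2 * z\<^sup>2)) - ?e) \<le> B1 + norm ?e"
        using norm_triangle_ineq4[of "wp \<tau> z + 1 / (4 * of_real pi ^ 2 * z\<^sup>2)" ?e] that(3) by linarith
    qed auto
    finally show ?thesis by simp
  qed
  have bdd: "\<forall>\<^sub>F z in at 0. norm (R z) \<le> (B1 + C + norm ?e) * B2"
    using B1 B2 lt1 nz
  proof eventually_elim
    case (elim z)
    have "R z = (z\<^sup>2 * (wp \<tau> z - ?e)) * (k z / z\<^sup>2)" using elim by (simp add: R_def k_def)
    hence "norm (R z) = norm (z\<^sup>2 * (wp \<tau> z - ?e)) * norm (k z / z\<^sup>2)" by (simp only: norm_mult)
    also have "\<dots> \<le> (B1 + C + norm ?e) * B2"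
      using pb[OF elim(3,4,1)] elim(2) by (intro mult_mono) (auto intro: order_trans[OF norm_ge_zero])
    finally show ?case .
  qed
  have p1: "R (z + of_real (1 / 2)) = R z" for z
    using wp_add_1[of \<tau> z] by (simp add: R_def mult.commute add.assoc)
  have p2: "R (z + \<tau>) = R z" for z
    using wp_add_\<tau>[OF \<tau>, of z] wp_add_\<tau>[OF \<tau>, of "z + 1 / 2"] by (simp add: R_def algebra_simps)
  obtain c where c: "\<And>z. z \<notin> lattice (1 / 2) \<tau> \<Longrightarrow> R z = c"
    using bounded_elliptic_constant[OF _ \<tau> holo p1 p2 bdd] by auto
  have "R (\<tau> / 2) = 0" by (simp add: R_def eq)
  hence R0: "R z = 0" if "z \<notin> lattice (1 / 2) \<tau>" for z
    using c half_period_notin(2)[OF \<tau>] that by metis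
  \<comment> \<open>Close to 0 the principal part has modulus \<open>C / norm z ^ 2\<close>, more
    than the bounded remainder can compensate.\<close>
  have large: "\<forall>\<^sub>F z in at 0. wp \<tau> z \<noteq> ?e"
  proof -
    have "((\<lambda>z. norm z ^ 2 * (B1 + norm ?e)) \<longlongrightarrow> 0 ^ 2 * (B1 + norm ?e)) (at (0::complex))"
      by (intro tendsto_intros tendsto_norm_zero)
    hence "\<forall>\<^sub>F z in at (0::complex). norm z ^ 2 * (B1 + norm ?e) < C"
      by (rule order_tendstoD) (auto simp: C_def)
    thus ?thesis using B1 nz
    proof eventually_elim
      case (elim z)
      show ?case
      proof
        assume e: "wp \<tau> z = ?e"
        have "1 / (4 * of_real pi ^ 2 * z\<^sup>2) = (?e + 1 / (4 * of_real pi ^ 2 * z\<^sup>2)) - ?e" by simp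
        hence "norm (1 / (4 * of_real pi ^ 2 * z\<^sup>2)) \<le> B1 + norm ?e"
          using norm_triangle_ineq4[of "?e + 1 / (4 * of_real pi ^ 2 * z\<^sup>2)" ?e] elim(2) e by simp
        hence "norm z ^ 2 * norm (1 / (4 * of_real pi ^ 2 * z\<^sup>2)) \<le> norm z ^ 2 * (B1 + norm ?e)"
          by (rule mult_left_mono) simp
        moreover have "norm z ^ 2 * norm (1 / (4 * of_real pi ^ 2 * z\<^sup>2)) = C"
          using elim(3) by (simp add: C_def norm_divide norm_mult norm_power field_simps)
        ultimately show False using elim(1) by simp
      qed
    qed
  qed
  have off: "\<forall>\<^sub>F z in at 0. z \<notin> lattice (1 / 2) \<tau>"
    using eventually_notin_lattice[OF _ \<tau>, of "1/2" 0] by simp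
  have ev: "\<forall>\<^sub>F z in at 0. wp \<tau> (z + 1 / 2) = ?e"
    using large off by eventually_elim (use R0 in \<open>auto simp: R_def\<close>)
  have conn: "connected (- lattice 1 \<tau>)"
    using connected_open_diff_countable[of "UNIV :: complex set" "lattice 1 \<tau>"] countable_lattice connected_UNIV
    by (simp add: Compl_eq_Diff_UNIV)
  define Z where "Z = {z \<in> - lattice 1 \<tau>. wp \<tau> z - ?e = 0}"
  have "\<forall>\<^sub>F z in at (1/2). z \<in> Z"
  proof -
    have "\<forall>\<^sub>F z in at 0. wp \<tau> (z + 1 / 2) = ?e \<and> z + 1 / 2 \<notin> lattice 1 \<tau>"
      using ev off by eventually_elim (use sub2 in auto)
    hence "\<forall>\<^sub>F z in at (1/2). wp \<tau> z = ?e \<and> z \<notin> lattice 1 \<tau>"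
      by (subst at_to_0) (auto simp: eventually_filtermap)
    thus ?thesis by eventually_elim (auto simp: Z_def)
  qed
  hence islim: "(1/2) islimpt Z"
    by (auto simp: islimpt_conv_frequently_at intro!: eventually_frequently)
  have "wp \<tau> z - ?e = 0" if "z \<in> - lattice 1 \<tau>" for z
    by (rule analytic_continuation[of "\<lambda>z. wp \<tau> z - ?e" "- lattice 1 \<tau>" Z "1/2"])
       (use op conn islim that half_period_notin(1)[OF \<tau>] in
         \<open>auto simp: Z_def intro!: holomorphic_intros holomorphic_wp[OF \<tau>]\<close>)
  moreover have "\<forall>\<^sub>F z in at 0. z \<notin> lattice 1 \<tau>"
    using eventually_notin_lattice[OF _ \<tau>, of 1 0] by simp
  ultimately have "\<forall>\<^sub>F z in at 0. wp \<tau> z = ?e" by (auto elim: eventually_mono)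
  with large have "\<forall>\<^sub>F z in at (0::complex). False" by eventually_elim auto
  thus False by (simp add: trivial_limit_at)
qed

text \<open>Division by \<tau> exchanges the half periods 1/2 and \<tau> / 2 and preserves the
  third, up to sign and periods of the new lattice; the additive constant of the transformation
  cancels in differences.\<close>

lemma e_differences_S:
  assumes \<tau>: "Im \<tau> > 0"
  defines "q \<equiv> nome \<tau>" and "q' \<equiv> nome (- 1 / \<tau>)"
  shows "e1 q' - e2 q' = \<tau>\<^sup>2 * (e2 q - e1 q)" "e1 q' - e2 (- q') = \<tau>\<^sup>2 * (e2 q - e2 (- q))"
    "e2 q' - e2 (- q') = \<tau>\<^sup>2 * (e1 q - e2 (- q))"
proof -
  have t: "\<tau> \<noteq> 0" using \<tau> by auto
  define \<sigma> where "\<sigma> = - 1 / \<tau>"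
  have \<sigma>: "Im \<sigma> > 0" using Im_S[OF \<tau>] by (simp add: \<sigma>_def)
  obtain c where c: "\<And>z. z \<notin> lattice 1 \<tau> \<Longrightarrow> wp \<tau> z = wp \<sigma> (z / \<tau>) / \<tau>\<^sup>2 + c"
    using wp_S[OF \<tau>] unfolding \<sigma>_def by metis
  note w = wp_half_periods[OF \<tau>] wp_half_periods[OF \<sigma>]
  have h: "1 / 2 / \<tau> = - (\<sigma> / 2)" "\<tau> / 2 / \<tau> = 1 / 2" using t by (auto simp: \<sigma>_def)
  have h3: "(\<tau> / 2 + 1 / 2) / \<tau> = - (\<sigma> / 2 + 1 / 2) + 1" using t by (simp add: \<sigma>_def field_simps)
  have *: "e1 q = e2 q' / \<tau>\<^sup>2 + c" "e2 q = e1 q' / \<tau>\<^sup>2 + c" "e2 (- q) = e2 (- q') / \<tau>\<^sup>2 + c"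
    using c[OF half_period_notin(1)[OF \<tau>]] c[OF half_period_notin(2)[OF \<tau>]] c[OF half_period_notin(3)[OF \<tau>]]
    unfolding h h3 w wp_minus[OF \<sigma>] wp_add_1 q_def q'_def \<sigma>_def[symmetric] by auto
  show "e1 q' - e2 q' = \<tau>\<^sup>2 * (e2 q - e1 q)" "e1 q' - e2 (- q') = \<tau>\<^sup>2 * (e2 q - e2 (- q))"
    "e2 q' - e2 (- q') = \<tau>\<^sup>2 * (e1 q - e2 (- q))"
    unfolding * using t by (simp_all add: field_simps)
qed

lemma e1_neq_e2_nome: "Im \<tau> > 0 \<Longrightarrow> e1 (nome \<tau>) \<noteq> e2 (nome \<tau>)"
  using wp_values_distinct[of \<tau>] by (simp add: wp_half_periods)

lemma nome_surj:
  assumes "norm q < 1" "q \<noteq> 0"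
  obtains \<tau> where "Im \<tau> > 0" "nome \<tau> = q"
proof -
  define \<tau> where "\<tau> = Ln q / (of_real pi * \<i>)"
  have "nome \<tau> = q" using assms by (simp add: nome_def \<tau>_def)
  moreover have "Im \<tau> > 0"
  proof -
    have "exp (- pi * Im \<tau>) < exp 0" using assms(1) \<open>nome \<tau> = q\<close> norm_nome[of \<tau>] by simp
    hence "- pi * Im \<tau> < 0" by (subst (asm) exp_less_cancel_iff)
    thus ?thesis by (simp add: zero_less_mult_iff)
  qed
  ultimately show ?thesis using that by blast
qed

lemma e1_neq_e2:
  assumes "norm q < 1"
  shows "e1 q \<noteq> e2 q"
proof (cases "q = 0")
  case True thus ?thesis by (simp add: e_values_0)
next
  case False
  thus ?thesis using nome_surj[OF assms] e1_neq_e2_nome by metis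
qed

text \<open>The substitution of -1 / \<tau> turns this pair of values into the pair of
  \<open>e1_neq_e2\<close>, taken at the negative of the new nome.\<close>

lemma e2_neq_minus:
  assumes "norm q < 1" "q \<noteq> 0"
  shows "e2 q \<noteq> e2 (- q)"
proof -
  obtain \<tau> where t: "Im \<tau> > 0" "nome \<tau> = q" using nome_surj[OF assms] by metis
  have "Im (- 1 / \<tau>) > 0" by (rule Im_S[OF t(1)])
  hence "e1 (- nome (- 1 / \<tau>)) \<noteq> e2 (- nome (- 1 / \<tau>))"
    by (intro e1_neq_e2) simp
  thus ?thesis using e_differences_S(2)[OF t(1)] t by (auto simp: e1_minus)
qed

lemma U_minus: "U (- q) = 1 / U q"
  by (simp add: U_def e1_minus)

lemma U_nonzero: "norm q < 1 \<Longrightarrow> U q \<noteq> 0"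
  using e1_neq_e2[of q] e1_neq_e2[of "-q"] by (simp add: U_def e1_minus)

lemma U_neq_1: "norm q < 1 \<Longrightarrow> q \<noteq> 0 \<Longrightarrow> U q \<noteq> 1"
  using e1_neq_e2[of q] e2_neq_minus[of q] by (auto simp: U_def)

lemma U_0: "U 0 = 1"
  by (simp add: U_def e_values_0)

lemma U_S:
  assumes "Im \<tau> > 0"
  shows "U (nome (- 1 / \<tau>)) = 1 - U (nome \<tau>)"
proof -
  have "\<tau> \<noteq> 0" using assms by auto
  thus ?thesis
    unfolding U_def e_differences_S[OF assms] using e1_neq_e2_nome[OF assms]
    by (simp add: field_simps)
qed

lemma e_cnj: "norm q < 1 \<Longrightarrow> e1 (cnj q) = cnj (e1 q)" "norm q < 1 \<Longrightarrow> e2 (cnj q) = cnj (e2 q)"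
  using lambert_sum_cnj[of "q\<^sup>2"] norm_power_less_1(1)[of q]
  by (auto simp: e1_def e2_def simp flip: lambert_sum_cnj)

lemma U_cnj: "norm q < 1 \<Longrightarrow> U (cnj q) = cnj (U q)"
  using e_cnj[of q] e_cnj[of "- q"] by (simp add: U_def)

lemma holomorphic_e2_minus: "(\<lambda>q. e2 (- q)) holomorphic_on ball 0 1"
proof -
  have "(e2 \<circ> uminus) holomorphic_on ball 0 1"
    by (rule holomorphic_on_compose_gen[OF _ holomorphic_e2]) (auto intro: holomorphic_intros)
  thus ?thesis by (simp add: o_def)
qed

lemma holomorphic_U: "U holomorphic_on ball 0 1"
  unfolding U_def[abs_def] using e1_neq_e2
  by (intro holomorphic_intros holomorphic_e1 holomorphic_e2 holomorphic_e2_minus) auto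

text \<open>Only the first term of the series contributes to first order; the arguments of the
  others are q^3, q^5 and so on.\<close>

lemma deriv_e2_0: "(e2 has_field_derivative 2) (at 0)"
proof -

  have tail: "norm (lambert_sum (q\<^sup>2) (q * q\<^sup>2)) \<le> 8 * norm q ^ 3" if q: "norm q \<le> 1 / 2" for q :: complex
  proof -
    have le: "norm (lambert_term (q * q\<^sup>2 * (q\<^sup>2) ^ n)) \<le> 4 * norm q ^ 3 * (1 / 4) ^ n" for n
    proof -
      have "norm (q * q\<^sup>2 * (q\<^sup>2) ^ n) = norm q ^ 3 * (norm q ^ 2) ^ n"
        by (simp add: norm_mult norm_power power3_eq_cube power2_eq_square)
      moreover have "(norm q ^ 2) ^ n \<le> (1 / 4) ^ n"
        using power_mono[OF q, of 2] by (intro power_mono) (auto simp: power2_eq_square)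
      ultimately have le: "norm (q * q\<^sup>2 * (q\<^sup>2) ^ n) \<le> norm q ^ 3 * (1 / 4) ^ n"
        by (simp add: mult_left_mono)
      also have "\<dots> \<le> (1 / 2) ^ 3 * 1"
        using q by (intro mult_mono power_mono power_le_one) auto
      also have "\<dots> \<le> 1 / 2" by (simp add: power3_eq_cube)
      finally have "norm (q * q\<^sup>2 * (q\<^sup>2) ^ n) \<le> 1 / 2" .
      from norm_lambert_term_le[OF this] le show ?thesis by linarith
    qed
    have s: "(\<lambda>n. 4 * norm q ^ 3 * (1 / 4) ^ n) sums (4 * norm q ^ 3 * (1 / (1 - 1 / 4)))"
      by (intro sums_mult geometric_sums) auto
    have "norm (lambert_sum (q\<^sup>2) (q * q\<^sup>2)) \<le> (\<Sum>n. 4 * norm q ^ 3 * (1 / 4) ^ n)"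
      unfolding lambert_sum_def by (rule norm_suminf_le[OF le sums_summable[OF s]])
    also have "\<dots> = 4 * norm q ^ 3 * (4 / 3)" using s by (simp add: sums_iff)
    also have "\<dots> \<le> 8 * norm q ^ 3" by simp
    finally show ?thesis .
  qed
  have sm: "\<forall>\<^sub>F q in at (0::complex). norm q < 1 / 2"
    using eventually_at_in_open'[of "ball 0 (1/2)" "0::complex"] by simp
  have nz: "\<forall>\<^sub>F q in at (0::complex). q \<noteq> 0" by (rule eventually_neq_at_within)
  have t0: "((\<lambda>q. 2 * lambert_sum (q\<^sup>2) (q * q\<^sup>2) / q) \<longlongrightarrow> 0) (at (0::complex))"
  proof (rule Lim_null_comparison)
    show "((\<lambda>q. 16 * norm q ^ 2) \<longlongrightarrow> 0) (at (0::complex))"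
      by (rule tendsto_eq_intros refl tendsto_norm_zero)+ simp
    show "\<forall>\<^sub>F q in at (0::complex). norm (2 * lambert_sum (q\<^sup>2) (q * q\<^sup>2) / q) \<le> 16 * norm q ^ 2"
      using sm nz
    proof eventually_elim
      case (elim q)
      have "norm (lambert_sum (q\<^sup>2) (q * q\<^sup>2)) / norm q \<le> 8 * norm q ^ 3 / norm q"
        using tail[of q] elim by (intro divide_right_mono) auto
      also have "\<dots> = 8 * norm q ^ 2" using elim by (simp add: power2_eq_square power3_eq_cube)
      finally show ?case by (simp add: norm_divide norm_mult)
    qed
  qed
  have "((\<lambda>q. 2 / (1 - q)\<^sup>2 + 2 * lambert_sum (q\<^sup>2) (q * q\<^sup>2) / q) \<longlongrightarrow> 2 / (1 - 0)\<^sup>2 + 0) (at (0::complex))"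
    by (intro tendsto_intros t0) auto
  hence "((\<lambda>q. (e2 q - e2 0) / (q - 0)) \<longlongrightarrow> 2 / (1 - 0)\<^sup>2 + 0) (at 0)"
  proof (rule Lim_transform_eventually)
    show "\<forall>\<^sub>F q in at 0. 2 / (1 - q)\<^sup>2 + 2 * lambert_sum (q\<^sup>2) (q * q\<^sup>2) / q = (e2 q - e2 0) / (q - 0)"
      using sm nz
    proof eventually_elim
      case (elim q)
      have "lambert_sum (q\<^sup>2) q = q / (1 - q)\<^sup>2 + lambert_sum (q\<^sup>2) (q * q\<^sup>2)"
        using lambert_sum_shift[of "q\<^sup>2" q] norm_power_less_1(1)[of q] elim by (simp add: lambert_term_def)
      thus ?case using elim(2) by (simp add: e_values_0) (simp add: e2_def field_simps)
    qed
  qed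
  thus ?thesis by (simp add: has_field_derivative_iff)
qed

text \<open>The derivative of \<open>e1\<close> cancels in the quotient rule; with
  \<open>e1 0 = - 1 / 4\<close> there remains 4 / (- 1 / 4).\<close>

lemma deriv_U_0: "(U has_field_derivative - 16) (at 0)"
proof -
  have d1: "(e1 has_field_derivative deriv e1 0) (at 0)"
    by (rule holomorphic_derivI[OF holomorphic_e1]) auto
  have d2: "((\<lambda>q. e2 (- q)) has_field_derivative 2 * (- 1)) (at 0)"
    by (rule DERIV_chain2[of e2 _ uminus]) (use deriv_e2_0 in \<open>auto intro!: derivative_eq_intros\<close>)
  show ?thesis
    unfolding U_def[abs_def]
    by (rule derivative_eq_intros d1 d2 deriv_e2_0 refl)+ (auto simp: e_values_0 field_simps)
qed

section \<open>Absence of critical points of the modular function\<close>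

text \<open>This is lambda divided by the nome, completed by the leading coefficient 16 of lambda at
  the cusp. Its point is that it has no zero in the whole disc.\<close>

definition V :: "complex \<Rightarrow> complex" where
  "V q = (if q = 0 then 16 else (1 - U q) / q)"

lemma V_eq: "1 - U q = q * V q"
  by (simp add: V_def U_0)

lemma holomorphic_V: "V holomorphic_on ball 0 1"
proof -
  have d: "deriv (\<lambda>q. 1 - U q) 0 = 16"
    by (rule DERIV_imp_deriv) (auto intro!: derivative_eq_intros deriv_U_0)
  have "(\<lambda>z. if z = 0 then deriv (\<lambda>q. 1 - U q) 0 else ((1 - U z) - (1 - U 0)) / (z - 0)) holomorphic_on ball 0 1"
    by (rule pole_lemma) (auto intro!: holomorphic_intros holomorphic_U)
  moreover have "(\<lambda>z. if z = 0 then deriv (\<lambda>q. 1 - U q) 0 else ((1 - U z) - (1 - U 0)) / (z - 0)) = V"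
    unfolding d by (auto simp: V_def U_0)
  ultimately show ?thesis by simp
qed

lemma V_nonzero: "norm q < 1 \<Longrightarrow> V q \<noteq> 0"
  using U_neq_1[of q] by (auto simp: V_def)

lemma V_cnj: "norm q < 1 \<Longrightarrow> V (cnj q) = cnj (V q)"
  by (simp add: V_def U_cnj)

text \<open>\<open>Phi\<close> turns out to be invariant under the modular group, so its modulus attains a maximum and
  \<open>Phi\<close> is constant; hence the derivative of the modular function \<open>u\<close> has no zeros.\<close>

definition Phi :: "complex \<Rightarrow> complex" where
  "Phi q = deriv U q / (U q * V q * (e1 q - e2 q))"

lemma holomorphic_Phi: "Phi holomorphic_on ball 0 1"
  unfolding Phi_def[abs_def] using U_nonzero V_nonzero e1_neq_e2
  by (intro holomorphic_intros holomorphic_U holomorphic_V holomorphic_e1 holomorphic_e2) auto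

lemma Phi_0: "Phi 0 = 4"
proof -
  have "deriv U 0 = - 16" by (rule DERIV_imp_deriv[OF deriv_U_0])
  thus ?thesis by (simp add: Phi_def U_0 V_def e_values_0)
qed

lemma deriv_U: "norm q < 1 \<Longrightarrow> (U has_field_derivative deriv U q) (at q)"
  by (rule holomorphic_derivI[OF holomorphic_U]) auto

lemma Phi_minus:
  assumes "norm q < 1"
  shows "Phi (- q) = Phi q"
proof (cases "q = 0")
  case False
  have nz: "U q \<noteq> 0" "V q \<noteq> 0" "e1 q - e2 q \<noteq> 0" "e1 q - e2 (- q) \<noteq> 0"
    using U_nonzero V_nonzero e1_neq_e2[of q] e1_neq_e2[of "- q"] assms by (auto simp: e1_minus)
  have "((\<lambda>q. U (- q)) has_field_derivative deriv U (- q) * (- 1)) (at q)"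
    by (rule DERIV_chain2[of U _ uminus]) (use deriv_U[of "-q"] assms in \<open>auto intro!: derivative_eq_intros\<close>)
  moreover have "((\<lambda>q. 1 / U q) has_field_derivative - deriv U q / (U q)\<^sup>2) (at q)"
    using nz by (auto intro!: derivative_eq_intros deriv_U assms simp: power2_eq_square)
  ultimately have d: "deriv U (- q) * (- 1) = - deriv U q / (U q)\<^sup>2"
    unfolding U_minus by (rule DERIV_unique)
  hence d: "deriv U (- q) = deriv U q / (U q)\<^sup>2" by simp
  have v: "V (- q) = V q / U q" using False nz by (simp add: V_def U_minus field_simps)
  have e: "e1 q - e2 (- q) = U q * (e1 q - e2 q)" using nz by (simp add: U_def)
  show ?thesis
    unfolding Phi_def d v e1_minus e U_minus using nz by (simp add: field_simps power2_eq_square)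
qed auto

definition u :: "complex \<Rightarrow> complex" where
  "u \<tau> = U (nome \<tau>)"

definition upper_half :: "complex set" where
  "upper_half = {\<tau>. Im \<tau> > 0}"

lemma open_upper_half: "open upper_half"
  unfolding upper_half_def by (rule open_halfspace_Im_gt)

lemma convex_upper_half: "convex upper_half"
  unfolding upper_half_def by (rule convex_halfspace_Im_gt)

lemma deriv_nome: "(nome has_field_derivative of_real pi * \<i> * nome \<tau>) (at \<tau>)"
  unfolding nome_def[abs_def] by (auto intro!: derivative_eq_intros)

lemma deriv_u:
  assumes "Im \<tau> > 0"
  shows "(u has_field_derivative deriv U (nome \<tau>) * (of_real pi * \<i> * nome \<tau>)) (at \<tau>)"
  unfolding u_def[abs_def]
  by (rule DERIV_chain2[of U _ nome, OF deriv_U deriv_nome]) (use assms in auto)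

lemma u_S: "Im \<tau> > 0 \<Longrightarrow> u (- 1 / \<tau>) = 1 - u \<tau>"
  unfolding u_def by (rule U_S)

lemma u_T: "u (\<tau> + 1) = 1 / u \<tau>"
  by (simp add: u_def nome_add_1 U_minus)

lemma u_range: "Im \<tau> > 0 \<Longrightarrow> u \<tau> \<in> - {0, 1}"
  using U_nonzero[of "nome \<tau>"] U_neq_1[of "nome \<tau>"] by (simp add: u_def)

text \<open>As functions of \<tau>, both \<open>q * deriv U q\<close> and \<open>e1 q - e2 q\<close>
  are multiplied by \<open>- \<tau>\<^sup>2\<close>, so their quotient is unchanged. The remaining
  factors \<open>U q\<close> and \<open>q * V q = 1 - U q\<close> are exchanged.\<close>

lemma Phi_S:
  assumes \<tau>: "Im \<tau> > 0"
  shows "Phi (nome (- 1 / \<tau>)) = Phi (nome \<tau>)"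
proof -
  define \<sigma> where "\<sigma> = - 1 / \<tau>"
  have \<sigma>: "Im \<sigma> > 0" using Im_S[OF \<tau>] by (simp add: \<sigma>_def)
  have t: "\<tau> \<noteq> 0" using \<tau> by auto
  define p where "p = nome \<sigma>"
  define q where "q = nome \<tau>"
  have lt: "norm p < 1" "norm q < 1" "p \<noteq> 0" "q \<noteq> 0" using \<tau> \<sigma> by (auto simp: p_def q_def)
  have dS: "((\<lambda>\<tau>. - 1 / \<tau>) has_field_derivative 1 / \<tau>\<^sup>2) (at \<tau>)"
    using t by (auto intro!: derivative_eq_intros simp: power2_eq_square field_simps)
  have "((\<lambda>\<tau>. u (- 1 / \<tau>)) has_field_derivative (deriv U p * (of_real pi * \<i> * p)) * (1 / \<tau>\<^sup>2)) (at \<tau>)"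
    using deriv_u[OF \<sigma>] unfolding p_def
    by (intro DERIV_chain2[of u _ "\<lambda>\<tau>. - 1 / \<tau>", OF _ dS]) (simp add: \<sigma>_def)
  moreover have "((\<lambda>\<tau>. u (- 1 / \<tau>)) has_field_derivative - (deriv U q * (of_real pi * \<i> * q))) (at \<tau>)"
  proof (rule has_field_derivative_transform_within_open[where S = upper_half])
    show "((\<lambda>\<tau>. 1 - u \<tau>) has_field_derivative - (deriv U q * (of_real pi * \<i> * q))) (at \<tau>)"
      using deriv_u[OF \<tau>] unfolding q_def by (auto intro!: derivative_eq_intros)
  qed (use \<tau> u_S open_upper_half in \<open>auto simp: upper_half_def\<close>)
  ultimately have "(deriv U p * (of_real pi * \<i> * p)) * (1 / \<tau>\<^sup>2) = - (deriv U q * (of_real pi * \<i> * q))"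
    by (rule DERIV_unique)
  hence "(of_real pi * \<i>) * (deriv U p * p) = (of_real pi * \<i>) * (- (\<tau>\<^sup>2 * (deriv U q * q)))"
    using t by (simp add: field_simps)
  hence d: "deriv U p * p = - (\<tau>\<^sup>2 * (deriv U q * q))"
    by (subst (asm) mult_cancel_left) simp
  have Us: "U p = 1 - U q" using U_S[OF \<tau>] by (simp add: p_def q_def \<sigma>_def)
  have es: "e1 p - e2 p = - (\<tau>\<^sup>2 * (e1 q - e2 q))"
    using e_differences_S(1)[OF \<tau>] by (simp add: p_def q_def \<sigma>_def algebra_simps)
  have ph: "Phi x = (deriv U x * x) / (U x * (1 - U x) * (e1 x - e2 x))" if "x \<noteq> 0" for x
    using that by (simp add: Phi_def V_eq)
  have "Phi p = Phi q"
    unfolding ph[OF lt(3)] ph[OF lt(4)] d es Us using t by (simp add: mult_ac)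
  thus ?thesis by (simp add: p_def q_def \<sigma>_def)
qed

subsection \<open>Reduction to a fundamental domain\<close>

text \<open>Generated by the elementary steps, so that invariance statements are proved by
  induction; the matrix form enters only where heights in the orbit are counted.\<close>

inductive modular_orbit :: "complex \<Rightarrow> complex \<Rightarrow> bool" for \<tau> where
  orbit_refl: "modular_orbit \<tau> \<tau>"
| orbit_plus: "modular_orbit \<tau> x \<Longrightarrow> modular_orbit \<tau> (x + 1)"
| orbit_minus: "modular_orbit \<tau> x \<Longrightarrow> modular_orbit \<tau> (x - 1)"
| orbit_inv: "modular_orbit \<tau> x \<Longrightarrow> modular_orbit \<tau> (- 1 / x)"

lemma modular_orbit_upper_half: "modular_orbit \<tau> x \<Longrightarrow> Im \<tau> > 0 \<Longrightarrow> Im x > 0"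
proof (induction rule: modular_orbit.induct)
  case (orbit_inv x)
  thus ?case by (intro Im_S)
qed auto

lemma linear_form_nonzero:
  assumes "Im \<tau> > 0" "c \<noteq> 0 \<or> d \<noteq> (0::int)"
  shows "of_int c * \<tau> + of_int d \<noteq> 0"
proof
  assume e: "of_int c * \<tau> + of_int d = 0"
  hence "Im (of_int c * \<tau> + of_int d) = 0" by simp
  hence "c = 0" using assms(1) by simp
  with e assms(2) show False by simp
qed

lemma modular_orbit_moebius:
  assumes "modular_orbit \<tau> x" "Im \<tau> > 0"
  shows "\<exists>a b c d :: int. a * d - b * c = 1 \<and> x = (of_int a * \<tau> + of_int b) / (of_int c * \<tau> + of_int d)"
  using assms(1)
proof (induction rule: modular_orbit.induct)
  case orbit_refl
  show ?case by (intro exI[of _ 1] exI[of _ 0]) auto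
next
  case (orbit_plus x)
  then obtain a b c d :: int where *: "a * d - b * c = 1" "x = (of_int a * \<tau> + of_int b) / (of_int c * \<tau> + of_int d)" by blast
  have nz: "of_int c * \<tau> + of_int d \<noteq> 0" using *(1) by (intro linear_form_nonzero assms) auto
  show ?case
    by (intro exI[of _ "a + c"] exI[of _ "b + d"] exI[of _ c] exI[of _ d]) (use * nz in \<open>auto simp: field_simps\<close>)
next
  case (orbit_minus x)
  then obtain a b c d :: int where *: "a * d - b * c = 1" "x = (of_int a * \<tau> + of_int b) / (of_int c * \<tau> + of_int d)" by blast
  have nz: "of_int c * \<tau> + of_int d \<noteq> 0" using *(1) by (intro linear_form_nonzero assms) auto
  show ?case
    by (intro exI[of _ "a - c"] exI[of _ "b - d"] exI[of _ c] exI[of _ d]) (use * nz in \<open>auto simp: field_simps\<close>)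
next
  case (orbit_inv x)
  then obtain a b c d :: int where *: "a * d - b * c = 1" "x = (of_int a * \<tau> + of_int b) / (of_int c * \<tau> + of_int d)" by blast
  have nz: "of_int a * \<tau> + of_int b \<noteq> 0" using *(1) by (intro linear_form_nonzero assms) auto
  show ?case
    by (intro exI[of _ "- c"] exI[of _ "- d"] exI[of _ a] exI[of _ b]) (use * nz in \<open>auto simp: field_simps\<close>)
qed

lemma Im_moebius:
  fixes a b c d :: real
  assumes "a * d - b * c = 1" "of_real c * \<tau> + of_real d \<noteq> 0"
  shows "Im ((of_real a * \<tau> + of_real b) / (of_real c * \<tau> + of_real d)) = Im \<tau> / (norm (of_real c * \<tau> + of_real d))\<^sup>2"
proof -
  let ?w = "of_real c * \<tau> + of_real d"
  have "Im ((of_real a * \<tau> + of_real b) / ?w)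
      = (Im (of_real a * \<tau> + of_real b) * Re ?w - Re (of_real a * \<tau> + of_real b) * Im ?w) / (norm ?w)\<^sup>2"
    by (simp add: Im_divide cmod_power2)
  also have "Im (of_real a * \<tau> + of_real b) * Re ?w - Re (of_real a * \<tau> + of_real b) * Im ?w = (a * d - b * c) * Im \<tau>"
    by (simp add: algebra_simps)
  finally show ?thesis using assms by simp
qed

lemma finite_small_linear_forms:
  assumes "Im \<tau> > 0"
  shows "finite {(c, d). norm (of_int (c::int) * \<tau> + of_int (d::int)) \<le> 1}"
proof (rule finite_subset)
  define C where "C = \<lceil>1 / Im \<tau>\<rceil>"
  define D where "D = \<lceil>1 + \<bar>of_int C * Re \<tau>\<bar>\<rceil>"
  show "finite ({-C..C} \<times> {-D..D})" by simp
  show "{(c, d). norm (of_int (c::int) * \<tau> + of_int (d::int)) \<le> 1} \<subseteq> {-C..C} \<times> {-D..D}"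
  proof clarify
    fix c d :: int
    assume le: "norm (of_int c * \<tau> + of_int d) \<le> 1"
    have "\<bar>Im (of_int c * \<tau> + of_int d)\<bar> \<le> 1" using abs_Im_le_cmod[of "of_int c * \<tau> + of_int d"] le by linarith
    hence "\<bar>of_int c\<bar> * Im \<tau> \<le> 1" using assms by (simp add: abs_mult)
    hence "\<bar>of_int c\<bar> \<le> 1 / Im \<tau>" using assms by (simp add: field_simps)
    hence c: "\<bar>c\<bar> \<le> C" unfolding C_def by linarith
    have "\<bar>Re (of_int c * \<tau> + of_int d)\<bar> \<le> 1" using abs_Re_le_cmod[of "of_int c * \<tau> + of_int d"] le by linarith
    hence "\<bar>of_int d\<bar> \<le> 1 + \<bar>of_int c * Re \<tau>\<bar>" by simp
    also have "\<bar>of_int c * Re \<tau>\<bar> \<le> \<bar>of_int C * Re \<tau>\<bar>"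
      using c unfolding abs_mult by (intro mult_right_mono) auto
    finally have "\<bar>d\<bar> \<le> D" unfolding D_def by linarith
    with c show "c \<in> {-C..C} \<and> d \<in> {-D..D}" by auto
  qed
qed

lemma modular_orbit_translate: "modular_orbit \<tau> x \<Longrightarrow> modular_orbit \<tau> (x + of_int n)"
proof (induction n rule: int_induct[of _ 0])
  case (step1 i) thus ?case using modular_orbit.orbit_plus[of \<tau> "x + of_int i"] by (simp add: add.assoc)
next
  case (step2 i) thus ?case using modular_orbit.orbit_minus[of \<tau> "x + of_int i"] by (simp add: algebra_simps)
qed auto

text \<open>Heights in the orbit have the form Im \<tau> / |c \<tau> + d|^2 with integers c and d,
  so only finitely many are at least Im \<tau>, and a highest point exists. Translated to |Re x| at
  most 1/2, it satisfies |x| at least 1, because inversion cannot raise it further.\<close>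

lemma modular_reduction:
  assumes \<tau>: "Im \<tau> > 0"
  obtains x where "modular_orbit \<tau> x" "1 / 2 \<le> Im x" "\<bar>Re x\<bar> \<le> 1 / 2"
proof -
  define M where "M = {y. \<exists>x. modular_orbit \<tau> x \<and> Im x = y \<and> Im \<tau> \<le> y}"
  have "M \<subseteq> (\<lambda>(c, d). Im \<tau> / (norm (of_int c * \<tau> + of_int d))\<^sup>2) ` {(c, d). norm (of_int (c::int) * \<tau> + of_int (d::int)) \<le> 1}"
  proof
    fix y assume "y \<in> M"
    then obtain x where x: "modular_orbit \<tau> x" "Im x = y" "Im \<tau> \<le> y" by (auto simp: M_def)
    obtain a b c d :: int where *: "a * d - b * c = 1" "x = (of_int a * \<tau> + of_int b) / (of_int c * \<tau> + of_int d)"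
      using modular_orbit_moebius[OF x(1) \<tau>] by blast
    have nz: "of_int c * \<tau> + of_int d \<noteq> 0" using *(1) by (intro linear_form_nonzero \<tau>) auto
    have "real_of_int a * real_of_int d - real_of_int b * real_of_int c = 1"
      using *(1) by (metis of_int_1 of_int_diff of_int_mult)
    from Im_moebius[OF this, of \<tau>] nz have y: "y = Im \<tau> / (norm (of_int c * \<tau> + of_int d))\<^sup>2"
      using x(2) *(2) by simp
    have "(norm (of_int c * \<tau> + of_int d))\<^sup>2 \<le> 1"
      using x(3) \<tau> nz unfolding y by (simp add: field_simps)
    hence "norm (of_int c * \<tau> + of_int d) \<le> 1" by (simp add: abs_square_le_1)
    thus "y \<in> (\<lambda>(c, d). Im \<tau> / (norm (of_int c * \<tau> + of_int d))\<^sup>2) ` {(c, d). norm (of_int (c::int) * \<tau> + of_int (d::int)) \<le> 1}"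
      using y by force
  qed
  hence finM: "finite M" using finite_small_linear_forms[OF \<tau>] finite_surj by blast
  have "Im \<tau> \<in> M" by (auto simp: M_def intro: modular_orbit.orbit_refl)
  hence "Max M \<in> M" using finM by (intro Max_in) auto
  then obtain x0 where x0: "modular_orbit \<tau> x0" "Im x0 = Max M" by (auto simp: M_def)
  define x where "x = x0 + of_int (- round (Re x0))"
  have x: "modular_orbit \<tau> x" unfolding x_def by (rule modular_orbit_translate[OF x0(1)])
  have re: "\<bar>Re x\<bar> \<le> 1 / 2" using of_int_round_abs_le[of "Re x0"] by (simp add: x_def abs_minus_commute)
  have im: "Im x = Max M" by (simp add: x_def x0)
  have ge: "Im \<tau> \<le> Max M" using \<open>Im \<tau> \<in> M\<close> finM by auto
  hence pos: "Im x > 0" using \<tau> im by simp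
  have xn: "x \<noteq> 0" using pos by auto
  have ims: "Im (- 1 / x) = Im x / (norm x)\<^sup>2" by (simp add: Im_divide cmod_power2)
  have "Im (- 1 / x) \<le> Im x"
  proof (cases "Im \<tau> \<le> Im (- 1 / x)")
    case True
    hence "Im (- 1 / x) \<in> M" using modular_orbit.orbit_inv[OF x] by (auto simp: M_def simp del: Im_divide)
    thus ?thesis using finM im by simp
  next
    case False thus ?thesis using ge im by simp
  qed
  hence "Im x * 1 \<le> Im x * (norm x)\<^sup>2" using xn unfolding ims by (simp add: field_simps)
  hence "1 \<le> (norm x)\<^sup>2" using pos by (simp only: mult_le_cancel_left_pos)
  moreover have "(Re x)\<^sup>2 \<le> (1 / 2)\<^sup>2" using re by (simp only: abs_le_square_iff[symmetric])
  \<comment> \<open>The available value 3/4 for the square of the height is weakened to 1/4.\<close>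
  ultimately have "(1 / 2)\<^sup>2 \<le> (Im x)\<^sup>2" unfolding cmod_power2 power_divide by simp
  hence "1 / 2 \<le> Im x" using pos abs_le_square_iff[of "1/2" "Im x"] by simp
  with x re show ?thesis using that by blast
qed

lemma Phi_modular_orbit:
  assumes "modular_orbit \<tau> x" "Im \<tau> > 0"
  shows "Phi (nome x) = Phi (nome \<tau>)"
  using assms(1)
proof (induction rule: modular_orbit.induct)
  case (orbit_plus x)
  have "Im x > 0" using orbit_plus modular_orbit_upper_half assms by blast
  thus ?case using orbit_plus by (simp add: nome_add_1 Phi_minus)
next
  case (orbit_minus x)
  have "Im (x - 1) > 0" using orbit_minus modular_orbit_upper_half[OF _ assms(2)] by auto
  thus ?case using orbit_minus nome_add_1[of "x - 1"] Phi_minus[of "nome (x - 1)"] by simp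
next
  case (orbit_inv x)
  have "Im x > 0" using orbit_inv modular_orbit_upper_half assms by blast
  from Phi_S[OF this] orbit_inv show ?case by simp
qed auto

text \<open>Every value on the punctured disc is also taken on a fixed smaller closed disc, namely
  at the nome of a reduced point, so the modulus has a maximum in the interior.\<close>

lemma Phi_constant:
  assumes "norm q < 1"
  shows "Phi q = 4"
proof -
  \<comment> \<open>The modulus of the nome at height 1/2, the lower bound for reduced
    points.\<close>
  define r where "r = exp (- pi / 2)"
  have r: "0 < r" "r < 1" by (simp_all add: r_def)
  have "continuous_on (cball 0 r) (\<lambda>q. norm (Phi q))"
    by (intro continuous_on_norm continuous_on_subset[OF holomorphic_on_imp_continuous_on[OF holomorphic_Phi]])
       (use r in auto)
  then obtain x where x: "x \<in> cball 0 r" "\<And>y. y \<in> cball 0 r \<Longrightarrow> norm (Phi y) \<le> norm (Phi x)"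
    using continuous_attains_sup[OF compact_cball, of 0 r "\<lambda>q. norm (Phi q)"] r by auto
  have "norm (Phi y) \<le> norm (Phi x)" if "y \<in> ball 0 1" for y
  proof (cases "y = 0")
    case True thus ?thesis using x r by auto
  next
    case False
    obtain \<tau> where \<tau>: "Im \<tau> > 0" "nome \<tau> = y" using nome_surj[of y] False \<open>y \<in> ball 0 1\<close> by auto
    obtain t where t: "modular_orbit \<tau> t" "1 / 2 \<le> Im t" using modular_reduction[OF \<tau>(1)] by blast
    have "norm (nome t) \<le> r" using t(2) by (simp add: norm_nome r_def)
    hence "norm (Phi (nome t)) \<le> norm (Phi x)" using x(2) by simp
    thus ?thesis using Phi_modular_orbit[OF t(1) \<tau>(1)] \<tau>(2) by simp
  qed
  hence "Phi constant_on ball 0 1"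
    by (intro maximum_modulus_principle[OF holomorphic_Phi _ _ open_ball order.refl, of x]) (use x r in auto)
  then obtain c where "\<And>q. q \<in> ball 0 1 \<Longrightarrow> Phi q = c" unfolding constant_on_def by blast
  thus ?thesis using Phi_0 assms by (metis mem_ball_0 norm_zero zero_less_one)
qed

lemma deriv_U_nonzero: "norm q < 1 \<Longrightarrow> deriv U q \<noteq> 0"
  using Phi_constant[of q] by (auto simp: Phi_def)

lemma deriv_u_nonzero: "Im \<tau> > 0 \<Longrightarrow> deriv u \<tau> \<noteq> 0"
  using DERIV_imp_deriv[OF deriv_u, of \<tau>] deriv_U_nonzero[of "nome \<tau>"] by simp

subsection \<open>Covering maps from uniform local inverses\<close>

text \<open>The set of agreement is open and closed in the disc. It is open because \<open>s\<close>
  has an open image by invariance of domain, and \<open>s' y\<close> lies in that image only if it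
  equals \<open>s y\<close>.\<close>

lemma local_sections_agree:
  fixes p :: "complex \<Rightarrow> complex"
  assumes s: "continuous_on (ball x r) s" "\<And>y. y \<in> ball x r \<Longrightarrow> p (s y) = y"
    and s': "continuous_on (ball x r) s'" "\<And>y. y \<in> ball x r \<Longrightarrow> p (s' y) = y"
    and b: "b \<in> ball x r" "s b = s' b" and c: "c \<in> ball x r"
  shows "s c = s' c"
proof -
  let ?E = "{y \<in> ball x r. s y = s' y}"
  have inj: "inj_on s (ball x r)" using s(2) by (metis inj_onI)
  have op: "open (s ` ball x r)"
    using invariance_of_domain[OF s(1) open_ball inj] .
  have "openin (top_of_set (ball x r)) ?E"
  proof -
    have "?E = ball x r \<inter> s' -` (s ` ball x r)"
    proof -
      have "s y = s' y \<longleftrightarrow> s' y \<in> s ` ball x r" if y: "y \<in> ball x r" for y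
      proof
        assume "s' y \<in> s ` ball x r"
        then obtain c where c: "c \<in> ball x r" "s' y = s c" by blast
        hence "y = c" using s(2)[OF c(1)] s'(2)[OF y] by simp
        thus "s y = s' y" using c by simp
      qed (metis imageI y)
      thus ?thesis by blast
    qed
    moreover have "openin (top_of_set (ball x r)) (ball x r \<inter> s' -` (s ` ball x r))"
      by (rule continuous_openin_preimage_gen[OF s'(1) op])
    ultimately show ?thesis by simp
  qed
  moreover have "closedin (top_of_set (ball x r)) ?E"
    using continuous_closedin_preimage_constant[of "ball x r" "\<lambda>y. s y - s' y" 0] s(1) s'(1)
    by (auto intro: continuous_on_diff)
  ultimately have "?E = {} \<or> ?E = ball x r"
    using connected_clopen[of "ball x r"] connected_ball[of x r] by blast
  thus ?thesis using b c by blast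
qed

text \<open>What matters is that one radius serves all points above the disc: their sections give
  the sheets, and two sheets that meet coincide. Surjectivity comes from the connectedness of
  \<open>X\<close>, since the image and its complement are both open.\<close>

lemma covering_space_uniform_sections:
  fixes p :: "complex \<Rightarrow> complex"
  assumes H: "H \<noteq> {}" "continuous_on H p" "p ` H \<subseteq> X" and X: "connected X"
    and sec: "\<And>x. x \<in> X \<Longrightarrow> \<exists>r>0. ball x r \<subseteq> X \<and> (\<forall>\<tau>\<in>H. p \<tau> \<in> ball x r \<longrightarrow>
       (\<exists>s. continuous_on (ball x r) s \<and> s ` ball x r \<subseteq> H \<and> s (p \<tau>) = \<tau> \<and> (\<forall>y\<in>ball x r. p (s y) = y)))"
  shows "covering_space H p X"
proof
  show "continuous_on H p" by fact
  have sub: "ball x r \<subseteq> p ` H" if "s ` ball x r \<subseteq> H" "\<forall>y\<in>ball x r. p (s y) = y" for x r s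
    using that by (force simp: image_iff)
  have op1: "open (p ` H)"
    unfolding open_contains_ball
  proof
    fix y assume "y \<in> p ` H"
    then obtain \<tau> where \<tau>: "\<tau> \<in> H" "y = p \<tau>" by blast
    with H(3) sec[of y] obtain r s where "r > 0" "s ` ball y r \<subseteq> H" "\<forall>y'\<in>ball y r. p (s y') = y'"
      by (metis centre_in_ball image_subset_iff)
    thus "\<exists>e>0. ball y e \<subseteq> p ` H" using sub by blast
  qed
  \<comment> \<open>A disc around a missed point is missed completely: a section through any point
    above it would cover the whole disc, including the centre.\<close>
  have op2: "open (X - p ` H)"
    unfolding open_contains_ball
  proof
    fix x assume x: "x \<in> X - p ` H"
    with sec[of x] obtain r where r: "r > 0" "ball x r \<subseteq> X"
      "\<And>\<tau>. \<tau> \<in> H \<Longrightarrow> p \<tau> \<in> ball x r \<Longrightarrow> \<exists>s. s ` ball x r \<subseteq> H \<and> (\<forall>y\<in>ball x r. p (s y) = y)"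
      by blast
    have "ball x r \<inter> p ` H = {}"
    proof (rule ccontr)
      assume "ball x r \<inter> p ` H \<noteq> {}"
      with r(3) sub have "ball x r \<subseteq> p ` H" by blast
      with x r(1) show False by (metis DiffE centre_in_ball subsetD)
    qed
    with r show "\<exists>e>0. ball x e \<subseteq> X - p ` H" by blast
  qed
  show im: "p ` H = X"
  proof -
    have "p ` H \<inter> (X - p ` H) \<inter> X = {}" "X \<subseteq> p ` H \<union> (X - p ` H)" by auto
    with X op1 op2 have "p ` H \<inter> X = {} \<or> (X - p ` H) \<inter> X = {}" unfolding connected_def by blast
    with H show ?thesis by blast
  qed
  fix x assume "x \<in> X"
  from sec[OF this] obtain r where r: "r > 0" "ball x r \<subseteq> X"
    and ex: "\<forall>\<tau>\<in>H. p \<tau> \<in> ball x r \<longrightarrow> (\<exists>s. continuous_on (ball x r) s \<and> s ` ball x r \<subseteq> H \<and> s (p \<tau>) = \<tau> \<and> (\<forall>y\<in>ball x r. p (s y) = y))"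
    by blast
  then have "\<forall>\<tau>\<in>H \<inter> p -` ball x r. \<exists>s. continuous_on (ball x r) s \<and> s ` ball x r \<subseteq> H \<and> s (p \<tau>) = \<tau> \<and> (\<forall>y\<in>ball x r. p (s y) = y)"
    by blast
  then obtain S where S: "\<And>\<tau>. \<tau> \<in> H \<inter> p -` ball x r \<Longrightarrow> continuous_on (ball x r) (S \<tau>) \<and> S \<tau> ` ball x r \<subseteq> H \<and> S \<tau> (p \<tau>) = \<tau> \<and> (\<forall>y\<in>ball x r. p (S \<tau> y) = y)"
    using bchoice[of "H \<inter> p -` ball x r"] by metis
  \<comment> \<open>The same sheet arises from every one of its points; collecting the sheets as a
    set of sets removes the repetitions.\<close>
  define \<V> where "\<V> = (\<lambda>\<tau>. S \<tau> ` ball x r) ` (H \<inter> p -` ball x r)"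
  show "\<exists>T. x \<in> T \<and> openin (top_of_set X) T \<and>
      (\<exists>v. \<Union>v = H \<inter> p -` T \<and> (\<forall>u\<in>v. openin (top_of_set H) u) \<and> pairwise disjnt v \<and> (\<forall>u\<in>v. \<exists>q. homeomorphism u T p q))"
  proof (intro exI conjI)
    show "x \<in> ball x r" using r by simp
    show "openin (top_of_set X) (ball x r)" using r by (simp add: open_subset)
    show "\<Union>\<V> = H \<inter> p -` ball x r"
    proof
      show "\<Union>\<V> \<subseteq> H \<inter> p -` ball x r" using S by (fastforce simp: \<V>_def)
      show "H \<inter> p -` ball x r \<subseteq> \<Union>\<V>" using S by (force simp: \<V>_def image_iff)
    qed
    show "\<forall>u\<in>\<V>. openin (top_of_set H) u"
    proof
      fix W assume "W \<in> \<V>"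
      then obtain \<tau> where \<tau>: "\<tau> \<in> H \<inter> p -` ball x r" "W = S \<tau> ` ball x r" by (auto simp: \<V>_def)
      have "inj_on (S \<tau>) (ball x r)" using S[OF \<tau>(1)] by (metis inj_onI)
      hence "open W" using S[OF \<tau>(1)] \<tau>(2) invariance_of_domain by blast
      thus "openin (top_of_set H) W" using S[OF \<tau>(1)] \<tau>(2) by (simp add: open_subset)
    qed
    show "pairwise disjnt \<V>"
    proof (rule pairwiseI, rule ccontr)
      fix W W' assume W: "W \<in> \<V>" "W' \<in> \<V>" "W \<noteq> W'" "\<not> disjnt W W'"
      then obtain \<tau> \<tau>' where \<tau>: "\<tau> \<in> H \<inter> p -` ball x r" "W = S \<tau> ` ball x r"
        and \<tau>': "\<tau>' \<in> H \<inter> p -` ball x r" "W' = S \<tau>' ` ball x r" unfolding \<V>_def by blast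
      obtain b b' where b: "b \<in> ball x r" "b' \<in> ball x r" "S \<tau> b = S \<tau>' b'"
        using W(4) \<tau>(2) \<tau>'(2) by (auto simp: disjnt_def)
      hence "b = b'" using S[OF \<tau>(1)] S[OF \<tau>'(1)] by metis
      hence "S \<tau> c = S \<tau>' c" if "c \<in> ball x r" for c
        using local_sections_agree[of x r "S \<tau>" p "S \<tau>'" b c] S[OF \<tau>(1)] S[OF \<tau>'(1)] b that by blast
      hence "W = W'" using \<tau>(2) \<tau>'(2) by (auto simp: image_iff)
      with W(3) show False by simp
    qed
    show "\<forall>u\<in>\<V>. \<exists>q. homeomorphism u (ball x r) p q"
    proof
      fix W assume "W \<in> \<V>"
      then obtain \<tau> where \<tau>: "\<tau> \<in> H \<inter> p -` ball x r" "W = S \<tau> ` ball x r" by (auto simp: \<V>_def)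
      have "homeomorphism W (ball x r) p (S \<tau>)"
      proof (rule homeomorphismI)
        show "continuous_on W p" using H(2) S[OF \<tau>(1)] \<tau>(2) continuous_on_subset by blast
      qed (use S[OF \<tau>(1)] \<tau>(2) in auto)
      thus "\<exists>q. homeomorphism W (ball x r) p q" by blast
    qed
  qed
qed

subsection \<open>The modular covering\<close>

text \<open>The anharmonic group, through which the modular group acts on the values of \<open>u\<close>.\<close>

definition six_maps :: "(complex \<Rightarrow> complex) set" where
  "six_maps = {(\<lambda>v. v), (\<lambda>v. 1 - v), (\<lambda>v. 1 / v), (\<lambda>v. 1 - 1 / v), (\<lambda>v. 1 / (1 - v)), (\<lambda>v. v / (v - 1))}"

lemma six_maps_precompose:
  assumes "f \<in> six_maps"
  shows "\<exists>g\<in>six_maps. \<forall>v\<in>-{0,1}. f (1 / v) = g v" "\<exists>g\<in>six_maps. \<forall>v\<in>-{0,1}. f (1 - v) = g v"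
proof -
  have a: "1 / (1 - 1 / v) = v / (v - 1)" "(1 / v) / (1 / v - 1) = 1 / (1 - v)"
    "1 - 1 / (1 - v) = v / (v - 1)" "(1 - v) / (1 - v - 1) = 1 - 1 / v" if "v \<in> -{0,1}" for v :: complex
  proof -
    have "v \<noteq> 0" "v - 1 \<noteq> 0" "1 - v \<noteq> 0" using that by auto
    thus "1 / (1 - 1 / v) = v / (v - 1)" "(1 / v) / (1 / v - 1) = 1 / (1 - v)"
      "1 - 1 / (1 - v) = v / (v - 1)" "(1 - v) / (1 - v - 1) = 1 - 1 / v"
      by (simp_all add: divide_simps) (simp add: algebra_simps)
  qed
  show "\<exists>g\<in>six_maps. \<forall>v\<in>-{0,1}. f (1 / v) = g v"
    using assms a unfolding six_maps_def by (elim insertE; simp)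
  show "\<exists>g\<in>six_maps. \<forall>v\<in>-{0,1}. f (1 - v) = g v"
    using assms a unfolding six_maps_def by (elim insertE; simp)
qed

lemma six_maps_inverse:
  assumes "f \<in> six_maps"
  shows "\<exists>g\<in>six_maps. \<forall>v\<in>-{0,1}. g v \<in> -{0,1} \<and> f v \<in> -{0,1} \<and> f (g v) = v \<and> g (f v) = v"
proof -
  have a: "1 / (1 - (1 - 1 / v)) = v" "1 - 1 / (1 / (1 - v)) = v" "(v / (v - 1)) / (v / (v - 1) - 1) = v"
     "1 - 1 / v \<noteq> 0" "1 / (1 - v) \<noteq> 1" "v / (v - 1) \<noteq> 1" "1 - v \<noteq> 0" "v - 1 \<noteq> 0" "1 / v \<noteq> 1" "1 - 1 / v \<noteq> 1"
      "1 / (1 - v) \<noteq> 0" "v / (v - 1) \<noteq> 0" "1 / v \<noteq> 0" "1 - v \<noteq> 1"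
    if "v \<in> -{0,1}" for v :: complex
  proof -
    have nz: "v \<noteq> 0" "v - 1 \<noteq> 0" "1 - v \<noteq> 0" using that by auto
    have "v / (v - 1) - 1 = 1 / (v - 1)" using nz by (simp add: field_simps)
    thus "(v / (v - 1)) / (v / (v - 1) - 1) = v" using nz by simp
  qed (use that in \<open>auto simp: field_simps\<close>)
  have "\<exists>g\<in>six_maps. \<forall>v\<in>-{0,1}. f (g v) = v \<and> g (f v) = v"
  proof -
    consider "f \<in> {(\<lambda>v. v), (\<lambda>v. 1 - v), (\<lambda>v. 1 / v)}" | "f = (\<lambda>v. v / (v - 1))" | "f = (\<lambda>v. 1 - 1 / v)" | "f = (\<lambda>v. 1 / (1 - v))"
      using assms unfolding six_maps_def by blast
    thus ?thesis
    proof cases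
      case 1
      show ?thesis by (rule bexI[of _ f]) (use 1 assms in auto)
    next
      case 2
      show ?thesis unfolding 2 by (rule bexI[of _ "\<lambda>v. v / (v - 1)"], intro ballI conjI a(3)) (auto simp: six_maps_def)
    next
      case 3
      show ?thesis by (rule bexI[of _ "\<lambda>v. 1 / (1 - v)"]) (use 3 a(1,2) in \<open>auto simp: six_maps_def\<close>)
    next
      case 4
      show ?thesis by (rule bexI[of _ "\<lambda>v. 1 - 1 / v"]) (use 4 a(1,2) in \<open>auto simp: six_maps_def\<close>)
    qed
  qed
  moreover have "f v \<in> - {0,1}" if "v \<in> -{0,1}" "f \<in> six_maps" for f v
  proof -
    have "f v \<noteq> 0 \<and> f v \<noteq> 1"
      using that(2) a(4-)[OF that(1)] that(1) unfolding six_maps_def by (elim insertE emptyE) simp_all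
    thus ?thesis by simp
  qed
  ultimately show ?thesis using assms by blast
qed

lemma continuous_on_six_maps: "f \<in> six_maps \<Longrightarrow> continuous_on (-{0,1}) f"
  unfolding six_maps_def by (auto intro!: continuous_intros)

lemma holomorphic_u: "u holomorphic_on upper_half"
  using deriv_u by (auto simp: upper_half_def holomorphic_on_def field_differentiable_def intro: has_field_derivative_at_within)

lemma continuous_on_u: "continuous_on upper_half u"
  using holomorphic_u by (rule holomorphic_on_imp_continuous_on)

text \<open>The map \<open>h\<close> leads from the reduced point back to the original one. A
  section of \<open>u\<close> at the reduced point can thus be transported, with \<sigma> as the
  correction on the values.\<close>

lemma modular_orbit_lift:
  assumes "modular_orbit \<tau> x" "\<tau> \<in> upper_half"
  shows "\<exists>h \<sigma>. continuous_on upper_half h \<and> h ` upper_half \<subseteq> upper_half \<and> h x = \<tau> \<and> \<sigma> \<in> six_maps \<and>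
           (\<forall>y\<in>upper_half. u (h y) = \<sigma> (u y))"
  using assms(1)
proof (induction rule: modular_orbit.induct)
  case orbit_refl
  show ?case
    by (intro exI[of _ "\<lambda>x. x"] conjI) (auto simp: six_maps_def)
next
  case (orbit_plus x)
  then obtain h \<sigma> where h: "continuous_on upper_half h" "h ` upper_half \<subseteq> upper_half" "h x = \<tau>" "\<sigma> \<in> six_maps"
    "\<And>y. y \<in> upper_half \<Longrightarrow> u (h y) = \<sigma> (u y)" by blast
  obtain \<sigma>' where \<sigma>': "\<sigma>' \<in> six_maps" "\<And>v. v \<in> -{0,1} \<Longrightarrow> \<sigma> (1 / v) = \<sigma>' v"
    using six_maps_precompose(1)[OF h(4)] by blast
  have sub: "(\<lambda>y. y - 1) ` upper_half \<subseteq> upper_half" by (auto simp: upper_half_def)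
  show ?case
  proof (intro exI conjI ballI)
    show "continuous_on upper_half (\<lambda>y. h (y - 1))"
      by (rule continuous_on_compose2[OF h(1) _ sub]) (intro continuous_intros)
    show "(\<lambda>y. h (y - 1)) ` upper_half \<subseteq> upper_half" using h(2) sub by blast
    show "h (x + 1 - 1) = \<tau>" using h(3) by simp
    show "\<sigma>' \<in> six_maps" by fact
    fix y assume y: "y \<in> upper_half"
    hence "u (h (y - 1)) = \<sigma> (u (y - 1))" using h(5) sub by blast
    also have "u (y - 1) = 1 / u y" using u_T[of "y - 1"] by simp
    finally show "u (h (y - 1)) = \<sigma>' (u y)" using \<sigma>'(2) u_range y by (simp add: upper_half_def)
  qed
next
  case (orbit_minus x)
  then obtain h \<sigma> where h: "continuous_on upper_half h" "h ` upper_half \<subseteq> upper_half" "h x = \<tau>" "\<sigma> \<in> six_maps"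
    "\<And>y. y \<in> upper_half \<Longrightarrow> u (h y) = \<sigma> (u y)" by blast
  obtain \<sigma>' where \<sigma>': "\<sigma>' \<in> six_maps" "\<And>v. v \<in> -{0,1} \<Longrightarrow> \<sigma> (1 / v) = \<sigma>' v"
    using six_maps_precompose(1)[OF h(4)] by blast
  have sub: "(\<lambda>y. y + 1) ` upper_half \<subseteq> upper_half" by (auto simp: upper_half_def)
  show ?case
  proof (intro exI conjI ballI)
    show "continuous_on upper_half (\<lambda>y. h (y + 1))"
      by (rule continuous_on_compose2[OF h(1) _ sub]) (intro continuous_intros)
    show "(\<lambda>y. h (y + 1)) ` upper_half \<subseteq> upper_half" using h(2) sub by blast
    show "h (x - 1 + 1) = \<tau>" using h(3) by simp
    show "\<sigma>' \<in> six_maps" by fact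
    fix y assume y: "y \<in> upper_half"
    hence "u (h (y + 1)) = \<sigma> (1 / u y)" using h(5) sub u_T[of y] by (metis image_subset_iff)
    thus "u (h (y + 1)) = \<sigma>' (u y)" using \<sigma>'(2) u_range y by (simp add: upper_half_def)
  qed
next
  case (orbit_inv x)
  then obtain h \<sigma> where h: "continuous_on upper_half h" "h ` upper_half \<subseteq> upper_half" "h x = \<tau>" "\<sigma> \<in> six_maps"
    "\<And>y. y \<in> upper_half \<Longrightarrow> u (h y) = \<sigma> (u y)" by blast
  obtain \<sigma>' where \<sigma>': "\<sigma>' \<in> six_maps" "\<And>v. v \<in> -{0,1} \<Longrightarrow> \<sigma> (1 - v) = \<sigma>' v"
    using six_maps_precompose(2)[OF h(4)] by blast
  have x: "Im x > 0" using orbit_inv(1) modular_orbit_upper_half assms(2) by (auto simp: upper_half_def)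
  have sub: "(\<lambda>y. - 1 / y) ` upper_half \<subseteq> upper_half" using Im_S by (auto simp: upper_half_def)
  show ?case
  proof (intro exI conjI ballI)
    show "continuous_on upper_half (\<lambda>y. h (- 1 / y))"
      by (rule continuous_on_compose2[OF h(1) _ sub]) (auto intro!: continuous_intros simp: upper_half_def)
    show "(\<lambda>y. h (- 1 / y)) ` upper_half \<subseteq> upper_half" using h(2) sub by blast
    show "h (- 1 / (- 1 / x)) = \<tau>" using h(3) x by simp
    show "\<sigma>' \<in> six_maps" by fact
    fix y assume y: "y \<in> upper_half"
    hence "u (h (- 1 / y)) = \<sigma> (1 - u y)" using h(5)[of "- 1 / y"] sub u_S[of y] by (auto simp: upper_half_def)
    thus "u (h (- 1 / y)) = \<sigma>' (u y)" using \<sigma>'(2) u_range y by (simp add: upper_half_def)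
  qed
qed

lemma u_near_cusp:
  assumes "\<delta> > 0"
  obtains Y where "\<And>t. Im t \<ge> Y \<Longrightarrow> norm (u t - 1) < \<delta>"
proof -
  have "isCont U 0"
    using holomorphic_on_imp_continuous_on[OF holomorphic_U] by (simp add: continuous_on_eq_continuous_at)
  then obtain d where d: "d > 0" "\<And>q. norm q < d \<Longrightarrow> norm (U q - 1) < \<delta>"
    using assms by (auto simp: continuous_at_eps_delta dist_norm U_0)
  define Y where "Y = 1 - ln d / pi"
  have "norm (u t - 1) < \<delta>" if "Im t \<ge> Y" for t
  proof -
    have "pi * Im t \<ge> pi * Y" using that by simp
    hence "- pi * Im t < ln d" by (simp add: Y_def algebra_simps) (use pi_gt_zero in linarith)
    hence "exp (- pi * Im t) < exp (ln d)" by (subst exp_less_cancel_iff)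
    thus ?thesis using d by (simp add: u_def norm_nome)
  qed
  thus ?thesis using that by blast
qed

lemma finite_uniform_radius:
  assumes "finite S" "\<And>x. x \<in> S \<Longrightarrow> \<exists>r>0. P x r" "\<And>x r r'. P x r \<Longrightarrow> 0 < r' \<Longrightarrow> r' \<le> r \<Longrightarrow> P x r'"
  shows "\<exists>r>(0::real). \<forall>x\<in>S. P x r"
  using assms(1,2)
proof (induction S rule: finite_induct)
  case empty thus ?case by (auto intro: exI[of _ 1])
next
  case (insert x S)
  then obtain r r' where "r > 0" "\<forall>x\<in>S. P x r" "r' > 0" "P x r'" by blast
  thus ?case using assms(3) by (intro exI[of _ "min r r'"]) (auto intro: min.cobounded1 min.cobounded2)
qed

definition section_at :: "complex \<Rightarrow> real \<Rightarrow> bool" where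
  "section_at t \<rho> \<longleftrightarrow> (\<exists>s. continuous_on (ball (u t) \<rho>) s \<and> s ` ball (u t) \<rho> \<subseteq> upper_half \<and> s (u t) = t \<and>
      (\<forall>y\<in>ball (u t) \<rho>. u (s y) = y))"

lemma section_at_mono: "section_at t \<rho> \<Longrightarrow> \<rho>' \<le> \<rho> \<Longrightarrow> section_at t \<rho>'"
  unfolding section_at_def by (meson continuous_on_subset image_mono order_trans subset_ball subsetD)

text \<open>One radius works for all points near \<open>t\<close>, as compactness arguments require:
  discs of half the radius around nearby values lie in the disc around \<open>u t\<close>.\<close>

lemma local_section:
  assumes t: "t \<in> upper_half"
  shows "\<exists>\<epsilon> \<rho>. \<epsilon> > 0 \<and> \<rho> > 0 \<and> (\<forall>t'\<in>ball t \<epsilon>. section_at t' \<rho>)"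
proof -
  obtain r where r: "r > 0" "ball t r \<subseteq> upper_half" "open (u ` ball t r)" "inj_on u (ball t r)"
    using has_complex_derivative_locally_invertible[OF holomorphic_u t open_upper_half] deriv_u_nonzero t
    by (auto simp: upper_half_def)
  have holo: "u holomorphic_on ball t r" using holomorphic_on_subset[OF holomorphic_u r(2)] .
  obtain g where g: "g holomorphic_on (u ` ball t r)" "\<And>z. z \<in> ball t r \<Longrightarrow> g (u z) = z"
    using holomorphic_has_inverse[OF holo open_ball r(4)] by metis
  have "u t \<in> u ` ball t r" using r(1) by simp
  then obtain R where R: "R > 0" "ball (u t) R \<subseteq> u ` ball t r" using r(3) open_contains_ball by blast
  have "isCont u t" using continuous_on_u open_upper_half t by (simp add: continuous_on_eq_continuous_at)
  then obtain d where d: "d > 0" "\<And>t'. dist t' t < d \<Longrightarrow> dist (u t') (u t) < R / 2"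
    using R(1) by (auto simp: continuous_at_eps_delta dest: spec[of _ "R/2"])
  have "section_at t' (R / 2)" if t': "t' \<in> ball t (min d r)" for t'
  proof -
    have "dist (u t') (u t) < R / 2" using t' d(2)[of t'] by (simp add: dist_commute)
    hence sub: "ball (u t') (R / 2) \<subseteq> ball (u t) R"
      by (smt (verit, best) dist_commute dist_triangle mem_ball subsetI field_sum_of_halves)
    hence sub: "ball (u t') (R / 2) \<subseteq> u ` ball t r" using R(2) by blast
    show ?thesis
      unfolding section_at_def
    proof (intro exI[of _ g] conjI ballI)
      show "continuous_on (ball (u t') (R / 2)) g"
        using holomorphic_on_imp_continuous_on[OF g(1)] sub continuous_on_subset by blast
      show "g ` ball (u t') (R / 2) \<subseteq> upper_half" using sub g(2) r(2) by force
      show "g (u t') = t'" using t' g(2) by auto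
      fix y assume "y \<in> ball (u t') (R / 2)"
      thus "u (g y) = y" using sub g(2) by force
    qed
  qed
  thus ?thesis using d(1) r(1) R(1) by (intro exI[of _ "min d r"] exI[of _ "R / 2"]) auto
qed

lemma compact_sections:
  assumes "compact C" "C \<subseteq> upper_half"
  obtains \<rho> where "\<rho> > 0" "\<And>t. t \<in> C \<Longrightarrow> section_at t \<rho>"
proof -
  have "\<forall>t\<in>C. \<exists>\<epsilon>. \<epsilon> > 0 \<and> (\<exists>\<rho>>0. \<forall>t'\<in>ball t \<epsilon>. section_at t' \<rho>)"
    using local_section assms(2) by blast
  from bchoice[OF this] obtain \<epsilon> where \<epsilon>: "\<And>t. t \<in> C \<Longrightarrow> \<epsilon> t > 0 \<and> (\<exists>\<rho>>0. \<forall>t'\<in>ball t (\<epsilon> t). section_at t' \<rho>)"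
    by blast
  have "C \<subseteq> (\<Union>t\<in>C. ball t (\<epsilon> t))" using \<epsilon> by force
  then obtain D where D: "D \<subseteq> C" "finite D" "C \<subseteq> (\<Union>t\<in>D. ball t (\<epsilon> t))"
    using compactE_image[OF assms(1), of C "\<lambda>t. ball t (\<epsilon> t)"] by blast
  have "\<exists>r>0. \<forall>t\<in>D. \<forall>t'\<in>ball t (\<epsilon> t). section_at t' r"
    by (rule finite_uniform_radius[OF D(2)]) (use \<epsilon> D(1) section_at_mono in blast)+
  then obtain \<rho> where "\<rho> > 0" "\<forall>t\<in>D. \<forall>t'\<in>ball t (\<epsilon> t). section_at t' \<rho>" by blast
  with D(3) have "section_at t \<rho>" if "t \<in> C" for t using that by blast
  with \<open>\<rho> > 0\<close> show ?thesis using that by blast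
qed

text \<open>Any point above the small disc has a reduced representative whose value under
  \<open>u\<close> lies in a compact set \<open>K\<close> without 1. By the behaviour at the cusp
  its height is bounded, so it lies in a compact rectangle, on which sections of a common radius
  exist.\<close>

lemma u_uniform_sections:
  assumes x: "x \<in> - {0, 1}"
  shows "\<exists>r>0. ball x r \<subseteq> - {0, 1} \<and> (\<forall>\<tau>\<in>upper_half. u \<tau> \<in> ball x r \<longrightarrow>
       (\<exists>s. continuous_on (ball x r) s \<and> s ` ball x r \<subseteq> upper_half \<and> s (u \<tau>) = \<tau> \<and> (\<forall>y\<in>ball x r. u (s y) = y)))"
proof -
  have "open (- {0, 1 :: complex})" by (simp add: open_Compl)
  then obtain r0 where r0: "r0 > 0" "cball x r0 \<subseteq> - {0, 1}" using x open_contains_cball by blast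
  \<comment> \<open>All values that the six maps can produce from the disc; they stay away from the
    cusp value 1 because each map preserves the complement of 0 and 1.\<close>
  define K where "K = (\<Union>\<sigma>\<in>six_maps. \<sigma> ` cball x r0)"
  have fin: "finite six_maps" by (simp add: six_maps_def)
  have "compact K" unfolding K_def
    using continuous_on_subset[OF continuous_on_six_maps r0(2)] fin
    by (intro compact_UN compact_continuous_image) auto
  moreover have "1 \<notin> K"
  proof
    assume "1 \<in> K"
    then obtain \<sigma> v where "\<sigma> \<in> six_maps" "v \<in> cball x r0" "1 = \<sigma> v" by (auto simp: K_def)
    thus False using six_maps_inverse[of \<sigma>] r0(2) by fastforce
  qed
  ultimately obtain \<delta> where \<delta>: "\<delta> > 0" "\<And>v. v \<in> K \<Longrightarrow> \<delta> \<le> dist 1 v"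
    using separate_point_closed[OF compact_imp_closed[of K], of 1] by blast
  obtain Y where Y: "\<And>t. Im t \<ge> Y \<Longrightarrow> norm (u t - 1) < \<delta>" using u_near_cusp[OF \<delta>(1)] by blast
  define C where "C = cbox (Complex (-1/2) (1/2)) (Complex (1/2) Y)"
  have C: "compact C" "C \<subseteq> upper_half" by (auto simp: C_def upper_half_def in_cbox_complex_iff)
  obtain \<rho> where \<rho>: "\<rho> > 0" "\<And>t. t \<in> C \<Longrightarrow> section_at t \<rho>" using compact_sections[OF C] by blast
  \<comment> \<open>The six maps distort distances, so the radius has to be small enough for each of
    them.\<close>
  have "\<exists>d>0. \<forall>\<sigma>\<in>six_maps. \<forall>v\<in>cball x r0. \<forall>v'\<in>cball x r0. dist v v' < d \<longrightarrow> dist (\<sigma> v) (\<sigma> v') < \<rho>"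
  proof (rule finite_uniform_radius[OF fin])
    fix \<sigma> assume "\<sigma> \<in> six_maps"
    hence "uniformly_continuous_on (cball x r0) \<sigma>"
      using continuous_on_subset[OF continuous_on_six_maps r0(2)] by (intro compact_uniformly_continuous) auto
    thus "\<exists>d>0. \<forall>v\<in>cball x r0. \<forall>v'\<in>cball x r0. dist v v' < d \<longrightarrow> dist (\<sigma> v) (\<sigma> v') < \<rho>"
      using uniformly_continuous_onE[of "cball x r0" \<sigma> \<rho>] \<rho>(1) by (metis dist_commute)
  qed auto
  then obtain d where d: "d > 0" "\<And>\<sigma> v v'. \<sigma> \<in> six_maps \<Longrightarrow> v \<in> cball x r0 \<Longrightarrow> v' \<in> cball x r0 \<Longrightarrow> dist v v' < d \<Longrightarrow> dist (\<sigma> v) (\<sigma> v') < \<rho>"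
    by blast
  define r where "r = min r0 (d / 2)"
  have r: "r > 0" "ball x r \<subseteq> cball x r0" using r0 d by (auto simp: r_def)
  show ?thesis
  proof (intro exI[of _ r] conjI ballI impI)
    show "r > 0" by fact
    show sub: "ball x r \<subseteq> - {0, 1}" using r r0 by blast
    fix \<tau> assume \<tau>: "\<tau> \<in> upper_half" "u \<tau> \<in> ball x r"
    obtain t where t: "modular_orbit \<tau> t" "1 / 2 \<le> Im t" "\<bar>Re t\<bar> \<le> 1 / 2"
      using modular_reduction \<tau>(1) by (auto simp: upper_half_def)
    obtain h \<sigma>' where h: "continuous_on upper_half h" "h ` upper_half \<subseteq> upper_half" "h t = \<tau>" "\<sigma>' \<in> six_maps"
      "\<And>y. y \<in> upper_half \<Longrightarrow> u (h y) = \<sigma>' (u y)"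
      using modular_orbit_lift[OF t(1) \<tau>(1)] by blast
    obtain \<sigma> where \<sigma>: "\<sigma> \<in> six_maps" "\<And>v. v \<in> -{0,1} \<Longrightarrow> \<sigma> v \<in> -{0,1} \<and> \<sigma>' (\<sigma> v) = v \<and> \<sigma> (\<sigma>' v) = v"
      using six_maps_inverse[OF h(4)] by blast
    have tH: "t \<in> upper_half" using t(2) by (auto simp: upper_half_def)
    have "u \<tau> = \<sigma>' (u t)" using h(3,5) tH by metis
    hence ut: "\<sigma> (u \<tau>) = u t" using \<sigma>(2) u_range tH by (simp add: upper_half_def)
    have "u \<tau> \<in> cball x r0" using \<tau>(2) r(2) by blast
    hence "\<sigma> (u \<tau>) \<in> K" unfolding K_def using \<sigma>(1) by blast
    hence "u t \<in> K" by (simp only: ut)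
    from \<delta>(2)[OF this] have "\<not> norm (u t - 1) < \<delta>" by (simp add: dist_norm norm_minus_commute)
    hence "Im t < Y" using Y[of t] by linarith
    hence "t \<in> C" using t by (auto simp: C_def in_cbox_complex_iff)
    from \<rho>(2)[OF this] obtain s where s: "continuous_on (ball (u t) \<rho>) s" "s ` ball (u t) \<rho> \<subseteq> upper_half" "s (u t) = t"
      "\<And>y. y \<in> ball (u t) \<rho> \<Longrightarrow> u (s y) = y" unfolding section_at_def by blast
    have im: "\<sigma> v \<in> ball (u t) \<rho>" if "v \<in> ball x r" for v
    proof -
      have "dist v (u \<tau>) \<le> dist v x + dist x (u \<tau>)" by (rule dist_triangle)
      also have "\<dots> < d" using that \<tau>(2) by (simp add: r_def dist_commute)
      finally have "dist (\<sigma> v) (\<sigma> (u \<tau>)) < \<rho>" using d(2)[OF \<sigma>(1), of v "u \<tau>"] that \<tau>(2) r(2) by blast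
      thus ?thesis by (simp add: ut dist_commute)
    qed
    show "\<exists>s. continuous_on (ball x r) s \<and> s ` ball x r \<subseteq> upper_half \<and> s (u \<tau>) = \<tau> \<and> (\<forall>y\<in>ball x r. u (s y) = y)"
    \<comment> \<open>The transported section: \<sigma> moves \<open>v\<close> to a value near
      \<open>u t\<close>, \<open>s\<close> lifts it to a point near \<open>t\<close>, and
      \<open>h\<close> moves that point back towards \<tau>.\<close>
    proof (intro exI[of _ "\<lambda>v. h (s (\<sigma> v))"] conjI ballI)
      show "continuous_on (ball x r) (\<lambda>v. h (s (\<sigma> v)))"
      proof (rule continuous_on_compose2[OF h(1)])
        show "continuous_on (ball x r) (\<lambda>v. s (\<sigma> v))"
          by (rule continuous_on_compose2[OF s(1) continuous_on_subset[OF continuous_on_six_maps[OF \<sigma>(1)] sub]])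
             (use im in blast)
        show "(\<lambda>v. s (\<sigma> v)) ` ball x r \<subseteq> upper_half" using s(2) im by blast
      qed
      show "(\<lambda>v. h (s (\<sigma> v))) ` ball x r \<subseteq> upper_half" using s(2) im h(2) by blast
      show "h (s (\<sigma> (u \<tau>))) = \<tau>" by (simp add: ut s(3) h(3))
      fix v assume v: "v \<in> ball x r"
      have sH: "s (\<sigma> v) \<in> upper_half" using s(2) im[OF v] by blast
      have "v \<in> -{0,1}" using v sub by blast
      thus "u (h (s (\<sigma> v))) = v" using h(5)[OF sH] s(4)[OF im[OF v]] \<sigma>(2)[of v] by simp
    qed
  qed
qed

text \<open>The affine change moves the omitted values 0 and 1 of \<open>u\<close> to -1 and 1, and
  the value 1/2 at the point \<i> to the base point 0.\<close>

definition modz :: "complex \<Rightarrow> complex" where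
  "modz \<tau> = 2 * u \<tau> - 1"

lemma twice_punctured_connected: "connected twice_punctured"
  using connected_open_diff_countable[of "UNIV :: complex set" "{-1, 1}"] connected_UNIV
  by (simp add: twice_punctured_def Compl_eq_Diff_UNIV)

lemma modz_in: "\<tau> \<in> upper_half \<Longrightarrow> modz \<tau> \<in> twice_punctured"
  using u_range[of \<tau>] by (auto simp: modz_def twice_punctured_def upper_half_def)

lemma holomorphic_modz: "modz holomorphic_on upper_half"
  unfolding modz_def[abs_def] by (intro holomorphic_intros holomorphic_u)

lemma covering_modz: "covering_space upper_half modz twice_punctured"
proof (rule covering_space_uniform_sections)
  have "\<i> \<in> upper_half" by (simp add: upper_half_def)
  thus "upper_half \<noteq> {}" by blast
  show "continuous_on upper_half modz" using holomorphic_modz by (rule holomorphic_on_imp_continuous_on)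
  show "modz ` upper_half \<subseteq> twice_punctured" using modz_in by blast
  show "connected twice_punctured" by (rule twice_punctured_connected)
  fix x assume x: "x \<in> twice_punctured"
  define A where "A = (\<lambda>y :: complex. (y + 1) / 2)"
  have ax: "A x \<in> - {0, 1}" using x by (auto simp: A_def twice_punctured_def add_eq_0_iff2)
  obtain r where r: "r > 0" "ball (A x) r \<subseteq> - {0, 1}" and sec: "\<And>\<tau>. \<tau> \<in> upper_half \<Longrightarrow> u \<tau> \<in> ball (A x) r \<Longrightarrow>
     \<exists>s. continuous_on (ball (A x) r) s \<and> s ` ball (A x) r \<subseteq> upper_half \<and> s (u \<tau>) = \<tau> \<and> (\<forall>y\<in>ball (A x) r. u (s y) = y)"
    using u_uniform_sections[OF ax] by blast
  have d: "dist (A x) (A y) = dist x y / 2" for y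
  proof -
    have "A x - A y = (x - y) / 2" by (simp add: A_def field_simps)
    hence "norm (A x - A y) = norm ((x - y) / 2)" by (rule arg_cong)
    thus ?thesis by (simp add: dist_norm norm_divide)
  qed
  have Ab: "A y \<in> ball (A x) r \<longleftrightarrow> y \<in> ball x (2 * r)" for y by (simp add: d mult.commute)
  have Am: "A (modz \<tau>) = u \<tau>" "2 * A y - 1 = y" for \<tau> y by (simp_all add: A_def modz_def field_simps)
  show "\<exists>r>0. ball x r \<subseteq> twice_punctured \<and> (\<forall>\<tau>\<in>upper_half. modz \<tau> \<in> ball x r \<longrightarrow>
     (\<exists>s. continuous_on (ball x r) s \<and> s ` ball x r \<subseteq> upper_half \<and> s (modz \<tau>) = \<tau> \<and> (\<forall>y\<in>ball x r. modz (s y) = y)))"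
  proof (intro exI[of _ "2 * r"] conjI ballI impI)
    show "2 * r > 0" using r by simp
    show "ball x (2 * r) \<subseteq> twice_punctured"
    proof
      fix y assume "y \<in> ball x (2 * r)"
      hence "A y \<in> - {0, 1}" using Ab r(2) by blast
      thus "y \<in> twice_punctured" by (auto simp: A_def twice_punctured_def)
    qed
    fix \<tau> assume "\<tau> \<in> upper_half" "modz \<tau> \<in> ball x (2 * r)"
    then obtain s where s: "continuous_on (ball (A x) r) s" "s ` ball (A x) r \<subseteq> upper_half" "s (u \<tau>) = \<tau>"
        "\<And>y. y \<in> ball (A x) r \<Longrightarrow> u (s y) = y"
      using sec[of \<tau>] Ab[of "modz \<tau>"] Am by auto
    show "\<exists>s. continuous_on (ball x (2 * r)) s \<and> s ` ball x (2 * r) \<subseteq> upper_half \<and> s (modz \<tau>) = \<tau> \<and> (\<forall>y\<in>ball x (2 * r). modz (s y) = y)"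
    proof (intro exI[of _ "\<lambda>y. s (A y)"] conjI ballI)
      show "continuous_on (ball x (2 * r)) (\<lambda>y. s (A y))"
        by (rule continuous_on_compose2[OF s(1)]) (use Ab in \<open>auto simp: A_def intro!: continuous_intros\<close>)
      show "(\<lambda>y. s (A y)) ` ball x (2 * r) \<subseteq> upper_half" using s(2) Ab by blast
      show "s (A (modz \<tau>)) = \<tau>" using s(3) Am by simp
      fix y assume "y \<in> ball x (2 * r)"
      hence "u (s (A y)) = A y" using s(4) Ab by blast
      thus "modz (s (A y)) = y" using Am(2)[of y] by (simp add: modz_def)
    qed
  qed
qed

subsection \<open>Symmetries of the covering\<close>

lemma modz_S: "\<tau> \<in> upper_half \<Longrightarrow> modz (- 1 / \<tau>) = - modz \<tau>"
  by (simp add: modz_def upper_half_def u_S del: minus_divide_left) (simp add: u_S[simplified] algebra_simps)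

lemma modz_T2: "modz (\<tau> + 2) = modz \<tau>"
  using u_T[of "\<tau> + 1"] u_T[of \<tau>] by (simp add: modz_def add.assoc)

lemma modz_cnj: "\<tau> \<in> upper_half \<Longrightarrow> modz (- cnj \<tau>) = cnj (modz \<tau>)"
  by (simp add: modz_def u_def nome_cnj U_cnj upper_half_def)

lemma i_upper_half [simp]: "\<i> \<in> upper_half"
  by (simp add: upper_half_def)

lemma modz_i: "modz \<i> = 0"
  using modz_S[of \<i>] by simp

lemma continuous_modz: "continuous_on upper_half modz"
  using holomorphic_modz by (rule holomorphic_on_imp_continuous_on)

subsection \<open>Moebius transformations\<close>

text \<open>The entries are real rather than integral, because pairs of geodesics are later
  normalised by real matrices.\<close>

type_synonym rmat = "real \<times> real \<times> real \<times> real"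

definition mob :: "rmat \<Rightarrow> complex \<Rightarrow> complex" where
  "mob = (\<lambda>(a, b, c, d) \<tau>. (of_real a * \<tau> + of_real b) / (of_real c * \<tau> + of_real d))"

definition mmul :: "rmat \<Rightarrow> rmat \<Rightarrow> rmat" where
  "mmul = (\<lambda>(a, b, c, d) (a', b', c', d'). (a * a' + b * c', a * b' + b * d', c * a' + d * c', c * b' + d * d'))"

definition mdet :: "rmat \<Rightarrow> real" where
  "mdet = (\<lambda>(a, b, c, d). a * d - b * c)"

definition minv :: "rmat \<Rightarrow> rmat" where
  "minv = (\<lambda>(a, b, c, d). (d, - b, - c, a))"

definition mid :: rmat where
  "mid = (1, 0, 0, 1)"

lemma real_linear_form_nonzero:
  assumes "\<tau> \<in> upper_half" "c \<noteq> 0 \<or> d \<noteq> 0"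
  shows "of_real c * \<tau> + of_real d \<noteq> 0"
proof
  assume e: "of_real c * \<tau> + of_real d = 0"
  hence "Im (of_real c * \<tau> + of_real d) = 0" by simp
  hence "c = 0" using assms(1) by (simp add: upper_half_def)
  with e assms(2) show False by simp
qed

lemma mob_upper_half:
  assumes "mdet M = 1" "\<tau> \<in> upper_half"
  shows "mob M \<tau> \<in> upper_half"
proof -
  obtain a b c d where M: "M = (a, b, c, d)" by (cases M)
  have det: "a * d - b * c = 1" using assms(1) by (simp add: M mdet_def)
  have nz: "of_real c * \<tau> + of_real d \<noteq> 0"
    using det by (intro real_linear_form_nonzero[OF assms(2)]) auto
  have "Im (mob M \<tau>) = Im \<tau> / (norm (of_real c * \<tau> + of_real d))\<^sup>2"
    using Im_moebius[OF det nz] by (simp add: M mob_def)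
  thus ?thesis using assms(2) nz by (simp add: upper_half_def)
qed

lemma mdet_mmul: "mdet (mmul M N) = mdet M * mdet N"
  by (cases M; cases N) (simp add: mdet_def mmul_def algebra_simps)

lemma mob_mmul:
  assumes "mdet N = 1" "\<tau> \<in> upper_half"
  shows "mob (mmul M N) \<tau> = mob M (mob N \<tau>)"
proof -
  obtain a b c d where M: "M = (a, b, c, d)" by (cases M)
  obtain a' b' c' d' where N: "N = (a', b', c', d')" by (cases N)
  define x where "x = of_real a' * \<tau> + of_real b'"
  define y where "y = of_real c' * \<tau> + of_real d'"
  have y: "y \<noteq> 0"
    using assms(1) unfolding y_def by (intro real_linear_form_nonzero[OF assms(2)]) (auto simp: N mdet_def)
  have "mob M (mob N \<tau>) = (of_real a * (x / y) + of_real b) / (of_real c * (x / y) + of_real d)"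
    by (simp add: M N mob_def x_def y_def)
  also have "\<dots> = ((of_real a * x + of_real b * y) / y) / ((of_real c * x + of_real d * y) / y)"
    using y by (simp add: add_divide_distrib)
  also have "\<dots> = (of_real a * x + of_real b * y) / (of_real c * x + of_real d * y)"
    using y by simp
  also have "\<dots> = mob (mmul M N) \<tau>"
    by (simp add: M N mob_def mmul_def x_def y_def algebra_simps)
  finally show ?thesis by simp
qed

lemma mob_mid [simp]: "mob mid \<tau> = \<tau>"
  by (simp add: mob_def mid_def)

lemma mdet_mid [simp]: "mdet mid = 1"
  by (simp add: mdet_def mid_def)

lemma mdet_minv: "mdet (minv M) = mdet M"
  by (cases M) (simp add: mdet_def minv_def)

lemma mmul_minv: "mdet M = 1 \<Longrightarrow> mmul (minv M) M = mid" "mdet M = 1 \<Longrightarrow> mmul M (minv M) = mid"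
  by (cases M; simp add: mdet_def minv_def mmul_def mid_def algebra_simps)+

lemma mob_minv:
  assumes "mdet M = 1" "\<tau> \<in> upper_half"
  shows "mob (minv M) (mob M \<tau>) = \<tau>" "mob M (mob (minv M) \<tau>) = \<tau>"
  using assms by (simp_all add: mob_mmul[symmetric] mdet_minv mmul_minv)

lemma holomorphic_mob:
  assumes "mdet M = 1"
  shows "mob M holomorphic_on upper_half"
proof -
  obtain a b c d where M: "M = (a, b, c, d)" by (cases M)
  have "of_real c * \<tau> + of_real d \<noteq> 0" if "\<tau> \<in> upper_half" for \<tau>
    using assms by (intro real_linear_form_nonzero[OF that]) (auto simp: M mdet_def)
  thus ?thesis unfolding M mob_def by (auto intro!: holomorphic_intros)
qed

lemma continuous_mob: "mdet M = 1 \<Longrightarrow> continuous_on upper_half (mob M)"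
  by (rule holomorphic_on_imp_continuous_on[OF holomorphic_mob])

text \<open>Powers of two parabolic elements of Gamma(2). The matrix for \<open>A2\<close> fixes the
  cusp at infinity, which lies over 1; the one for \<open>A1\<close> fixes the cusp 0, over
  -1.\<close>

definition gen_mat :: "gen \<Rightarrow> int \<Rightarrow> rmat" where
  "gen_mat g n = (case g of A1 \<Rightarrow> (1, 0, - 2 * of_int n, 1) | A2 \<Rightarrow> (1, 2 * of_int n, 0, 1))"

primrec word_mat :: "word \<Rightarrow> rmat" where
  "word_mat [] = mid"
| "word_mat (t # w) = mmul (gen_mat (fst t) (snd t)) (word_mat w)"

definition deck :: "rmat \<Rightarrow> bool" where
  "deck M \<longleftrightarrow> mdet M = 1 \<and> (\<forall>\<tau>\<in>upper_half. modz (mob M \<tau>) = modz \<tau>)"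

lemma deck_mid: "deck mid"
  by (simp add: deck_def)

lemma deck_mmul: "deck M \<Longrightarrow> deck N \<Longrightarrow> deck (mmul M N)"
  by (auto simp: deck_def mdet_mmul mob_mmul mob_upper_half)

lemma deck_minv:
  assumes "deck M"
  shows "deck (minv M)"
proof -
  have "modz (mob (minv M) \<tau>) = modz \<tau>" if "\<tau> \<in> upper_half" for \<tau>
  proof -
    have "mob (minv M) \<tau> \<in> upper_half" using assms that by (simp add: deck_def mob_upper_half mdet_minv)
    hence "modz (mob M (mob (minv M) \<tau>)) = modz (mob (minv M) \<tau>)" using assms by (simp add: deck_def)
    thus ?thesis using assms that by (simp add: deck_def mob_minv)
  qed
  thus ?thesis using assms by (simp add: deck_def mdet_minv)
qed

lemma deck_gen_mat: "deck (gen_mat g n)"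
proof -
  have d2: "deck (gen_mat A2 n)" for n
    using int_periodic[of modz 2 _ n] modz_T2
    by (auto simp: deck_def mdet_def gen_mat_def mob_def mult_ac)
  have "deck (gen_mat A1 n)" for n
  proof -
    have "modz (mob (gen_mat A1 n) \<tau>) = modz \<tau>" if \<tau>: "\<tau> \<in> upper_half" for \<tau>
    proof -
      have t: "\<tau> \<noteq> 0" using \<tau> by (auto simp: upper_half_def)
      have S: "- 1 / \<tau> \<in> upper_half" using \<tau> Im_S by (simp add: upper_half_def del: minus_divide_left)
      have S2: "mob (gen_mat A2 n) (- 1 / \<tau>) \<in> upper_half" using S d2 by (intro mob_upper_half) (auto simp: deck_def)
      have "mob (gen_mat A1 n) \<tau> = - 1 / mob (gen_mat A2 n) (- 1 / \<tau>)"
      proof -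
        have "mob (gen_mat A2 n) (- 1 / \<tau>) = - ((1 - 2 * of_int n * \<tau>) / \<tau>)"
          using t by (simp add: mob_def gen_mat_def field_simps)
        thus ?thesis by (simp add: mob_def gen_mat_def)
      qed
      also have "modz \<dots> = - modz (mob (gen_mat A2 n) (- 1 / \<tau>))" by (rule modz_S[OF S2])
      also have "\<dots> = - modz (- 1 / \<tau>)" using d2 S by (simp add: deck_def)
      also have "\<dots> = modz \<tau>" using modz_S[OF \<tau>] by simp
      finally show ?thesis .
    qed
    thus ?thesis by (simp add: deck_def mdet_def gen_mat_def)
  qed
  with d2 show ?thesis by (cases g) auto
qed

lemma deck_word_mat: "deck (word_mat w)"
  by (induction w) (simp_all add: deck_mid deck_mmul deck_gen_mat)

subsection \<open>Homotopy classes with boundary values\<close>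

lemma bv_homotopyI:
  fixes h :: "real \<times> real \<Rightarrow> complex"
  assumes "continuous_on ({0..1} \<times> {0..1}) h" "h ` ({0..1} \<times> {0..1}) \<subseteq> twice_punctured"
    "\<And>t. t \<in> {0..1} \<Longrightarrow> h (0, t) = p t" "\<And>t. t \<in> {0..1} \<Longrightarrow> h (1, t) = q t"
    "\<And>s. s \<in> {0..1} \<Longrightarrow> h (s, 0) \<in> A" "\<And>s. s \<in> {0..1} \<Longrightarrow> h (s, 1) \<in> A"
  shows "q \<in> bv_class A p"
  unfolding bv_class_def mem_Collect_eq
  by (subst homotopic_with)
     (use assms in \<open>auto simp: pathstart_def pathfinish_def image_subset_iff_funcset intro!: exI[of _ h]\<close>)

lemma bv_homotopyE:
  assumes "q \<in> bv_class A p"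
  obtains h :: "real \<times> real \<Rightarrow> complex" where "continuous_on ({0..1} \<times> {0..1}) h" "h ` ({0..1} \<times> {0..1}) \<subseteq> twice_punctured"
    "\<And>t. h (0, t) = p t" "\<And>t. h (1, t) = q t"
    "\<And>s. s \<in> {0..1} \<Longrightarrow> h (s, 0) \<in> A" "\<And>s. s \<in> {0..1} \<Longrightarrow> h (s, 1) \<in> A"
  using assms unfolding bv_class_def mem_Collect_eq homotopic_with_def
  by (auto simp: pathstart_def pathfinish_def image_subset_iff_funcset)

lemma bv_class_trans: "q \<in> bv_class A p \<Longrightarrow> r \<in> bv_class A q \<Longrightarrow> r \<in> bv_class A p"
  unfolding bv_class_def mem_Collect_eq by (rule homotopic_with_trans)

lemma bv_class_sym: "q \<in> bv_class A p \<Longrightarrow> p \<in> bv_class A q"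
  unfolding bv_class_def mem_Collect_eq by (rule homotopic_with_symD)

text \<open>\<open>L\<close> is the lift through \<open>\<i>\<close> of the boundary curve \<open>A\<close>, and \<open>g\<close> the inverse of the covering on it.\<close>

definition boundary_lift :: "complex set \<Rightarrow> complex set \<Rightarrow> (complex \<Rightarrow> complex) \<Rightarrow> bool" where
  "boundary_lift A L g \<longleftrightarrow> convex A \<and> 0 \<in> A \<and> A \<subseteq> twice_punctured \<and> L \<subseteq> upper_half \<and> modz ` L \<subseteq> A \<and>
     continuous_on A g \<and> g ` A \<subseteq> L \<and> g 0 = \<i> \<and> (\<forall>x\<in>A. modz (g x) = x) \<and> (\<forall>\<tau>\<in>L. g (modz \<tau>) = \<tau>)"

text \<open>\<open>R\<close> is a lift of a reflection \<rho> that fixes \<open>A\<close> pointwise.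
  Both \<open>g\<close> and its composition with \<open>R\<close> lift the inclusion of
  \<open>A\<close> and agree at 0, so \<open>g\<close> takes values in the fixed set of
  \<open>R\<close>, inside \<open>L\<close>. Conversely \<open>g\<close> after \<open>modz\<close>
  and the identity are lifts of \<open>modz\<close> on the connected set \<open>L\<close> that agree
  at \<i>.\<close>

lemma boundary_lift_exists:
  assumes A: "convex A" "0 \<in> A" "A \<subseteq> twice_punctured"
    and L: "connected L" "L \<subseteq> upper_half" "modz ` L \<subseteq> A" "\<i> \<in> L"
    and R: "continuous_on upper_half R" "R ` upper_half \<subseteq> upper_half" "R \<i> = \<i>"
      "\<And>\<tau>. \<tau> \<in> upper_half \<Longrightarrow> modz (R \<tau>) = \<rho> (modz \<tau>)" "\<And>x. x \<in> A \<Longrightarrow> \<rho> x = x"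
      "\<And>\<tau>. \<tau> \<in> upper_half \<Longrightarrow> R \<tau> = \<tau> \<Longrightarrow> \<tau> \<in> L"
  shows "\<exists>g. boundary_lift A L g"
proof -
  obtain g where g: "continuous_on A g" "g \<in> A \<rightarrow> upper_half" "g 0 = \<i>" "\<And>y. y \<in> A \<Longrightarrow> modz (g y) = y"
    using covering_space_lift_strong[OF covering_modz i_upper_half A(2) convex_imp_simply_connected[OF A(1)]
      convex_imp_locally_path_connected[OF A(1)], of "\<lambda>x. x"] A(3) modz_i by (auto intro: continuous_on_id)
  have conn: "connected A" using A(1) by (rule convex_connected)
  have RgL: "R (g x) = g x" if x: "x \<in> A" for x
  proof (rule covering_space_lift_unique[OF covering_modz, of "\<lambda>x. R (g x)" 0 g A "\<lambda>x. x"])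
    show "continuous_on A (\<lambda>x. R (g x))"
      by (rule continuous_on_compose2[OF R(1) g(1)]) (use g(2) in auto)
    show "(\<lambda>x. R (g x)) \<in> A \<rightarrow> upper_half" using R(2) g(2) by auto
    show "x = modz (R (g x))" if "x \<in> A" for x
    proof -
      have "g x \<in> upper_half" using g(2) that by auto
      thus ?thesis using R(4) R(5) g(4) that by simp
    qed
  qed (use g A(2,3) R(3) conn x in \<open>auto intro: continuous_on_id\<close>)
  have "g x \<in> L" if "x \<in> A" for x using R(6) RgL that g(2) by auto
  hence gL: "g ` A \<subseteq> L" by blast
  have "g (modz \<tau>) = \<tau>" if \<tau>: "\<tau> \<in> L" for \<tau>
  proof (rule covering_space_lift_unique[OF covering_modz, of "\<lambda>\<tau>. g (modz \<tau>)" \<i> "\<lambda>\<tau>. \<tau>" L modz])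
    show "continuous_on L modz" using continuous_modz L(2) continuous_on_subset by blast
    show "continuous_on L (\<lambda>\<tau>. g (modz \<tau>))"
      by (rule continuous_on_compose2[OF g(1) \<open>continuous_on L modz\<close> L(3)])
    show "modz \<in> L \<rightarrow> twice_punctured" using L(3) A(3) by blast
    show "(\<lambda>\<tau>. g (modz \<tau>)) \<in> L \<rightarrow> upper_half" using L(3) g(2) by blast
    show "modz x = modz (g (modz x))" if "x \<in> L" for x using g(4) L(3) that by force
  qed (use g(3) modz_i L \<tau> in \<open>auto intro: continuous_on_id\<close>)
  with gL g A L show ?thesis unfolding boundary_lift_def by blast
qed

definition L_tr :: "complex set" where
  "L_tr = {\<tau>. Re \<tau> = 0 \<and> Im \<tau> > 0}"

definition L_pb :: "complex set" where
  "L_pb = {\<tau>. norm \<tau> = 1 \<and> Im \<tau> > 0}"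

lemma interval_tr_iff: "z \<in> interval_tr \<longleftrightarrow> Im z = 0 \<and> \<bar>Re z\<bar> < 1"
  by (force simp: interval_tr_def image_iff complex_eq_iff)

lemma boundary_lift_tr: "\<exists>g. boundary_lift interval_tr L_tr g"
proof (rule boundary_lift_exists[where R = "\<lambda>\<tau>. - cnj \<tau>" and \<rho> = cnj])
  have conv: "convex L_tr"
    unfolding L_tr_def convex_def by (auto intro: add_nonneg_pos add_pos_nonneg simp: less_le) (metis add_nonneg_eq_0_iff mult_eq_0_iff mult_nonneg_nonneg less_eq_real_def add.commute zero_neq_one add_0)
  thus conn: "connected L_tr" by (rule convex_connected)
  show sub: "L_tr \<subseteq> upper_half" by (auto simp: L_tr_def upper_half_def)
  show "modz ` L_tr \<subseteq> interval_tr"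
  proof clarify
    fix \<tau> assume \<tau>: "\<tau> \<in> L_tr"
    have Im0: "Im (modz t) = 0" if "t \<in> L_tr" for t
    proof -
      have "- cnj t = t" using that by (simp add: L_tr_def complex_eq_iff)
      hence "modz t = cnj (modz t)" using modz_cnj[of t] sub that by auto
      thus ?thesis by (simp add: complex_eq_iff)
    qed
    \<comment> \<open>The values of \<open>modz\<close> on \<open>L_tr\<close> are real and omit 1
      and -1, so by connectedness they stay in the component of 0.\<close>
    define f where "f = (\<lambda>t. Re (modz t))"
    have cf: "connected (f ` L_tr)"
      unfolding f_def
      by (intro connected_continuous_image conn continuous_intros continuous_on_subset[OF continuous_modz sub])
    have f0: "0 \<in> f ` L_tr" by (rule image_eqI[of _ _ \<i>]) (auto simp: f_def modz_i L_tr_def)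
    have ne: "1 \<notin> f ` L_tr" "-1 \<notin> f ` L_tr"
    proof -
      have "f t \<noteq> 1 \<and> f t \<noteq> -1" if "t \<in> L_tr" for t
        using modz_in[of t] Im0[OF that] sub that by (auto simp: f_def twice_punctured_def complex_eq_iff)
      thus "1 \<notin> f ` L_tr" "-1 \<notin> f ` L_tr" by (metis imageE)+
    qed
    have "f \<tau> \<in> f ` L_tr" using \<tau> by blast
    hence "\<bar>f \<tau>\<bar> < 1"
    proof -
      assume fm: "f \<tau> \<in> f ` L_tr"
      have "f \<tau> < 1" using connected_contains_Icc[OF cf f0 fm] ne(1) by (meson atLeastAtMost_iff not_less subsetD zero_le_one)
      moreover have "f \<tau> > - 1"
      proof (rule ccontr)
        assume "\<not> f \<tau> > - 1"
        hence "- 1 \<in> {f \<tau>..0}" by simp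
        thus False using connected_contains_Icc[OF cf fm f0] ne(2) by blast
      qed
      ultimately show ?thesis by simp
    qed
    thus "modz \<tau> \<in> interval_tr" using Im0[OF \<tau>] by (simp add: interval_tr_iff f_def)
  qed
  show "convex interval_tr" unfolding interval_tr_def by (intro convex_linear_image) (auto intro!: bounded_linear.linear bounded_linear_of_real)
qed (auto simp: interval_tr_iff twice_punctured_def upper_half_def L_tr_def modz_cnj complex_eq_iff intro!: continuous_intros)

text \<open>The inversion in the unit circle is the composition of the symmetries
  \<open>modz_S\<close> and \<open>modz_cnj\<close>, and therefore covers the reflection in the
  imaginary axis.\<close>

lemma boundary_lift_pb: "\<exists>g. boundary_lift axis_pb L_pb g"
proof (rule boundary_lift_exists[where R = "\<lambda>\<tau>. 1 / cnj \<tau>" and \<rho> = "\<lambda>x. - cnj x"])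
  show sub: "L_pb \<subseteq> upper_half" by (auto simp: L_pb_def upper_half_def)
  have R: "modz (1 / cnj \<tau>) = - cnj (modz \<tau>)" if "\<tau> \<in> upper_half" for \<tau>
  proof -
    have "- cnj \<tau> \<in> upper_half" using that by (simp add: upper_half_def)
    from modz_S[OF this] modz_cnj[OF that] show ?thesis by simp
  qed
  thus "\<And>\<tau>. \<tau> \<in> upper_half \<Longrightarrow> modz (1 / cnj \<tau>) = - cnj (modz \<tau>)" .
  show "(\<lambda>\<tau>. 1 / cnj \<tau>) ` upper_half \<subseteq> upper_half"
    by (auto simp: upper_half_def Im_divide intro!: divide_pos_pos add_nonneg_pos)
  show "continuous_on upper_half (\<lambda>\<tau>. 1 / cnj \<tau>)"
    by (auto intro!: continuous_intros simp: upper_half_def)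
  have Rfix: "1 / cnj \<tau> = \<tau> \<longleftrightarrow> norm \<tau> = 1" if "\<tau> \<in> upper_half" for \<tau>
  proof -
    have "cnj \<tau> \<noteq> 0" using that by (auto simp: upper_half_def)
    hence "1 / cnj \<tau> = \<tau> \<longleftrightarrow> \<tau> * cnj \<tau> = 1" by (auto simp: field_simps)
    also have "\<dots> \<longleftrightarrow> (norm \<tau>)\<^sup>2 = 1" unfolding complex_norm_square[symmetric] by (metis of_real_1 of_real_eq_iff)
    also have "\<dots> \<longleftrightarrow> norm \<tau> = 1" by (smt (verit, best) norm_ge_zero one_power2 power2_eq_iff_nonneg)
    finally show ?thesis .
  qed
  show "\<And>\<tau>. \<tau> \<in> upper_half \<Longrightarrow> 1 / cnj \<tau> = \<tau> \<Longrightarrow> \<tau> \<in> L_pb"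
    using Rfix by (auto simp: L_pb_def upper_half_def)
  show "modz ` L_pb \<subseteq> axis_pb"
  proof clarify
    fix \<tau> assume \<tau>: "\<tau> \<in> L_pb"
    hence "1 / cnj \<tau> = \<tau>" using Rfix sub by (auto simp: L_pb_def)
    hence "modz \<tau> = - cnj (modz \<tau>)" using R[of \<tau>] sub \<tau> by auto
    thus "modz \<tau> \<in> axis_pb" by (simp add: axis_pb_def complex_eq_iff)
  qed
  show "connected L_pb"
  proof -
    have "L_pb = cis ` {0<..<pi}"
    proof
      show "L_pb \<subseteq> cis ` {0<..<pi}"
      proof
        fix \<tau> assume \<tau>: "\<tau> \<in> L_pb"
        hence n: "\<tau> \<noteq> 0" "norm \<tau> = 1" "Im \<tau> > 0" by (auto simp: L_pb_def)
        have "\<tau> = cis (Arg \<tau>)" using cis_Arg[OF n(1)] n(2) by (simp add: sgn_div_norm)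
        moreover have "0 < Arg \<tau> \<and> Arg \<tau> < pi" using Arg_lt_pi[of \<tau>] n(3) by simp
        ultimately show "\<tau> \<in> cis ` {0<..<pi}" by (metis greaterThanLessThan_iff imageI)
      qed
      show "cis ` {0<..<pi} \<subseteq> L_pb" by (auto simp: L_pb_def sin_gt_zero)
    qed
    moreover have "continuous_on {0<..<pi} cis" by (intro continuous_intros)
    ultimately show ?thesis using connected_continuous_image connected_Ioo by metis
  qed
  show "convex axis_pb" unfolding axis_pb_def using convex_hyperplane[of "1::complex" 0] by (simp add: inner_complex_def)
qed (auto simp: axis_pb_def twice_punctured_def L_pb_def complex_eq_iff)

lemma path_connected_boundary_lift:
  assumes "boundary_lift A L g"
  shows "path_connected L"
proof -
  note b = assms[unfolded boundary_lift_def]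
  have "L \<subseteq> g ` A"
  proof
    fix \<tau> assume \<tau>: "\<tau> \<in> L"
    have "modz \<tau> \<in> A" "g (modz \<tau>) = \<tau>" using b \<tau> by auto
    thus "\<tau> \<in> g ` A" by (metis imageI)
  qed
  with b have "L = g ` A" by blast
  moreover have "path_connected (g ` A)"
    using b by (intro path_connected_continuous_image convex_imp_path_connected) auto
  ultimately show ?thesis by simp
qed

text \<open>Unique lifting: the path \<open>k\<close> and the deck translate of \<open>g\<close>
  along \<beta> lift the same path and start at the same point.\<close>

lemma lift_endpoint_slide:
  assumes bl: "boundary_lift A L g" and M: "deck M"
    and \<beta>: "path \<beta>" "path_image \<beta> \<subseteq> A"
    and k: "path k" "path_image k \<subseteq> upper_half" "\<And>s. s \<in> {0..1} \<Longrightarrow> modz (k s) = \<beta> s" "k 0 \<in> mob M ` L"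
    and s: "s \<in> {0..1}"
  shows "k s \<in> mob M ` L"
proof -
  note b = bl[unfolded boundary_lift_def]
  have img: "\<beta> s \<in> A" if "s \<in> {0..1}" for s using \<beta>(2) that by (auto simp: path_image_def)
  have gH: "g x \<in> upper_half" if "x \<in> A" for x using b that by blast
  have det: "mdet M = 1" using M by (simp add: deck_def)
  have "k s = mob M (g (\<beta> s))"
  proof (rule covering_space_lift_unique[OF covering_modz, of k 0 "\<lambda>s. mob M (g (\<beta> s))" "{0..1}" \<beta>])
    obtain l where l: "l \<in> L" "k 0 = mob M l" using k(4) by blast
    have "\<beta> 0 = modz l" using k(3)[of 0] l M b by (auto simp: deck_def)
    hence "g (\<beta> 0) = l" using b l by auto
    thus "k 0 = mob M (g (\<beta> 0))" using l by simp
    show "continuous_on {0..1} \<beta>" using \<beta>(1) by (simp add: path_def)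
    show "\<beta> \<in> {0..1} \<rightarrow> twice_punctured" using img b by blast
    show "continuous_on {0..1} k" using k(1) by (simp add: path_def)
    show "k \<in> {0..1} \<rightarrow> upper_half" using k(2) by (auto simp: path_image_def)
    show "\<beta> x = modz (k x)" if "x \<in> {0..1}" for x using k(3) that by simp
    show "continuous_on {0..1} (\<lambda>s. mob M (g (\<beta> s)))"
    proof (rule continuous_on_compose2[OF continuous_mob[OF det]])
      show "continuous_on {0..1} (\<lambda>s. g (\<beta> s))"
        by (rule continuous_on_compose2[of A g]) (use b img \<beta>(1) in \<open>auto simp: path_def\<close>)
      show "(\<lambda>s. g (\<beta> s)) ` {0..1} \<subseteq> upper_half" using gH img by blast
    qed
    show "(\<lambda>s. mob M (g (\<beta> s))) \<in> {0..1} \<rightarrow> upper_half" using gH img mob_upper_half[OF det] by blast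
    show "\<beta> x = modz (mob M (g (\<beta> x)))" if "x \<in> {0..1}" for x
      using M gH[OF img[OF that]] b img[OF that] by (auto simp: deck_def)
  qed (use s in auto)
  thus ?thesis using b img[OF s] by blast
qed

text \<open>The homotopy is lifted from the given lift of its initial curve; the two edges traced by
  the end points remain in \<open>L\<close> and in its translate by the preceding lemma.\<close>

lemma homotopy_slide:
  assumes bl: "boundary_lift A L g" and M: "deck M"
    and W: "path W" "path_image W \<subseteq> upper_half" "\<And>t. t \<in> {0..1} \<Longrightarrow> modz (W t) = p t" "W 0 \<in> L" "W 1 \<in> mob M ` L"
    and q: "q \<in> bv_class A p"
  obtains W' where "path W'" "path_image W' \<subseteq> upper_half" "\<And>t. t \<in> {0..1} \<Longrightarrow> modz (W' t) = q t"
    "W' 0 \<in> L" "W' 1 \<in> mob M ` L"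
proof -
  obtain h :: "real \<times> real \<Rightarrow> complex" where h: "continuous_on ({0..1} \<times> {0..1}) h" "h ` ({0..1} \<times> {0..1}) \<subseteq> twice_punctured"
    "\<And>t. h (0, t) = p t" "\<And>t. h (1, t) = q t"
    "\<And>s. s \<in> {0..1} \<Longrightarrow> h (s, 0) \<in> A" "\<And>s. s \<in> {0..1} \<Longrightarrow> h (s, 1) \<in> A"
    using bv_homotopyE[OF q] by blast
  obtain k where k: "continuous_on ({0..1} \<times> {0..1}) k" "k \<in> ({0..1} \<times> {0..1}) \<rightarrow> upper_half"
      "\<And>y. y \<in> {0..1} \<Longrightarrow> k (0, y) = W y" "\<And>z. z \<in> {0..1} \<times> {0..1} \<Longrightarrow> h z = modz (k z)"
  proof (rule covering_space_lift_homotopy[OF covering_modz h(1)])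
    show "h \<in> {0..1} \<times> {0..1} \<rightarrow> twice_punctured" using h(2) by blast
    show "h (0, y) = modz (W y)" if "y \<in> {0..1}" for y using W(3) that h(3) by simp
    show "continuous_on {0..1} W" using W(1) by (simp add: path_def)
    show "W \<in> {0..1} \<rightarrow> upper_half" using W(2) by (auto simp: path_image_def)
  qed blast
  have edge: "path (\<lambda>s. f (s, e)) \<and> path_image (\<lambda>s. f (s, e)) = (\<lambda>s. f (s, e)) ` {0..1}"
    if "continuous_on ({0..1} \<times> {0..1}) f" "e \<in> {0..1}" for f :: "real \<times> real \<Rightarrow> complex" and e
    unfolding path_def path_image_def
    by (intro conjI continuous_on_compose2[OF that(1)] refl) (use that(2) in \<open>auto intro!: continuous_intros\<close>)
  have slide: "k (s, e) \<in> mob N ` L" if N: "deck N" and e: "e \<in> {0, 1}" and st: "W e \<in> mob N ` L" and s: "s \<in> {0..1}" for N e s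
  proof (rule lift_endpoint_slide[OF bl N, of "\<lambda>s. h (s, e)" "\<lambda>s. k (s, e)"])
    have e01: "e \<in> {0..1}" using e by auto
    show "path (\<lambda>s. h (s, e))" "path (\<lambda>s. k (s, e))" using edge[OF h(1) e01] edge[OF k(1) e01] by auto
    show "path_image (\<lambda>s. h (s, e)) \<subseteq> A" using edge[OF h(1) e01] h(5,6) e by auto
    show "path_image (\<lambda>s. k (s, e)) \<subseteq> upper_half" using edge[OF k(1) e01] k(2) e01 by auto
    show "modz (k (s, e)) = h (s, e)" if "s \<in> {0..1}" for s using k(4) that e01 by simp
    show "k (0, e) \<in> mob N ` L" using k(3)[OF e01] st by simp
  qed (fact s)
  have mobid: "mob mid ` L = L" by simp
  show ?thesis
  proof (rule that[of "\<lambda>t. k (1, t)"])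
    show "path (\<lambda>t. k (1, t))" unfolding path_def
      by (rule continuous_on_compose2[OF k(1)]) (auto intro!: continuous_intros)
    show "path_image (\<lambda>t. k (1, t)) \<subseteq> upper_half" using k(2) by (auto simp: path_image_def)
    show "modz (k (1, t)) = q t" if "t \<in> {0..1}" for t using k(4)[of "(1, t)"] h(4) that by simp
    show "k (1, 0) \<in> L" using slide[OF deck_mid, of 0 1] W(4) mobid by simp
    show "k (1, 1) \<in> mob M ` L" using slide[OF M, of 1 1] W(5) by simp
  qed
qed

section \<open>Monodromy: the matrix that belongs to the path of a word\<close>

definition lifts :: "(real \<Rightarrow> complex) \<Rightarrow> rmat \<Rightarrow> bool" where
  "lifts p M \<longleftrightarrow> deck M \<and> (\<exists>W. path W \<and> path_image W \<subseteq> upper_half \<and> pathstart W = \<i> \<and> pathfinish W = mob M \<i> \<and>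
     (\<forall>t\<in>{0..1}. modz (W t) = p t))"

lemma gen_loop_expi2:
  "gen_loop A2 t = 1 - expi2 (of_real t)" "gen_loop A1 t = - 1 + expi2 (of_real t)"
proof -
  have "\<i> * of_real (linepath pi (3 * pi) t) = of_real pi * \<i> + 2 * of_real pi * \<i> * of_real t"
    by (simp add: linepath_def algebra_simps)
  hence "exp (\<i> * of_real (linepath pi (3 * pi) t)) = - expi2 (of_real t)"
    by (simp only: exp_add exp_pi_i expi2_def mult_minus1)
  thus "gen_loop A2 t = 1 - expi2 (of_real t)" by (simp add: part_circlepath_def)
  show "gen_loop A1 t = - 1 + expi2 (of_real t)"
    by (simp add: part_circlepath_def expi2_def linepath_def mult_ac)
qed

lemma modz_nome: "modz \<tau> = 1 - 2 * (nome \<tau> * V (nome \<tau>))"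
  by (simp add: modz_def u_def V_eq[symmetric])

text \<open>The two conditions are those for straightening the circle around 1: the positive real
  part keeps convex combinations with 1 away from 0, and the bound 2 keeps the curves inside the
  disc around 1 that ends at -1. With |V q| < 17 a radius of at most 1/32 in the nome is
  enough.\<close>

lemma cusp_loop_height:
  obtains Y where "Y > 0" "\<And>q. norm q \<le> exp (- pi * Y) \<Longrightarrow> Re (V q) > 0"
    "\<And>q. norm q \<le> exp (- pi * Y) \<Longrightarrow> norm (2 * of_real (exp (- pi * Y)) * V q) < 2"
proof -
  have "isCont V 0"
    using holomorphic_on_imp_continuous_on[OF holomorphic_V] by (simp add: continuous_on_eq_continuous_at)
  then obtain d where d: "d > 0" "\<And>q. norm q < d \<Longrightarrow> norm (V q - 16) < 1"
    by (auto simp: continuous_at_eps_delta dist_norm V_def dest: spec[of _ 1])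
  define e where "e = min (d / 2) (1 / 32)"
  define Y where "Y = - ln e / pi"
  have e: "e > 0" "e < d" "e \<le> 1 / 32" using d(1) by (auto simp: e_def)
  have ex: "exp (- pi * Y) = e" using e(1) by (simp add: Y_def)
  have "ln e < 0" using e by simp
  hence Y: "Y > 0" by (simp add: Y_def divide_neg_pos)
  have v: "norm (V q - 16) < 1" if "norm q \<le> e" for q using d(2) that e(2) by auto
  show ?thesis
  proof (rule that[of Y, OF Y])
    fix q :: complex assume q: "norm q \<le> exp (- pi * Y)"
    have n: "norm (V q - 16) < 1" using v q ex by simp
    have "\<bar>Re (V q - 16)\<bar> < 1" using abs_Re_le_cmod[of "V q - 16"] n by linarith
    thus "Re (V q) > 0" by simp
    have "norm (V q) < 17" using n norm_triangle_ineq[of "V q - 16" 16] by simp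
    hence "2 * e * norm (V q) \<le> 2 * (1 / 32) * 17"
      using e by (intro mult_mono) auto
    thus "norm (2 * of_real (exp (- pi * Y)) * V q) < 2"
      unfolding ex using e(1) by (simp add: norm_mult)
  qed
qed

text \<open>High up near the cusp, the segment from \<open>\<i> * Y\<close> to \<open>2 + \<i> * Y\<close> is mapped to a perturbed circle
  \<open>1 - 2 * q * V q\<close> around \<open>1\<close>, which can be straightened to the generator.\<close>

lemma lifts_gen_loop_A2: "lifts (gen_loop A2) (gen_mat A2 1)"
proof -
  obtain Y where Y: "Y > 0" "\<And>q. norm q \<le> exp (- pi * Y) \<Longrightarrow> Re (V q) > 0"
    "\<And>q. norm q \<le> exp (- pi * Y) \<Longrightarrow> norm (2 * of_real (exp (- pi * Y)) * V q) < 2"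
    using cusp_loop_height by blast
  obtain g where bl: "boundary_lift interval_tr L_tr g" using boundary_lift_tr by blast
  note b = bl[unfolded boundary_lift_def]
  define \<rho> where "\<rho> = exp (- pi * Y)"
  define W where "W = (\<lambda>t :: real. \<i> * of_real Y + 2 * of_real t)"
  define q where "q = (\<lambda>t :: real. of_real \<rho> * expi2 (of_real t))"
  define c where "c = (\<lambda>t. 2 * of_real \<rho> * V (q t))"
  have rho: "0 < \<rho>" "\<rho> < 1" using Y(1) by (simp_all add: \<rho>_def)
  have nq: "norm (q t) = \<rho>" for t using rho by (simp add: q_def norm_mult norm_expi2)
  have nW: "nome (W t) = q t" for t
  proof -
    have "of_real pi * \<i> * W t = of_real (- pi * Y) + 2 * of_real pi * \<i> * of_real t"
      by (simp add: W_def algebra_simps)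
    thus ?thesis by (simp only: nome_def q_def expi2_def exp_add \<rho>_def exp_of_real)
  qed
  have mW: "modz (W t) = 1 - expi2 (of_real t) * c t" for t
    unfolding modz_nome nW by (simp add: c_def q_def)
  have c: "Re (c t) > 0" "norm (c t) < 2" for t
  proof -
    have "c t = of_real (2 * \<rho>) * V (q t)" by (simp add: c_def)
    hence "Re (c t) = (2 * \<rho>) * Re (V (q t))" by (metis Re_complex_of_real Im_complex_of_real mult_zero_left diff_zero times_complex.simps(1))
    thus "Re (c t) > 0" using Y(2)[of "q t"] rho by (simp add: nq \<rho>_def)
    show "norm (c t) < 2" using Y(3)[of "q t"] by (simp add: c_def nq \<rho>_def)
  qed
  \<comment> \<open>At both ends the nome is real, and \<open>V\<close> is real on the real axis, so
    the end points stay real during the straightening.\<close>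
  have c_end: "Im (c t) = 0" if "t \<in> {0, 1}" for t
  proof -
    have qt: "q t = of_real \<rho>" using that by (auto simp: q_def expi2_def[of 0])
    have "V (cnj (of_real \<rho>)) = cnj (V (of_real \<rho>))" using rho by (intro V_cnj) auto
    hence "Im (V (of_real \<rho>)) = 0" by (simp add: complex_eq_iff)
    thus ?thesis by (simp add: c_def qt)
  qed
  have contc: "continuous_on {0..1} c"
  proof -
    have "continuous_on {0..1} (\<lambda>t. V (q t))"
      by (rule continuous_on_compose2[OF holomorphic_on_imp_continuous_on[OF holomorphic_V]])
         (use rho nq in \<open>auto simp: q_def expi2_def intro!: continuous_intros\<close>)
    thus ?thesis unfolding c_def by (intro continuous_intros)
  qed
  define h where "h = (\<lambda>(s :: real, t :: real). 1 - expi2 (of_real t) * (of_real (1 - s) * c t + of_real s))"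
  \<comment> \<open>The radial factor of the homotopy. The curve meets 1 only if \<open>d\<close>
    vanishes and meets -1 only if \<open>d\<close> has modulus 2.\<close>
  define d where "d = (\<lambda>s t. of_real (1 - s) * c t + of_real s :: complex)"
  have d: "Re (d s t) > 0" "norm (d s t) < 2" if "s \<in> {0..1}" for s t
  proof -
    have "Re (d s t) = (1 - s) * Re (c t) + s" by (simp add: d_def)
    thus "Re (d s t) > 0" using that c(1)[of t] by (cases "s = 0") (auto intro: add_nonneg_pos)
    have "norm (d s t) \<le> norm (of_real (1 - s) * c t) + norm (of_real s :: complex)"
      unfolding d_def by (rule norm_triangle_ineq)
    also have "\<dots> = (1 - s) * norm (c t) + s" using that by (simp only: norm_mult norm_of_real) auto
    also have "\<dots> < 2"
    proof (cases "s = 1")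
      case False
      hence "(1 - s) * norm (c t) < (1 - s) * 2" using that c(2)[of t] by (intro mult_strict_left_mono) auto
      thus ?thesis using that by simp
    qed auto
    finally show "norm (d s t) < 2" .
  qed
  have hd: "h (s, t) = 1 - expi2 (of_real t) * d s t" for s t by (simp add: h_def d_def)
  have cl: "gen_loop A2 \<in> bv_class interval_tr (\<lambda>t. modz (W t))"
  proof (rule bv_homotopyI[of h])
    show "continuous_on ({0..1} \<times> {0..1}) h"
    proof -
      have "continuous_on ({0..1} \<times> {0..1}) (\<lambda>x. c (snd x))"
        by (rule continuous_on_compose2[OF contc]) (auto intro!: continuous_intros)
      thus ?thesis unfolding h_def case_prod_unfold expi2_def by (intro continuous_intros)
    qed
    show "h ` ({0..1} \<times> {0..1}) \<subseteq> twice_punctured"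
    proof clarify
      fix s t :: real assume s: "s \<in> {0..1}" and "t \<in> {0..1}"
      have "d s t \<noteq> 0" using d(1)[OF s, of t] by auto
      moreover have "expi2 (of_real t) * d s t \<noteq> 2"
      proof
        assume "expi2 (of_real t) * d s t = 2"
        hence "norm (expi2 (of_real t) * d s t) = norm (2 :: complex)" by (rule arg_cong)
        hence "norm (d s t) = 2" by (simp add: norm_mult norm_expi2)
        with d(2)[OF s, of t] show False by simp
      qed
      ultimately show "h (s, t) \<in> twice_punctured" by (auto simp: hd twice_punctured_def algebra_simps)
    qed
    show "h (0, t) = modz (W t)" for t by (simp add: mW h_def)
    show "h (1, t) = gen_loop A2 t" for t unfolding gen_loop_expi2 h_def by simp
    have "h (s, t) \<in> interval_tr" if "s \<in> {0..1}" "t \<in> {0, 1}" for s t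
    proof -
      have e: "expi2 (of_real t) = 1" using that(2) by (auto simp: expi2_def[of 0])
      have im: "Im (d s t) = 0" using c_end[OF that(2)] by (simp add: d_def)
      have "\<bar>Re (d s t)\<bar> < 2" using abs_Re_le_cmod[of "d s t"] d(2)[OF that(1), of t] by linarith
      thus ?thesis using d(1)[OF that(1), of t] im by (simp add: hd e interval_tr_iff)
    qed
    thus "h (s, 0) \<in> interval_tr" "h (s, 1) \<in> interval_tr" if "s \<in> {0..1}" for s using that by auto
  qed
  have iL: "\<i> * of_real Y \<in> L_tr" using Y(1) by (simp add: L_tr_def)
  have mob2: "mob (gen_mat A2 1) \<tau> = \<tau> + 2" for \<tau> by (simp add: mob_def gen_mat_def)
  obtain W' where W': "path W'" "path_image W' \<subseteq> upper_half" "\<And>t. t \<in> {0..1} \<Longrightarrow> modz (W' t) = gen_loop A2 t"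
    "W' 0 \<in> L_tr" "W' 1 \<in> mob (gen_mat A2 1) ` L_tr"
  proof (rule homotopy_slide[OF bl deck_gen_mat[of A2 1] _ _ _ _ _ cl])
    show "path W" unfolding path_def W_def by (intro continuous_intros)
    show "path_image W \<subseteq> upper_half" using Y(1) by (auto simp: path_image_def W_def upper_half_def)
    show "W 0 \<in> L_tr" using iL by (simp add: W_def)
    show "W 1 \<in> mob (gen_mat A2 1) ` L_tr" using iL by (auto simp: mob2 W_def)
  qed blast+
  have g0: "gen_loop A2 0 = 0" "gen_loop A2 1 = 0" unfolding gen_loop_expi2 by (simp_all add: expi2_def[of 0])
  \<comment> \<open>The sliding homotopy only places the ends on the two geodesics; injectivity of
    \<open>modz\<close> on \<open>L_tr\<close> then identifies them as \<i> and its
    translate.\<close>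
  have zero: "l = \<i>" if "l \<in> L_tr" "modz l = 0" for l
    using b that by metis
  have s: "W' 0 = \<i>" using zero W'(4) W'(3)[of 0] g0 by simp
  obtain l where l: "l \<in> L_tr" "W' 1 = mob (gen_mat A2 1) l" using W'(5) by blast
  have "modz l = modz (W' 1)" using l deck_gen_mat[of A2 1] b by (auto simp: deck_def)
  hence "l = \<i>" using zero l(1) W'(3)[of 1] g0 by simp
  with s W' l show ?thesis
    unfolding lifts_def by (intro conjI deck_gen_mat exI[of _ W']) (auto simp: pathstart_def pathfinish_def)
qed

text \<open>The loop for \<open>A1\<close> is the negative of the loop for \<open>A2\<close>, and -1
  / \<tau> covers the change of sign.\<close>

lemma lifts_gen_loop: "lifts (gen_loop g) (gen_mat g 1)"
proof (cases g)
  case A2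
  thus ?thesis using lifts_gen_loop_A2 by simp
next
  case A1
  obtain W where W: "path W" "path_image W \<subseteq> upper_half" "pathstart W = \<i>" "pathfinish W = mob (gen_mat A2 1) \<i>"
     "\<And>t. t \<in> {0..1} \<Longrightarrow> modz (W t) = gen_loop A2 t"
    using lifts_gen_loop_A2 unfolding lifts_def by blast
  have WH: "W t \<in> upper_half" if "t \<in> {0..1}" for t using W(2) that by (auto simp: path_image_def)
  have "lifts (gen_loop A1) (gen_mat A1 1)"
    unfolding lifts_def
  proof (intro conjI deck_gen_mat exI[of _ "\<lambda>t. - 1 / W t"] ballI)
    show "path (\<lambda>t. - 1 / W t)"
    proof -
      have "W t \<noteq> 0" if "t \<in> {0..1}" for t using WH[OF that] by (auto simp: upper_half_def)
      thus ?thesis using W(1) unfolding path_def by (intro continuous_intros) auto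
    qed
    show "path_image (\<lambda>t. - 1 / W t) \<subseteq> upper_half"
      using WH Im_S by (auto simp: path_image_def upper_half_def simp del: minus_divide_left)
    show "pathstart (\<lambda>t. - 1 / W t) = \<i>" using W(3) by (simp add: pathstart_def)
    have "- 1 / (\<i> + 2) = \<i> / (1 - 2 * \<i>)" by (simp add: complex_eq_iff Re_divide Im_divide)
    thus "pathfinish (\<lambda>t. - 1 / W t) = mob (gen_mat A1 1) \<i>"
      using W(4) by (simp add: pathfinish_def mob_def gen_mat_def)
    show "modz (- 1 / W t) = gen_loop A1 t" if "t \<in> {0..1}" for t
      using modz_S[OF WH[OF that]] W(5)[OF that] unfolding gen_loop_expi2 by simp
  qed
  with A1 show ?thesis by simp
qed

lemma lifts_const: "lifts (\<lambda>_. 0) mid"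
  unfolding lifts_def
  by (intro conjI deck_mid exI[of _ "\<lambda>_. \<i>"]) (auto simp: modz_i path_def pathstart_def pathfinish_def path_image_def)

lemma path_mob:
  assumes "mdet M = 1" "path W" "path_image W \<subseteq> upper_half"
  shows "path (mob M \<circ> W)" "path_image (mob M \<circ> W) \<subseteq> upper_half"
proof -
  show "path (mob M \<circ> W)"
    using assms continuous_mob[OF assms(1)] by (auto intro!: path_continuous_image intro: continuous_on_subset)
  show "path_image (mob M \<circ> W) \<subseteq> upper_half"
    using assms mob_upper_half[OF assms(1)] by (auto simp: path_image_def)
qed

text \<open>The second lift is moved by the deck transformation of the first so that the pieces fit
  together. This is why the matrix of the first path stands on the left of the product.\<close>

lemma lifts_join:
  assumes "lifts p M" "lifts q N"
  shows "lifts (p +++ q) (mmul M N)"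
proof -
  obtain W where W: "path W" "path_image W \<subseteq> upper_half" "pathstart W = \<i>" "pathfinish W = mob M \<i>"
     "\<And>t. t \<in> {0..1} \<Longrightarrow> modz (W t) = p t" and M: "deck M"
    using assms(1) unfolding lifts_def by blast
  obtain W' where W': "path W'" "path_image W' \<subseteq> upper_half" "pathstart W' = \<i>" "pathfinish W' = mob N \<i>"
     "\<And>t. t \<in> {0..1} \<Longrightarrow> modz (W' t) = q t" and N: "deck N"
    using assms(2) unfolding lifts_def by blast
  have det: "mdet M = 1" "mdet N = 1" using M N by (auto simp: deck_def)
  note p' = path_mob[OF det(1) W'(1,2)]
  show ?thesis
    unfolding lifts_def
  proof (intro conjI exI[of _ "W +++ (mob M \<circ> W')"] ballI)
    show "deck (mmul M N)" by (rule deck_mmul[OF M N])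
    show "path (W +++ (mob M \<circ> W'))" using W p' W'(3) by (simp add: pathstart_compose)
    show "path_image (W +++ (mob M \<circ> W')) \<subseteq> upper_half"
      using W(2) p'(2) path_image_join_subset by blast
    show "pathstart (W +++ (mob M \<circ> W')) = \<i>" using W(3) by simp
    show "pathfinish (W +++ (mob M \<circ> W')) = mob (mmul M N) \<i>"
      using W'(4) by (simp add: pathfinish_compose mob_mmul[OF det(2)])
    show "modz ((W +++ (mob M \<circ> W')) t) = (p +++ q) t" if t: "t \<in> {0..1}" for t
    proof (cases "t \<le> 1 / 2")
      case True
      thus ?thesis using W(5)[of "2 * t"] t by (simp add: joinpaths_def)
    next
      case False
      hence r: "2 * t - 1 \<in> {0..1}" using t by auto
      have "W' (2 * t - 1) \<in> upper_half" using W'(2) r by (auto simp: path_image_def)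
      thus ?thesis using W'(5)[OF r] M False by (simp add: joinpaths_def deck_def)
    qed
  qed
qed

lemma lifts_reversepath:
  assumes "lifts p M"
  shows "lifts (reversepath p) (minv M)"
proof -
  obtain W where W: "path W" "path_image W \<subseteq> upper_half" "pathstart W = \<i>" "pathfinish W = mob M \<i>"
     "\<And>t. t \<in> {0..1} \<Longrightarrow> modz (W t) = p t" and M: "deck M"
    using assms(1) unfolding lifts_def by blast
  have det: "mdet M = 1" "mdet (minv M) = 1" using M by (auto simp: deck_def mdet_minv)
  have "path (reversepath W)" "path_image (reversepath W) \<subseteq> upper_half" using W by auto
  note p' = path_mob[OF det(2) this]
  show ?thesis
    unfolding lifts_def
  proof (intro conjI exI[of _ "mob (minv M) \<circ> reversepath W"] ballI)
    show "deck (minv M)" by (rule deck_minv[OF M])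
    show "path (mob (minv M) \<circ> reversepath W)" "path_image (mob (minv M) \<circ> reversepath W) \<subseteq> upper_half" by (fact p')+
    show "pathstart (mob (minv M) \<circ> reversepath W) = \<i>" using W(4) mob_minv(1)[OF det(1)] by (simp add: pathstart_compose)
    show "pathfinish (mob (minv M) \<circ> reversepath W) = mob (minv M) \<i>" using W(3) by (simp add: pathfinish_compose)
    show "modz ((mob (minv M) \<circ> reversepath W) t) = reversepath p t" if t: "t \<in> {0..1}" for t
    proof -
      have r: "1 - t \<in> {0..1}" using t by auto
      have "W (1 - t) \<in> upper_half" using W(2) r by (auto simp: path_image_def)
      thus ?thesis using W(5)[OF r] deck_minv[OF M] by (simp add: reversepath_def deck_def)
    qed
  qed
qed

lemma lifts_loop_power:
  assumes "lifts p (gen_mat g e)" "pathstart p = 0"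
  shows "lifts (loop_power p n) (gen_mat g (e * int n))"
proof (induction n)
  case 0
  have "gen_mat g 0 = mid" by (cases g) (simp_all add: gen_mat_def mid_def)
  thus ?case using lifts_const assms(2) by simp
next
  case (Suc n)
  have "mmul (gen_mat g e) (gen_mat g (e * int n)) = gen_mat g (e * int (Suc n))"
    by (cases g) (simp_all add: gen_mat_def mmul_def algebra_simps)
  thus ?case using lifts_join[OF assms(1) Suc] by simp
qed

lemma lifts_term_path: "lifts (term_path g n) (gen_mat g n)"
proof (cases "n \<ge> 0")
  case True
  thus ?thesis using lifts_loop_power[OF lifts_gen_loop pathstart_gen_loop, of g "nat n"] by (simp add: term_path_def)
next
  case False
  have "minv (gen_mat g 1) = gen_mat g (- 1)" by (cases g) (simp_all add: gen_mat_def minv_def)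
  hence "lifts (reversepath (gen_loop g)) (gen_mat g (- 1))" using lifts_reversepath[OF lifts_gen_loop, of g] by simp
  from lifts_loop_power[OF this, of "nat (- n)"] False show ?thesis
    by (simp add: term_path_def pathfinish_gen_loop)
qed

lemma lifts_word_path: "lifts (word_path w) (word_mat w)"
  by (induction w rule: word_path.induct) (simp_all add: lifts_const lifts_join lifts_term_path)

lemma modz_translate_boundary:
  assumes "boundary_lift A L g" "deck M" "x \<in> mob M ` L"
  shows "modz x \<in> A"
proof -
  obtain l where l: "l \<in> L" "x = mob M l" using assms(3) by blast
  hence "l \<in> upper_half" "modz l \<in> A" using assms(1) unfolding boundary_lift_def by auto
  thus ?thesis using assms(2) l(2) by (simp add: deck_def)
qed

lemma upper_half_homotopy_in_class:
  fixes k :: "real \<times> real \<Rightarrow> complex"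
  assumes bl: "boundary_lift A L g" and M: "deck M"
    and k: "continuous_on ({0..1} \<times> {0..1}) k" "k ` ({0..1} \<times> {0..1}) \<subseteq> upper_half"
      "\<And>s. s \<in> {0..1} \<Longrightarrow> k (s, 0) \<in> L" "\<And>s. s \<in> {0..1} \<Longrightarrow> k (s, 1) \<in> mob M ` L"
    and p: "\<And>t. t \<in> {0..1} \<Longrightarrow> p t = modz (k (0, t))" and q: "\<And>t. t \<in> {0..1} \<Longrightarrow> q t = modz (k (1, t))"
  shows "q \<in> bv_class A p"
proof (rule bv_homotopyI[of "\<lambda>x. modz (k x)"])
  note b = bl[unfolded boundary_lift_def]
  show "continuous_on ({0..1} \<times> {0..1}) (\<lambda>x. modz (k x))"
    by (rule continuous_on_compose2[OF continuous_modz k(1,2)])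
  show "(\<lambda>x. modz (k x)) ` ({0..1} \<times> {0..1}) \<subseteq> twice_punctured" using k(2) modz_in by blast
  show "modz (k (s, 0)) \<in> A" if "s \<in> {0..1}" for s using k(3)[OF that] b by blast
  show "modz (k (s, 1)) \<in> A" if s: "s \<in> {0..1}" for s
    by (rule modz_translate_boundary[OF bl M k(4)[OF s]])
qed (use p q in auto)

text \<open>In the convex upper half-plane every path between the two geodesics can be deformed to a
  segment, and segments are deformed into each other while their ends move along the path-connected
  geodesics.\<close>

lemma lift_in_class:
  assumes bl: "boundary_lift A L g" and p: "lifts p M" and iL: "\<i> \<in> L"
    and \<gamma>: "path \<gamma>" "path_image \<gamma> \<subseteq> upper_half" "\<gamma> 0 \<in> L" "\<gamma> 1 \<in> mob M ` L"
    and q: "\<And>t. t \<in> {0..1} \<Longrightarrow> q t = modz (\<gamma> t)"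
  shows "q \<in> bv_class A p"
proof -
  note b = bl[unfolded boundary_lift_def]
  obtain W where W: "path W" "path_image W \<subseteq> upper_half" "pathstart W = \<i>" "pathfinish W = mob M \<i>"
     "\<And>t. t \<in> {0..1} \<Longrightarrow> modz (W t) = p t" and M: "deck M"
    using p unfolding lifts_def by blast
  have det: "mdet M = 1" using M by (simp add: deck_def)
  have W01: "W 0 = \<i>" "W 1 = mob M \<i>" using W(3,4) by (simp_all add: pathstart_def pathfinish_def)
  have pc: "path_connected L" by (rule path_connected_boundary_lift[OF bl])
  have pc': "path_connected (mob M ` L)"
    by (rule path_connected_continuous_image[OF _ pc]) (use continuous_mob[OF det] b continuous_on_subset in blast)
  have MLH: "mob M ` L \<subseteq> upper_half" using b mob_upper_half[OF det] by blast
  obtain \<alpha> where \<alpha>: "path \<alpha>" "path_image \<alpha> \<subseteq> L" "pathstart \<alpha> = W 0" "pathfinish \<alpha> = \<gamma> 0"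
    using pc \<gamma>(3) iL W01 unfolding path_connected_def by metis
  obtain \<beta> where \<beta>: "path \<beta>" "path_image \<beta> \<subseteq> mob M ` L" "pathstart \<beta> = W 1" "pathfinish \<beta> = \<gamma> 1"
    using pc' \<gamma>(4) iL W01 unfolding path_connected_def by (metis imageI)
  have ends: "\<alpha> 0 = W 0" "\<alpha> 1 = \<gamma> 0" "\<beta> 0 = W 1" "\<beta> 1 = \<gamma> 1"
    using \<alpha>(3,4) \<beta>(3,4) by (simp_all add: pathstart_def pathfinish_def)
  define S where "S = (\<lambda>(u :: complex) v (t :: real). (1 - t) *\<^sub>R u + t *\<^sub>R v)"
  have SH: "S u v t \<in> upper_half" if "u \<in> upper_half" "v \<in> upper_half" "t \<in> {0..1}" for u v t
    unfolding S_def using convexD_alt[OF convex_upper_half that(1,2)] that(3) by auto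
  have S01: "S u v 0 = u" "S u v 1 = v" "S u u t = u" for u v t by (simp_all add: S_def algebra_simps)
  have pH: "f t \<in> B" if "path_image f \<subseteq> B" "t \<in> {0..1}" for f :: "real \<Rightarrow> complex" and B t
    using that by (auto simp: path_image_def)
  have cp: "continuous_on ({0..1} \<times> {0..1}) (\<lambda>x. f (fst x))" "continuous_on ({0..1} \<times> {0..1}) (\<lambda>x. f (snd x))"
    if "path f" for f :: "real \<Rightarrow> complex"
    using that unfolding path_def
    by (auto intro!: continuous_on_compose2[of "{0..1}" f] continuous_intros)
  \<comment> \<open>Deformation of a path to the segment between its own end points.\<close>
  have straight: "(\<lambda>t. modz (S (\<delta> 0) (\<delta> 1) t)) \<in> bv_class A r"
    if \<delta>: "path \<delta>" "path_image \<delta> \<subseteq> upper_half" "\<delta> 0 \<in> L" "\<delta> 1 \<in> mob M ` L" "\<And>t. t \<in> {0..1} \<Longrightarrow> r t = modz (\<delta> t)" for \<delta> r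
  proof (rule upper_half_homotopy_in_class[OF bl M, of "\<lambda>x. S (\<delta> (snd x)) (S (\<delta> 0) (\<delta> 1) (snd x)) (fst x)"])
    show "continuous_on ({0..1} \<times> {0..1}) (\<lambda>x. S (\<delta> (snd x)) (S (\<delta> 0) (\<delta> 1) (snd x)) (fst x))"
      unfolding S_def by (intro continuous_intros cp[OF \<delta>(1)])
    have "\<delta> 0 \<in> upper_half" "\<delta> 1 \<in> upper_half" using pH[OF \<delta>(2)] by auto
    thus "(\<lambda>x. S (\<delta> (snd x)) (S (\<delta> 0) (\<delta> 1) (snd x)) (fst x)) ` ({0..1} \<times> {0..1}) \<subseteq> upper_half"
      using pH[OF \<delta>(2)] by (auto intro!: SH)
  qed (use \<delta> S01 in auto)
  have "(\<lambda>t. modz (S (W 0) (W 1) t)) \<in> bv_class A p"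
    using straight[of W p] W W01 iL by auto
  \<comment> \<open>Here the end points move along \<alpha> in \<open>L\<close> and along \<beta> in
    its translate.\<close>
  moreover have "(\<lambda>t. modz (S (\<gamma> 0) (\<gamma> 1) t)) \<in> bv_class A (\<lambda>t. modz (S (W 0) (W 1) t))"
  proof (rule upper_half_homotopy_in_class[OF bl M, of "\<lambda>x. S (\<alpha> (fst x)) (\<beta> (fst x)) (snd x)"])
    show "continuous_on ({0..1} \<times> {0..1}) (\<lambda>x. S (\<alpha> (fst x)) (\<beta> (fst x)) (snd x))"
      unfolding S_def by (intro continuous_intros cp[OF \<alpha>(1)] cp[OF \<beta>(1)])
    show "(\<lambda>x. S (\<alpha> (fst x)) (\<beta> (fst x)) (snd x)) ` ({0..1} \<times> {0..1}) \<subseteq> upper_half"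
      using pH[OF \<alpha>(2)] pH[OF \<beta>(2)] b MLH by (auto intro!: SH)
    show "S (\<alpha> (fst (s, 0))) (\<beta> (fst (s, 0))) (snd (s, 0 :: real)) \<in> L" if "s \<in> {0..1}" for s
      using pH[OF \<alpha>(2) that] S01 by simp
    show "S (\<alpha> (fst (s, 1))) (\<beta> (fst (s, 1))) (snd (s, 1 :: real)) \<in> mob M ` L" if "s \<in> {0..1}" for s
      using pH[OF \<beta>(2) that] S01 by simp
  qed (use ends in auto)
  moreover have "q \<in> bv_class A (\<lambda>t. modz (S (\<gamma> 0) (\<gamma> 1) t))"
    by (rule bv_class_sym[OF straight[OF \<gamma> q]])
  ultimately show ?thesis using bv_class_trans by blast
qed

section \<open>Lifting maps of rectangles\<close>

text \<open>The branch is chosen on the left side, whose class gives a lift that joins the two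
  geodesics. From the two left corners the horizontal sides are followed by sliding.\<close>

lemma rectangle_lift:
  assumes bl: "boundary_lift A L g" and iL: "\<i> \<in> L" and zz: "Re z < Re z'" "Im z < Im z'"
    and f: "f holomorphic_on box z z'" and rep: "represents A (bv_class A (word_path w)) z z' f"
  obtains G where "continuous_on (cbox z z') G" "G holomorphic_on box z z'" "G ` cbox z z' \<subseteq> upper_half"
    "\<And>\<zeta>. \<zeta> \<in> cbox z z' \<Longrightarrow> Im \<zeta> = Im z \<Longrightarrow> G \<zeta> \<in> L"
    "\<And>\<zeta>. \<zeta> \<in> cbox z z' \<Longrightarrow> Im \<zeta> = Im z' \<Longrightarrow> G \<zeta> \<in> mob (word_mat w) ` L"
proof -
  note b = bl[unfolded boundary_lift_def]
  define M where "M = word_mat w"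
  obtain F where F: "continuous_on (cbox z z') F" "F ` cbox z z' \<subseteq> twice_punctured"
    "\<And>\<zeta>. \<zeta> \<in> box z z' \<Longrightarrow> F \<zeta> = f \<zeta>"
    "\<And>\<zeta>. \<zeta> \<in> cbox z z' \<Longrightarrow> Im \<zeta> = Im z \<or> Im \<zeta> = Im z' \<Longrightarrow> F \<zeta> \<in> A"
    "F \<circ> linepath z (Complex (Re z) (Im z')) \<in> bv_class A (word_path w)"
    using rep unfolding represents_def by blast
  define z1 where "z1 = Complex (Re z) (Im z')"
  obtain W where W: "path W" "path_image W \<subseteq> upper_half" "pathstart W = \<i>" "pathfinish W = mob M \<i>"
     "\<And>t. t \<in> {0..1} \<Longrightarrow> modz (W t) = word_path w t" and M: "deck M"
    using lifts_word_path[of w] unfolding lifts_def M_def by blast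
  obtain W' where W': "path W'" "path_image W' \<subseteq> upper_half"
    "\<And>t. t \<in> {0..1} \<Longrightarrow> modz (W' t) = (F \<circ> linepath z z1) t" "W' 0 \<in> L" "W' 1 \<in> mob M ` L"
  proof (rule homotopy_slide[OF bl M W(1,2,5) _ _ F(5)[folded z1_def]])
    show "W 0 \<in> L" "W 1 \<in> mob M ` L" using W(3,4) iL by (auto simp: pathstart_def pathfinish_def)
  qed blast+
  have zin: "z \<in> cbox z z'" "z1 \<in> cbox z z'" using zz by (auto simp: in_cbox_complex_iff z1_def)
  have conv: "convex (cbox z z')" by (rule convex_box)
  have W0: "W' 0 \<in> upper_half" using W'(4) b by blast
  have Fz: "F z = modz (W' 0)" using W'(3)[of 0] by (simp add: linepath_def)
  obtain G where G: "continuous_on (cbox z z') G" "G \<in> cbox z z' \<rightarrow> upper_half" "G z = W' 0"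
      "\<And>\<zeta>. \<zeta> \<in> cbox z z' \<Longrightarrow> modz (G \<zeta>) = F \<zeta>"
    using covering_space_lift_strong[OF covering_modz W0 zin(1) convex_imp_simply_connected[OF conv]
      convex_imp_locally_path_connected[OF conv] F(1) _ Fz] F(2) by blast
  have seg: "linepath \<zeta> \<xi> s \<in> cbox z z'" if "\<zeta> \<in> cbox z z'" "\<xi> \<in> cbox z z'" "s \<in> {0..1}" for \<zeta> \<xi> s
    unfolding linepath_def using convexD_alt[OF conv that(1,2)] that(3) by auto
  have pth: "path (H \<circ> linepath \<zeta> \<xi>)" if "continuous_on (cbox z z') H" "\<zeta> \<in> cbox z z'" "\<xi> \<in> cbox z z'" for H :: "complex \<Rightarrow> complex" and \<zeta> \<xi>
  proof (rule path_continuous_image)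
    show "path (linepath \<zeta> \<xi>)" by simp
    show "continuous_on (path_image (linepath \<zeta> \<xi>)) H"
      by (rule continuous_on_subset[OF that(1)]) (use seg[OF that(2,3)] in \<open>auto simp: path_image_def\<close>)
  qed
  \<comment> \<open>The lift on the rectangle agrees along the left side with the lift obtained from
    the homotopy, so the upper left corner lies on the translated geodesic.\<close>
  have G1: "G z1 = W' 1"
  proof -
    have "(G \<circ> linepath z z1) 1 = W' 1"
    proof (rule covering_space_lift_unique[OF covering_modz, of "G \<circ> linepath z z1" 0 W' "{0..1}" "F \<circ> linepath z z1"])
      show "(G \<circ> linepath z z1) 0 = W' 0" using G(3) by (simp add: linepath_def)
      show "continuous_on {0..1} (F \<circ> linepath z z1)" "continuous_on {0..1} (G \<circ> linepath z z1)"
        using pth[OF F(1) zin] pth[OF G(1) zin] by (simp_all add: path_def)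
      show "F \<circ> linepath z z1 \<in> {0..1} \<rightarrow> twice_punctured" "G \<circ> linepath z z1 \<in> {0..1} \<rightarrow> upper_half"
        using seg[OF zin] F(2) G(2) by auto
      show "(F \<circ> linepath z z1) x = modz ((G \<circ> linepath z z1) x)" if "x \<in> {0..1}" for x
        using G(4) seg[OF zin that] by simp
      show "continuous_on {0..1} W'" "W' \<in> {0..1} \<rightarrow> upper_half" using W'(1,2) by (auto simp: path_def path_image_def)
      show "(F \<circ> linepath z z1) x = modz (W' x)" if "x \<in> {0..1}" for x using W'(3)[OF that] by simp
    qed auto
    thus ?thesis by (simp add: linepath_def)
  qed
  have edge: "G \<xi> \<in> mob N ` L" if N: "deck N" and e: "\<zeta> \<in> cbox z z'" "\<xi> \<in> cbox z z'" "Im \<xi> = Im \<zeta>" "Im \<zeta> = Im z \<or> Im \<zeta> = Im z'"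
      and st: "G \<zeta> \<in> mob N ` L" for N \<zeta> \<xi>
  proof -
    have "(G \<circ> linepath \<zeta> \<xi>) 1 \<in> mob N ` L"
    proof (rule lift_endpoint_slide[OF bl N, of "F \<circ> linepath \<zeta> \<xi>"])
      show "path (F \<circ> linepath \<zeta> \<xi>)" "path (G \<circ> linepath \<zeta> \<xi>)" using pth[OF F(1) e(1,2)] pth[OF G(1) e(1,2)] by auto
      have im: "Im (linepath \<zeta> \<xi> s) = Im \<zeta>" for s using e(3) by (simp add: linepath_def algebra_simps)
      show "path_image (F \<circ> linepath \<zeta> \<xi>) \<subseteq> A"
        using F(4) seg[OF e(1,2)] im e(4) by (auto simp: path_image_def)
      show "path_image (G \<circ> linepath \<zeta> \<xi>) \<subseteq> upper_half" using G(2) seg[OF e(1,2)] by (auto simp: path_image_def)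
      show "modz ((G \<circ> linepath \<zeta> \<xi>) s) = (F \<circ> linepath \<zeta> \<xi>) s" if "s \<in> {0..1}" for s using G(4) seg[OF e(1,2) that] by simp
      show "(G \<circ> linepath \<zeta> \<xi>) 0 \<in> mob N ` L" using st by (simp add: linepath_def)
    qed auto
    thus ?thesis by (simp add: linepath_def)
  qed
  have boxsub: "box z z' \<subseteq> cbox z z'" by (rule box_subset_cbox)
  show ?thesis
  proof (rule that[of G])
    show "continuous_on (cbox z z') G" by fact
    show "G ` cbox z z' \<subseteq> upper_half" using G(2) by blast
    show "G holomorphic_on box z z'"
    proof (rule covering_space_lift_is_holomorphic[OF covering_modz open_upper_half holomorphic_modz f])
      show "f \<in> box z z' \<rightarrow> twice_punctured" using F(2,3) boxsub by (metis Pi_I image_subset_iff subsetD)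
      show "G \<in> box z z' \<rightarrow> upper_half" using G(2) boxsub by blast
      show "continuous_on (box z z') G" using G(1) boxsub continuous_on_subset by blast
      show "modz (G x) = f x" if "x \<in> box z z'" for x using G(4) F(3)[OF that] boxsub that by auto
    qed
    show "G \<zeta> \<in> L" if "\<zeta> \<in> cbox z z'" "Im \<zeta> = Im z" for \<zeta>
      using edge[OF deck_mid zin(1) that(1)] that(2) G(3) W'(4) by simp
    show "G \<zeta> \<in> mob (word_mat w) ` L" if "\<zeta> \<in> cbox z z'" "Im \<zeta> = Im z'" for \<zeta>
      using edge[OF M zin(2) that(1)] that(2) G1 W'(5) by (simp add: z1_def M_def)
  qed
qed

text \<open>The converse passage: both vertical sides join the two geodesics in the upper
  half-plane, which already determines the class of their images.\<close>

lemma represents_lift: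
  assumes bl: "boundary_lift A L g" and iL: "\<i> \<in> L" and zz: "Re z < Re z'" "Im z < Im z'"
    and G: "continuous_on (cbox z z') G" "G holomorphic_on box z z'" "G ` cbox z z' \<subseteq> upper_half"
    and bot: "\<And>\<zeta>. \<zeta> \<in> cbox z z' \<Longrightarrow> Im \<zeta> = Im z \<Longrightarrow> G \<zeta> \<in> L"
    and top: "\<And>\<zeta>. \<zeta> \<in> cbox z z' \<Longrightarrow> Im \<zeta> = Im z' \<Longrightarrow> G \<zeta> \<in> mob (word_mat w) ` L"
  shows "extremal_length A (bv_class A (word_path w)) \<le> ereal (rect_ratio z z')"
proof -
  note b = bl[unfolded boundary_lift_def]
  define f where "f = (\<lambda>\<zeta>. modz (G \<zeta>))"
  have boxsub: "box z z' \<subseteq> cbox z z'" by (rule box_subset_cbox)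
  have M: "deck (word_mat w)" by (rule deck_word_mat)
  have conv: "convex (cbox z z')" by (rule convex_box)
  have cls: "f \<circ> linepath \<zeta> \<xi> \<in> bv_class A (word_path w)"
    if e: "\<zeta> \<in> cbox z z'" "\<xi> \<in> cbox z z'" "Im \<zeta> = Im z" "Im \<xi> = Im z'" for \<zeta> \<xi>
  proof (rule lift_in_class[OF bl lifts_word_path iL, of "G \<circ> linepath \<zeta> \<xi>"])
    have seg: "linepath \<zeta> \<xi> s \<in> cbox z z'" if "s \<in> {0..1}" for s
      unfolding linepath_def using convexD_alt[OF conv e(1,2)] that by auto
    show "path (G \<circ> linepath \<zeta> \<xi>)"
      by (rule path_continuous_image) (use seg in \<open>auto simp: path_image_def intro!: continuous_on_subset[OF G(1)]\<close>)
    show "path_image (G \<circ> linepath \<zeta> \<xi>) \<subseteq> upper_half" using G(3) seg by (auto simp: path_image_def)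
    show "(G \<circ> linepath \<zeta> \<xi>) 0 \<in> L" using bot[OF e(1,3)] by (simp add: linepath_def)
    show "(G \<circ> linepath \<zeta> \<xi>) 1 \<in> mob (word_mat w) ` L" using top[OF e(2,4)] by (simp add: linepath_def)
  qed (simp add: f_def)
  have "f holomorphic_on box z z'"
  proof -
    have "(modz \<circ> G) holomorphic_on box z z'"
      by (rule holomorphic_on_compose_gen[OF G(2) holomorphic_modz]) (use G(3) boxsub in blast)
    thus ?thesis by (simp add: f_def o_def)
  qed
  moreover have fX: "f ` cbox z z' \<subseteq> twice_punctured" using G(3) modz_in by (auto simp: f_def)
  moreover have "represents A (bv_class A (word_path w)) z z' f"
    unfolding represents_def
  proof (intro exI[of _ f] conjI ballI impI)
    show "continuous_on (cbox z z') f" unfolding f_def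
      by (rule continuous_on_compose2[OF continuous_modz G(1,3)])
    show "f ` cbox z z' \<subseteq> twice_punctured" by fact
    show "f \<zeta> \<in> A" if \<zeta>: "\<zeta> \<in> cbox z z'" and e: "Im \<zeta> = Im z \<or> Im \<zeta> = Im z'" for \<zeta>
      using e
    proof
      assume "Im \<zeta> = Im z"
      thus ?thesis using bot[OF \<zeta>] b by (auto simp: f_def)
    next
      assume "Im \<zeta> = Im z'"
      thus ?thesis using modz_translate_boundary[OF bl M top[OF \<zeta>]] by (simp add: f_def)
    qed
    show "f \<circ> linepath z (Complex (Re z) (Im z')) \<in> bv_class A (word_path w)"
      by (rule cls) (use zz in \<open>auto simp: in_cbox_complex_iff\<close>)
    show "f \<circ> linepath (Complex (Re z') (Im z)) z' \<in> bv_class A (word_path w)"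
      by (rule cls) (use zz in \<open>auto simp: in_cbox_complex_iff\<close>)
  qed auto
  ultimately show ?thesis
    unfolding extremal_length_def using zz boxsub by (intro Inf_lower) blast
qed

subsection \<open>The extremal problem between two geodesics\<close>

lemma has_integral_unit_bounds:
  fixes f :: "real \<Rightarrow> real"
  assumes "(f has_integral J) {0..1}" "\<And>x. x \<in> {0..1} \<Longrightarrow> lo \<le> f x \<and> f x \<le> hi"
  shows "lo \<le> J \<and> J \<le> hi"
  using has_integral_le[OF has_integral_const_real[of lo 0 1] assms(1)]
    has_integral_le[OF assms(1) has_integral_const_real[of hi 0 1]] assms(2) by auto

text \<open>The real part of Cauchy's theorem for the boundary of the rectangle.\<close>

lemma rectangle_estimate:
  assumes zz: "Re z < Re z'" "Im z < Im z'"
    and g: "continuous_on (cbox z z') g" "g holomorphic_on box z z'"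
    and im: "\<And>\<zeta>. \<zeta> \<in> cbox z z' \<Longrightarrow> 0 \<le> Im (g \<zeta>) \<and> Im (g \<zeta>) \<le> pi"
    and bot: "\<And>\<zeta>. \<zeta> \<in> cbox z z' \<Longrightarrow> Im \<zeta> = Im z \<Longrightarrow> Re (g \<zeta>) = 0"
    and top: "\<And>\<zeta>. \<zeta> \<in> cbox z z' \<Longrightarrow> Im \<zeta> = Im z' \<Longrightarrow> Re (g \<zeta>) = l"
  shows "\<bar>l\<bar> * (Re z' - Re z) \<le> pi * (Im z' - Im z)"
proof -
  define z2 where "z2 = Complex (Re z') (Im z)"
  define z4 where "z4 = Complex (Re z) (Im z')"
  define b where "b = Re z' - Re z"
  define a where "a = Im z' - Im z"
  have ab: "a > 0" "b > 0" using zz by (auto simp: a_def b_def)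
  have inn: "z \<in> cbox z z'" "z2 \<in> cbox z z'" "z' \<in> cbox z z'" "z4 \<in> cbox z z'"
    using zz by (auto simp: in_cbox_complex_iff z2_def z4_def)
  have conv: "convex (cbox z z')" by (rule convex_box)
  have seg: "linepath x y t \<in> cbox z z'" if "x \<in> cbox z z'" "y \<in> cbox z z'" "t \<in> {0..1}" for x y t
    unfolding linepath_def using convexD_alt[OF conv that(1,2)] that(3) by auto
  have sub: "closed_segment x y \<subseteq> cbox z z'" if "x \<in> cbox z z'" "y \<in> cbox z z'" for x y
    using conv that by (rule closed_segment_subset[rotated 2])
  have int: "g contour_integrable_on linepath x y" if "x \<in> cbox z z'" "y \<in> cbox z z'" for x y
    by (rule contour_integrable_continuous_linepath[OF continuous_on_subset[OF g(1) sub[OF that]]])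
  define I where "I = (\<lambda>x y. contour_integral (linepath x y) g)"
  have hi: "((\<lambda>t. Re (g (linepath x y t) * (y - x))) has_integral Re (I x y)) {0..1}"
    if "x \<in> cbox z z'" "y \<in> cbox z z'" for x y
  proof -
    have "(g has_contour_integral I x y) (linepath x y)"
      unfolding I_def using int[OF that] by (rule has_contour_integral_integral)
    hence "((\<lambda>t. g (linepath x y t) * (y - x)) has_integral I x y) {0..1}"
      by (simp add: has_contour_integral_linepath)
    from has_integral_linear[OF this bounded_linear_Re] show ?thesis by (simp add: o_def)
  qed
  have "(g has_contour_integral (I z z2 + (I z2 z' + (I z' z4 + I z4 z)))) (rectpath z z')"
  proof -
    have r: "rectpath z z' = linepath z z2 +++ linepath z2 z' +++ linepath z' z4 +++ linepath z4 z"
      by (simp add: rectpath_def Let_def z2_def z4_def)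
    have hc: "(g has_contour_integral I x y) (linepath x y)" if "x \<in> cbox z z'" "y \<in> cbox z z'" for x y
      unfolding I_def using int[OF that] by (rule has_contour_integral_integral)
    show ?thesis unfolding r
      by (intro has_contour_integral_join hc inn valid_path_join) auto
  qed
  moreover have "(g has_contour_integral 0) (rectpath z z')"
  proof (rule Cauchy_theorem_convex[OF g(1) conv, of "{}"])
    fix x assume "x \<in> interior (cbox z z') - {}"
    thus "g field_differentiable at x"
      using holomorphic_on_imp_differentiable_at[OF g(2) open_box, of x] by (simp add: interior_cbox)
  next
    show "path_image (rectpath z z') \<subseteq> cbox z z'"
      using zz by (intro path_image_rectpath_subset_cbox) auto
  qed auto
  ultimately have "I z z2 + (I z2 z' + (I z' z4 + I z4 z)) = 0"
    by (rule has_contour_integral_unique)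
  hence "Re (I z z2 + (I z2 z' + (I z' z4 + I z4 z))) = 0" by simp
  hence sum: "Re (I z z2) + (Re (I z2 z') + (Re (I z' z4) + Re (I z4 z))) = 0" by simp
  have "0 \<le> Re (I z z2) \<and> Re (I z z2) \<le> 0"
  proof (rule has_integral_unit_bounds[OF hi[OF inn(1,2)]])
    fix t :: real assume t: "t \<in> {0..1}"
    have "z2 - z = of_real b" "Im (linepath z z2 t) = Im z"
      by (auto simp: z2_def b_def linepath_def complex_eq_iff algebra_simps)
    thus "0 \<le> Re (g (linepath z z2 t) * (z2 - z)) \<and> Re (g (linepath z z2 t) * (z2 - z)) \<le> 0"
      using bot[OF seg[OF inn(1,2) t]] by simp
  qed
  moreover have "- (l * b) \<le> Re (I z' z4) \<and> Re (I z' z4) \<le> - (l * b)"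
  proof (rule has_integral_unit_bounds[OF hi[OF inn(3,4)]])
    fix t :: real assume t: "t \<in> {0..1}"
    have "z4 - z' = of_real (- b)" "Im (linepath z' z4 t) = Im z'"
      by (auto simp: z4_def b_def linepath_def complex_eq_iff algebra_simps)
    thus "- (l * b) \<le> Re (g (linepath z' z4 t) * (z4 - z')) \<and> Re (g (linepath z' z4 t) * (z4 - z')) \<le> - (l * b)"
      using top[OF seg[OF inn(3,4) t]] by simp
  qed
  moreover have "- (pi * a) \<le> Re (I z2 z') \<and> Re (I z2 z') \<le> 0"
  proof (rule has_integral_unit_bounds[OF hi[OF inn(2,3)]])
    fix t :: real assume t: "t \<in> {0..1}"
    have "z' - z2 = \<i> * of_real a" by (auto simp: z2_def a_def complex_eq_iff)
    hence "Re (g (linepath z2 z' t) * (z' - z2)) = - (Im (g (linepath z2 z' t)) * a)" by simp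
    thus "- (pi * a) \<le> Re (g (linepath z2 z' t) * (z' - z2)) \<and> Re (g (linepath z2 z' t) * (z' - z2)) \<le> 0"
      using im[OF seg[OF inn(2,3) t]] ab by (simp add: mult_right_mono)
  qed
  moreover have "0 \<le> Re (I z4 z) \<and> Re (I z4 z) \<le> pi * a"
  proof (rule has_integral_unit_bounds[OF hi[OF inn(4,1)]])
    fix t :: real assume t: "t \<in> {0..1}"
    have "z - z4 = - (\<i> * of_real a)" by (auto simp: z4_def a_def complex_eq_iff)
    hence "Re (g (linepath z4 z t) * (z - z4)) = Im (g (linepath z4 z t)) * a" by simp
    thus "0 \<le> Re (g (linepath z4 z t) * (z - z4)) \<and> Re (g (linepath z4 z t) * (z - z4)) \<le> pi * a"
      using im[OF seg[OF inn(4,1) t]] ab by (simp add: mult_right_mono)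
  qed
  \<comment> \<open>The vertical sides contribute with opposite signs, each at most
    \<open>pi * a\<close> in modulus, so their sum obeys the same bound.\<close>
  ultimately have "\<bar>l * b\<bar> \<le> pi * a" using sum by linarith
  thus ?thesis using ab by (simp add: abs_mult a_def b_def)
qed

text \<open>The common normal form: after conjugation both boundary conditions ask for a map with
  the bottom on the imaginary axis and the top on a translate of it.\<close>

definition strip_map :: "rmat \<Rightarrow> complex \<Rightarrow> complex \<Rightarrow> (complex \<Rightarrow> complex) \<Rightarrow> bool" where
  "strip_map B z z' G \<longleftrightarrow> Re z < Re z' \<and> Im z < Im z' \<and> continuous_on (cbox z z') G \<and> G holomorphic_on box z z' \<and>
     G ` cbox z z' \<subseteq> upper_half \<and> (\<forall>\<zeta>\<in>cbox z z'. Im \<zeta> = Im z \<longrightarrow> G \<zeta> \<in> L_tr) \<and>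
     (\<forall>\<zeta>\<in>cbox z z'. Im \<zeta> = Im z' \<longrightarrow> G \<zeta> \<in> mob B ` L_tr)"

text \<open>For \<open>B = (p, q, r, s)\<close> this is the hyperbolic cosine of the distance from the geodesic
  \<open>L_tr\<close> to its image under \<open>B\<close>, if these are disjoint.\<close>

definition geod :: "rmat \<Rightarrow> real" where
  "geod = (\<lambda>(p, q, r, s). \<bar>p * s + q * r\<bar>)"

text \<open>A Moebius map sending the two geodesics to concentric half circles; its coefficient \<open>m\<close>
  is the endpoint of their common perpendicular.\<close>

lemma concentric_normal_form:
  assumes det: "mdet B = 1" and Q: "geod B > 1"
  obtains N K where "mdet N = 1" "K > 0" "K + 1 / K = 2 * geod B"
    "\<And>\<tau>. \<tau> \<in> upper_half \<Longrightarrow> norm (mob N \<tau>) = 1 \<longleftrightarrow> \<tau> \<in> L_tr"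
    "\<And>\<tau>. \<tau> \<in> upper_half \<Longrightarrow> norm (mob N \<tau>) = K \<longleftrightarrow> \<tau> \<in> mob B ` L_tr"
proof -
  obtain p q r s where B: "B = (p, q, r, s)" by (cases B)
  have d: "p * s - q * r = 1" using det by (simp add: B mdet_def)
  have Q1: "\<bar>p * s + q * r\<bar> > 1" using Q by (simp add: B geod_def)
  define y where "y = q * r"
  have ps: "p * s = 1 + y" using d by (simp add: y_def)
  have "\<bar>1 + 2 * y\<bar> > 1" using Q1 ps by (simp add: y_def)
  \<comment> \<open>Thus \<open>p * s\<close> and \<open>q * r\<close> have the same sign: no entry
    vanishes, so the geodesics have no common end point, and the quotient below is positive.\<close>
  hence "y > 0 \<or> y < - 1" by linarith
  hence "(1 + y) * y > 0" by (auto intro: mult_pos_pos mult_neg_neg)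
  hence pos: "(p * s) * (q * r) > 0" by (simp add: ps y_def)
  hence nz: "p \<noteq> 0" "q \<noteq> 0" "r \<noteq> 0" "s \<noteq> 0" by auto
  have "(p * q) * (r * s) > 0" using pos by (simp add: mult_ac)
  hence m2: "(p * q) / (r * s) > 0" by (simp add: zero_less_mult_iff zero_less_divide_iff)
  \<comment> \<open>The image geodesic ends at q / s and p / r. The half circle of radius
    \<open>m\<close> around 0 is perpendicular to it exactly if \<open>m\<close> squared is the
    product of these numbers.\<close>
  define m where "m = sqrt ((p * q) / (r * s))"
  have m: "m > 0" "m * m = (p * q) / (r * s)"
    using m2 real_sqrt_pow2[of "(p * q) / (r * s)"] unfolding m_def by (auto simp: power2_eq_square simp del: real_sqrt_mult_self)
  have mrs: "m * m * (r * s) = p * q" using m(2) nz by simp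
  define \<alpha> where "\<alpha> = p + m * r"
  define \<beta> where "\<beta> = q + m * s"
  have e1: "(q - m * s) * \<alpha> = - m"
  proof -
    have "(q - m * s) * \<alpha> = p * q - m * m * (r * s) - m * (p * s - q * r)" by (simp add: \<alpha>_def algebra_simps)
    thus ?thesis by (simp add: mrs d)
  qed
  have e2: "(p - m * r) * \<beta> = m"
  proof -
    have "(p - m * r) * \<beta> = p * q - m * m * (r * s) + m * (p * s - q * r)" by (simp add: \<beta>_def algebra_simps)
    thus ?thesis by (simp add: mrs d)
  qed
  have ab: "\<alpha> \<noteq> 0" "\<beta> \<noteq> 0" "q - m * s \<noteq> 0" using e1 e2 m(1) by auto
  \<comment> \<open>In these terms the normalised image of \<tau> is \<open>- \<kappa> * (\<alpha> *
    \<tau> - \<beta>) / (\<alpha> * \<tau> + \<beta>)\<close>, of modulus |\<kappa>| precisely for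
    Re \<tau> = 0.\<close>
  define \<kappa> where "\<kappa> = (q - m * s) / \<beta>"
  have k1: "q - m * s = \<kappa> * \<beta>" using ab by (simp add: \<kappa>_def)
  have k2: "p - m * r = - (\<kappa> * \<alpha>)"
  proof -
    have "(p - m * r) * \<beta> = - (\<kappa> * \<alpha>) * \<beta>" using e1 e2 by (simp add: k1 mult_ac)
    thus ?thesis using ab(2) by (simp only: mult_cancel_right) simp
  qed
  have k0: "\<kappa> \<noteq> 0" using ab by (simp add: \<kappa>_def)
  \<comment> \<open>Scaling that gives determinant 1 to the map sending \<open>m\<close> to 0 and
    \<open>- m\<close> to infinity.\<close>
  define c where "c = 1 / sqrt (2 * m)"
  have c: "c > 0" "c * c * (2 * m) = 1" using m(1) by (simp_all add: c_def)
  define N :: rmat where "N = (c, - (c * m), c, c * m)"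
  have detN: "mdet N = 1" using c(2) by (simp add: N_def mdet_def algebra_simps)
  have N: "mob N \<tau> = (\<tau> - of_real m) / (\<tau> + of_real m)" for \<tau>
  proof -
    have "mob N \<tau> = (of_real c * (\<tau> - of_real m)) / (of_real c * (\<tau> + of_real m))"
      by (simp add: N_def mob_def algebra_simps)
    thus ?thesis using c(1) by simp
  qed
  have eqdist: "norm (x - of_real t) = norm (x + of_real t) \<longleftrightarrow> Re x = 0" if "t \<noteq> 0" for x t
  proof -
    have "norm (x - of_real t) = norm (x + of_real t) \<longleftrightarrow> (norm (x - of_real t))\<^sup>2 = (norm (x + of_real t))\<^sup>2"
      by (simp add: power2_eq_iff_nonneg)
    also have "\<dots> \<longleftrightarrow> (Re x - t)\<^sup>2 = (Re x + t)\<^sup>2" by (simp add: cmod_power2)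
    also have "\<dots> \<longleftrightarrow> 4 * (Re x * t) = 0" unfolding power2_sum power2_diff by linarith
    also have "\<dots> \<longleftrightarrow> Re x = 0" using that by simp
    finally show ?thesis .
  qed
  have N1: "norm (mob N \<tau>) = 1 \<longleftrightarrow> \<tau> \<in> L_tr" if "\<tau> \<in> upper_half" for \<tau>
  proof -
    have "\<tau> + of_real m \<noteq> 0" using real_linear_form_nonzero[OF that, of 1 m] by simp
    hence "norm (mob N \<tau>) = 1 \<longleftrightarrow> norm (\<tau> - of_real m) = norm (\<tau> + of_real m)"
      unfolding N norm_divide by auto
    thus ?thesis using eqdist[of m \<tau>] m(1) that by (simp add: L_tr_def upper_half_def)
  qed
  have NB: "norm (mob N (mob B \<tau>)) = \<bar>\<kappa>\<bar> \<longleftrightarrow> \<tau> \<in> L_tr" if "\<tau> \<in> upper_half" for \<tau>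
  proof -
    define w where "w = of_real r * \<tau> + of_real s"
    have w: "w \<noteq> 0" unfolding w_def using nz by (intro real_linear_form_nonzero[OF that]) auto
    have v: "of_real \<alpha> * \<tau> + of_real \<beta> \<noteq> 0" using ab by (intro real_linear_form_nonzero[OF that]) auto
    have "mob N (mob B \<tau>) = ((of_real p * \<tau> + of_real q) / w - of_real m) / ((of_real p * \<tau> + of_real q) / w + of_real m)"
      unfolding N by (simp add: B mob_def w_def)
    also have "\<dots> = ((of_real p * \<tau> + of_real q - of_real m * w) / w) / ((of_real p * \<tau> + of_real q + of_real m * w) / w)"
      using w by (simp add: diff_divide_distrib add_divide_distrib)
    also have "\<dots> = (of_real p * \<tau> + of_real q - of_real m * w) / (of_real p * \<tau> + of_real q + of_real m * w)"
      using w by simp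
    also have "of_real p * \<tau> + of_real q - of_real m * w = of_real (p - m * r) * \<tau> + of_real (q - m * s)"
      by (simp add: w_def algebra_simps)
    also have "\<dots> = - of_real \<kappa> * (of_real \<alpha> * \<tau> - of_real \<beta>)" unfolding k1 k2 by (simp add: algebra_simps)
    also have "of_real p * \<tau> + of_real q + of_real m * w = of_real \<alpha> * \<tau> + of_real \<beta>"
      by (simp add: w_def \<alpha>_def \<beta>_def algebra_simps)
    finally have "norm (mob N (mob B \<tau>)) = \<bar>\<kappa>\<bar> * (norm (of_real \<alpha> * \<tau> - of_real \<beta>) / norm (of_real \<alpha> * \<tau> + of_real \<beta>))"
      by (simp add: norm_divide norm_mult)
    moreover have "k * (a / b) = k \<longleftrightarrow> a = b" if "k \<noteq> 0" "b \<noteq> 0" for k a b :: real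
      using that by (auto simp: field_simps)
    ultimately have "norm (mob N (mob B \<tau>)) = \<bar>\<kappa>\<bar> \<longleftrightarrow> norm (of_real \<alpha> * \<tau> - of_real \<beta>) = norm (of_real \<alpha> * \<tau> + of_real \<beta>)"
      using k0 v by simp
    also have "\<dots> \<longleftrightarrow> Re (of_real \<alpha> * \<tau>) = 0" by (rule eqdist[OF ab(2)])
    also have "\<dots> \<longleftrightarrow> \<tau> \<in> L_tr" using ab that by (simp add: L_tr_def upper_half_def)
    finally show ?thesis .
  qed
  have LH: "L_tr \<subseteq> upper_half" by (auto simp: L_tr_def upper_half_def)
  show ?thesis
  proof (rule that[of N "\<bar>\<kappa>\<bar>"])
    show "mdet N = 1" by (fact detN)
    show "\<bar>\<kappa>\<bar> > 0" using k0 by simp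
    show "norm (mob N \<tau>) = 1 \<longleftrightarrow> \<tau> \<in> L_tr" if "\<tau> \<in> upper_half" for \<tau> by (rule N1[OF that])
    show "norm (mob N \<tau>) = \<bar>\<kappa>\<bar> \<longleftrightarrow> \<tau> \<in> mob B ` L_tr" if \<tau>: "\<tau> \<in> upper_half" for \<tau>
    proof
      assume a: "norm (mob N \<tau>) = \<bar>\<kappa>\<bar>"
      have t: "mob (minv B) \<tau> \<in> upper_half" using det \<tau> by (simp add: mob_upper_half mdet_minv)
      have "mob (minv B) \<tau> \<in> L_tr" using NB[OF t] a by (simp add: mob_minv[OF det \<tau>])
      thus "\<tau> \<in> mob B ` L_tr" by (metis imageI mob_minv(2)[OF det \<tau>])
    next
      assume "\<tau> \<in> mob B ` L_tr"
      thus "norm (mob N \<tau>) = \<bar>\<kappa>\<bar>" using NB LH by blast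
    qed
    show "\<bar>\<kappa>\<bar> + 1 / \<bar>\<kappa>\<bar> = 2 * geod B"
    proof -
      define x where "x = q - m * s"
      have "\<bar>\<kappa>\<bar> + 1 / \<bar>\<kappa>\<bar> = \<bar>x\<bar> / \<bar>\<beta>\<bar> + \<bar>\<beta>\<bar> / \<bar>x\<bar>" by (simp add: \<kappa>_def x_def)
      also have "\<dots> = (\<bar>x\<bar> * \<bar>x\<bar> + \<bar>\<beta>\<bar> * \<bar>\<beta>\<bar>) / (\<bar>x\<bar> * \<bar>\<beta>\<bar>)" using ab by (simp add: x_def field_simps)
      also have "\<bar>x\<bar> * \<bar>x\<bar> + \<bar>\<beta>\<bar> * \<bar>\<beta>\<bar> = 2 * (q * q + m * m * (s * s))"
        by (simp add: x_def \<beta>_def algebra_simps)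
      also have "m * m * (s * s) = p * q * s / r" using mrs nz by (simp add: field_simps)
      also have "q * q + p * q * s / r = q / r * (p * s + q * r)" using nz by (simp add: field_simps)
      also have "\<bar>x\<bar> * \<bar>\<beta>\<bar> = \<bar>q / r\<bar>"
      proof -
        have "x * \<beta> = q * q - m * m * (s * s)" by (simp add: x_def \<beta>_def algebra_simps)
        also have "m * m * (s * s) = p * q * s / r" using mrs nz by (simp add: field_simps)
        also have "q * q - p * q * s / r = - (q / r) * (p * s - q * r)" using nz by (simp add: field_simps)
        also have "\<dots> = - (q / r)" by (simp add: d)
        finally have "\<bar>x * \<beta>\<bar> = \<bar>q / r\<bar>" by simp
        thus ?thesis by (simp add: abs_mult)
      qed
      also have "2 * (q / r * (p * s + q * r)) / \<bar>q / r\<bar> = 2 * geod B"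
      proof -
        have "q / r * (p * s + q * r) \<ge> 0"
        proof -
          have "q / r * (p * s + q * r) = q * q + m * m * (s * s)" using mrs nz by (simp add: field_simps)
          thus ?thesis by simp
        qed
        hence "q / r * (p * s + q * r) = \<bar>q / r\<bar> * geod B"
          by (simp only: B geod_def prod.case abs_mult[symmetric] abs_of_nonneg)
        thus ?thesis using nz by simp
      qed
      finally show ?thesis .
    qed
  qed
qed

text \<open>The larger of \<open>K\<close> and \<open>1 / K\<close> lies between \<open>Q\<close>
  and \<open>2 * Q\<close>.\<close>

lemma norm_form_bounds:
  fixes K Q :: real
  assumes "K > 0" "K + 1 / K = 2 * Q" "Q > 1"
  shows "ln Q \<le> \<bar>ln K\<bar>" "\<bar>ln K\<bar> \<le> ln (2 * Q)"
proof -
  have *: "ln Q \<le> \<bar>ln K\<bar> \<and> \<bar>ln K\<bar> \<le> ln (2 * Q)" if K: "K \<ge> 1" "K + 1 / K = 2 * Q" for K :: real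
  proof -
    have "1 / K \<le> 1" using K(1) by (simp add: divide_le_eq_1)
    hence "1 / K \<le> K" using K(1) by linarith
    hence "Q \<le> K" using K by linarith
    moreover have "K \<le> 2 * Q" using K by (simp flip: K(2))
    ultimately show ?thesis using K(1) assms(3) by simp
  qed
  have "ln Q \<le> \<bar>ln K\<bar> \<and> \<bar>ln K\<bar> \<le> ln (2 * Q)"
  proof (cases "K \<ge> 1")
    case True thus ?thesis using * assms by blast
  next
    case False
    have "ln Q \<le> \<bar>ln (1 / K)\<bar> \<and> \<bar>ln (1 / K)\<bar> \<le> ln (2 * Q)"
      using False assms by (intro *) (auto simp: field_simps)
    thus ?thesis using assms(1) by (simp add: ln_div)
  qed
  thus "ln Q \<le> \<bar>ln K\<bar>" "\<bar>ln K\<bar> \<le> ln (2 * Q)" by auto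
qed

text \<open>After the normalisation a logarithm maps the upper half-plane into a horizontal strip of
  height pi and the two half circles into the vertical lines at 0 and \<open>ln K\<close>.\<close>

lemma strip_map_lower:
  assumes det: "mdet B = 1" and Q: "geod B > 1" and G: "strip_map B z z' G"
  shows "ln (geod B) / pi \<le> rect_ratio z z'"
proof -
  note G = G[unfolded strip_map_def]
  obtain N K where N: "mdet N = 1" "K > 0" "K + 1 / K = 2 * geod B"
    "\<And>\<tau>. \<tau> \<in> upper_half \<Longrightarrow> norm (mob N \<tau>) = 1 \<longleftrightarrow> \<tau> \<in> L_tr"
    "\<And>\<tau>. \<tau> \<in> upper_half \<Longrightarrow> norm (mob N \<tau>) = K \<longleftrightarrow> \<tau> \<in> mob B ` L_tr"
    using concentric_normal_form[OF det Q] by blast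
  define f where "f = (\<lambda>\<tau>. Ln (mob N \<tau>))"
  have up: "mob N \<tau> \<in> upper_half" if "\<tau> \<in> upper_half" for \<tau> using mob_upper_half[OF N(1) that] .
  have holo: "f holomorphic_on upper_half"
  proof -
    have "mob N \<tau> \<notin> \<real>\<^sub>\<le>\<^sub>0" if "\<tau> \<in> upper_half" for \<tau>
      using up[OF that] by (auto simp: upper_half_def complex_nonpos_Reals_iff)
    thus ?thesis unfolding f_def by (intro holomorphic_on_Ln' holomorphic_mob[OF N(1)]) auto
  qed
  have ImL: "0 \<le> Im (f \<tau>) \<and> Im (f \<tau>) \<le> pi" and ReL: "Re (f \<tau>) = ln (norm (mob N \<tau>))" if "\<tau> \<in> upper_half" for \<tau>
  proof -
    have nz: "mob N \<tau> \<noteq> 0" "Im (mob N \<tau>) > 0" using up[OF that] by (auto simp: upper_half_def)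
    show "Re (f \<tau>) = ln (norm (mob N \<tau>))" using nz by (simp add: f_def)
    show "0 \<le> Im (f \<tau>) \<and> Im (f \<tau>) \<le> pi" using nz Im_Ln_pos_lt_imp[of "mob N \<tau>"] by (simp add: f_def)
  qed
  have inn: "G \<zeta> \<in> upper_half" if "\<zeta> \<in> cbox z z'" for \<zeta> using G that by blast
  have "\<bar>ln K\<bar> * (Re z' - Re z) \<le> pi * (Im z' - Im z)"
  proof (rule rectangle_estimate[of z z' "\<lambda>\<zeta>. f (G \<zeta>)"])
    show "Re z < Re z'" "Im z < Im z'" using G by auto
    show "continuous_on (cbox z z') (\<lambda>\<zeta>. f (G \<zeta>))"
      by (rule continuous_on_compose2[OF holomorphic_on_imp_continuous_on[OF holo]]) (use G in auto)
    have "(f \<circ> G) holomorphic_on box z z'"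
      by (rule holomorphic_on_compose_gen[OF _ holo]) (use G box_subset_cbox[of z z'] in auto)
    thus "(\<lambda>\<zeta>. f (G \<zeta>)) holomorphic_on box z z'" by (simp add: o_def)
    show "0 \<le> Im (f (G \<zeta>)) \<and> Im (f (G \<zeta>)) \<le> pi" if "\<zeta> \<in> cbox z z'" for \<zeta> by (rule ImL[OF inn[OF that]])
    show "Re (f (G \<zeta>)) = 0" if "\<zeta> \<in> cbox z z'" "Im \<zeta> = Im z" for \<zeta>
      using ReL[OF inn[OF that(1)]] N(4)[OF inn[OF that(1)]] G that by simp
    show "Re (f (G \<zeta>)) = ln K" if "\<zeta> \<in> cbox z z'" "Im \<zeta> = Im z'" for \<zeta>
      using ReL[OF inn[OF that(1)]] N(5)[OF inn[OF that(1)]] G that by simp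
  qed
  moreover have "ln (geod B) \<le> \<bar>ln K\<bar>" by (rule norm_form_bounds(1)[OF N(2,3) Q])
  ultimately have "ln (geod B) * (Re z' - Re z) \<le> pi * (Im z' - Im z)"
    using G by (meson diff_ge_0_iff_ge less_imp_le mult_right_mono order_trans)
  thus ?thesis using G by (simp add: rect_ratio_def field_simps)
qed

text \<open>The exponential map is used on arguments between pi / 4 and 3 pi / 4 only, so that the
  closed rectangle stays in the upper half-plane. Halving the width pi explains the factor
  2.\<close>

lemma strip_map_upper:
  assumes det: "mdet B = 1" and Q: "geod B > 1"
  obtains z z' G where "strip_map B z z' G" "rect_ratio z z' \<le> 2 * ln (2 * geod B) / pi"
proof -
  obtain N K where N: "mdet N = 1" "K > 0" "K + 1 / K = 2 * geod B"
    "\<And>\<tau>. \<tau> \<in> upper_half \<Longrightarrow> norm (mob N \<tau>) = 1 \<longleftrightarrow> \<tau> \<in> L_tr"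
    "\<And>\<tau>. \<tau> \<in> upper_half \<Longrightarrow> norm (mob N \<tau>) = K \<longleftrightarrow> \<tau> \<in> mob B ` L_tr"
    using concentric_normal_form[OF det Q] by blast
  have K1: "ln K \<noteq> 0" using norm_form_bounds(1)[OF N(2,3) Q] Q by auto
  \<comment> \<open>The sign makes the modulus move from 1 at the bottom to \<open>K\<close> at the
    top, whether \<open>K\<close> is larger or smaller than 1.\<close>
  define \<sigma> :: real where "\<sigma> = sgn (ln K)"
  have \<sigma>: "\<sigma> = 1 \<or> \<sigma> = - 1" "\<sigma> * \<bar>ln K\<bar> = ln K" "\<sigma> * \<sigma> = 1" using K1 by (auto simp: \<sigma>_def sgn_if)
  define z where "z = Complex (- (\<sigma> * pi / 2) - pi / 4) 0"
  define z' where "z' = Complex (- (\<sigma> * pi / 2) + pi / 4) \<bar>ln K\<bar>"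
  define E where "E = (\<lambda>\<zeta>. exp (- \<i> * of_real \<sigma> * \<zeta>))"
  define G where "G = (\<lambda>\<zeta>. mob (minv N) (E \<zeta>))"
  have detN': "mdet (minv N) = 1" using N(1) by (simp add: mdet_minv)
  have nE: "norm (E \<zeta>) = exp (\<sigma> * Im \<zeta>)" for \<zeta> by (simp add: E_def)
  have EH: "E \<zeta> \<in> upper_half" if "\<zeta> \<in> cbox z z'" for \<zeta>
  proof -
    have "- (\<sigma> * pi / 2) - pi / 4 \<le> Re \<zeta>" "Re \<zeta> \<le> - (\<sigma> * pi / 2) + pi / 4"
      using that by (auto simp: in_cbox_complex_iff z_def z'_def)
    hence "0 < - \<sigma> * Re \<zeta> \<and> - \<sigma> * Re \<zeta> < pi"
      using \<sigma>(1) pi_gt_zero by (elim disjE; simp; linarith)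
    hence "0 < - \<sigma> * Re \<zeta>" "- \<sigma> * Re \<zeta> < pi" by auto
    hence "sin (- \<sigma> * Re \<zeta>) > 0" by (rule sin_gt_zero)
    thus ?thesis by (simp add: E_def upper_half_def Im_exp mult_pos_neg)
  qed
  have NG: "mob N (G \<zeta>) = E \<zeta>" "G \<zeta> \<in> upper_half" if "\<zeta> \<in> cbox z z'" for \<zeta>
    using EH[OF that] N(1) detN' by (auto simp: G_def mob_minv mob_upper_half)
  have "strip_map B z z' G"
    unfolding strip_map_def
  proof (intro conjI ballI impI)
    show "Re z < Re z'" "Im z < Im z'" using K1 by (auto simp: z_def z'_def)
    have "(mob (minv N) \<circ> E) holomorphic_on cbox z z'"
      by (rule holomorphic_on_compose_gen[OF _ holomorphic_mob[OF detN']])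
         (use EH in \<open>auto simp: E_def intro!: holomorphic_intros\<close>)
    hence h: "G holomorphic_on cbox z z'" by (simp add: G_def o_def)
    show "continuous_on (cbox z z') G" using h by (rule holomorphic_on_imp_continuous_on)
    show "G holomorphic_on box z z'" using h box_subset_cbox by (rule holomorphic_on_subset)
    show "G ` cbox z z' \<subseteq> upper_half" using NG by blast
    show "G \<zeta> \<in> L_tr" if "\<zeta> \<in> cbox z z'" "Im \<zeta> = Im z" for \<zeta>
      using N(4)[OF NG(2)[OF that(1)]] NG(1)[OF that(1)] that(2) by (simp add: nE z_def)
    show "G \<zeta> \<in> mob B ` L_tr" if "\<zeta> \<in> cbox z z'" "Im \<zeta> = Im z'" for \<zeta>
      using N(5)[OF NG(2)[OF that(1)]] NG(1)[OF that(1)] that(2) N(2) \<sigma>(2) by (simp add: nE z'_def)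
  qed
  moreover have "rect_ratio z z' \<le> 2 * ln (2 * geod B) / pi"
  proof -
    have "rect_ratio z z' = 2 * \<bar>ln K\<bar> / pi" by (simp add: rect_ratio_def z_def z'_def)
    thus ?thesis using norm_form_bounds(2)[OF N(2,3) Q] by (simp add: divide_right_mono)
  qed
  ultimately show ?thesis using that by blast
qed

text \<open>The image geodesic has the ends q / s and p / r; the hypothesis says that one of them is
  infinity, so it is the vertical half-line over the other.\<close>

lemma vertical_image:
  assumes det: "mdet (p, q, r, s) = 1" and rs: "r * s = 0"
  obtains d where "\<And>\<tau>. \<tau> \<in> upper_half \<Longrightarrow> Re \<tau> = d \<Longrightarrow> \<tau> \<in> mob (p, q, r, s) ` L_tr"
proof -
  have d: "p * s - q * r = 1" using det by (simp add: mdet_def)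
  define \<delta> where "\<delta> = (if r = 0 then q / s else p / r)"
  have "\<tau> \<in> mob (p, q, r, s) ` L_tr" if \<tau>: "\<tau> \<in> upper_half" "Re \<tau> = \<delta>" for \<tau>
  proof -
    have H: "mob (minv (p, q, r, s)) \<tau> \<in> upper_half" using det \<tau> by (intro mob_upper_half) (simp_all add: mdet_minv)
    have "Re (mob (minv (p, q, r, s)) \<tau>) = 0"
    proof (cases "r = 0")
      case True
      hence "p \<noteq> 0" "s \<noteq> 0" using d by auto
      thus ?thesis using True \<tau>(2) by (simp add: mob_def minv_def \<delta>_def Re_divide_of_real)
    next
      case False
      hence "s = 0" using rs by simp
      have "Re (of_real (- r) * \<tau> + of_real p) = 0" using False \<tau>(2) by (simp add: \<delta>_def)
      thus ?thesis using \<open>s = 0\<close> by (simp add: mob_def minv_def Re_divide)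
    qed
    with H have "mob (minv (p, q, r, s)) \<tau> \<in> L_tr" by (simp add: L_tr_def upper_half_def)
    thus ?thesis by (metis imageI mob_minv(2)[OF det \<tau>(1)])
  qed
  thus ?thesis using that by blast
qed

text \<open>Two vertical half-lines bound an unbounded half-strip, in which a rectangle of height 1
  and any width \<open>n\<close> fits after a quarter turn and a scaling. If they coincide, a
  constant map does.\<close>

lemma strip_map_parallel_vertical:
  assumes det: "mdet (p, q, r, s) = 1" and rs: "r * s = 0" and n: "n > (0 :: real)"
  obtains z z' G where "strip_map (p, q, r, s) z z' G" "rect_ratio z z' = 1 / n"
proof -
  obtain d where d: "\<And>\<tau>. \<tau> \<in> upper_half \<Longrightarrow> Re \<tau> = d \<Longrightarrow> \<tau> \<in> mob (p, q, r, s) ` L_tr"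
    using vertical_image[OF det rs] by blast
  \<comment> \<open>The rectangle lies on the side where \<open>- d * Re \<zeta>\<close>, the
    imaginary part of the map, is positive.\<close>
  define x0 where "x0 = (if d > 0 then - (n + 1) else 1)"
  define z where "z = Complex x0 0"
  define z' where "z' = Complex (x0 + n) 1"
  define G where "G = (\<lambda>\<zeta>. if d = 0 then \<i> else - \<i> * of_real d * \<zeta>)"
  have h: "G holomorphic_on S" for S unfolding G_def by (cases "d = 0") (auto intro!: holomorphic_intros)
  have GH: "G \<zeta> \<in> upper_half" if "\<zeta> \<in> cbox z z'" for \<zeta>
  proof -
    have "x0 \<le> Re \<zeta>" "Re \<zeta> \<le> x0 + n" using that by (auto simp: in_cbox_complex_iff z_def z'_def)
    hence "d \<noteq> 0 \<Longrightarrow> d * Re \<zeta> < 0" by (auto simp: x0_def mult_less_0_iff split: if_splits)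
    thus ?thesis by (auto simp: G_def upper_half_def)
  qed
  have ReG: "Re (G \<zeta>) = d * Im \<zeta>" for \<zeta> by (simp add: G_def)
  have "strip_map (p, q, r, s) z z' G"
    unfolding strip_map_def
  proof (intro conjI ballI impI)
    show "Re z < Re z'" "Im z < Im z'" using n by (auto simp: z_def z'_def)
    show "continuous_on (cbox z z') G" using h by (rule holomorphic_on_imp_continuous_on)
    show "G holomorphic_on box z z'" by (rule h)
    show "G ` cbox z z' \<subseteq> upper_half" using GH by blast
    show "G \<zeta> \<in> L_tr" if "\<zeta> \<in> cbox z z'" "Im \<zeta> = Im z" for \<zeta>
      using GH[OF that(1)] ReG[of \<zeta>] that(2) by (simp add: z_def L_tr_def upper_half_def)
    show "G \<zeta> \<in> mob (p, q, r, s) ` L_tr" if "\<zeta> \<in> cbox z z'" "Im \<zeta> = Im z'" for \<zeta>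
      using d[OF GH[OF that(1)]] ReG[of \<zeta>] that(2) by (simp add: z'_def)
  qed
  moreover have "rect_ratio z z' = 1 / n" by (simp add: rect_ratio_def z_def z'_def)
  ultimately show ?thesis using that by blast
qed

lemma strip_map_compose:
  assumes G: "strip_map (mmul J B) z z' G" and J: "mdet J = 1" "mob (minv J) ` L_tr \<subseteq> L_tr" and B: "mdet B = 1"
  shows "strip_map B z z' (\<lambda>\<zeta>. mob (minv J) (G \<zeta>))"
proof -
  note G = G[unfolded strip_map_def]
  have J': "mdet (minv J) = 1" using J by (simp add: mdet_minv)
  have LH: "L_tr \<subseteq> upper_half" by (auto simp: L_tr_def upper_half_def)
  have boxsub: "box z z' \<subseteq> cbox z z'" by (rule box_subset_cbox)
  show ?thesis
    unfolding strip_map_def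
  proof (intro conjI ballI impI)
    show "Re z < Re z'" "Im z < Im z'" using G by auto
    show "continuous_on (cbox z z') (\<lambda>\<zeta>. mob (minv J) (G \<zeta>))"
      by (rule continuous_on_compose2[OF continuous_mob[OF J']]) (use G in auto)
    have "(mob (minv J) \<circ> G) holomorphic_on box z z'"
      by (rule holomorphic_on_compose_gen[OF _ holomorphic_mob[OF J']]) (use G boxsub in auto)
    thus "(\<lambda>\<zeta>. mob (minv J) (G \<zeta>)) holomorphic_on box z z'" by (simp add: o_def)
    show "(\<lambda>\<zeta>. mob (minv J) (G \<zeta>)) ` cbox z z' \<subseteq> upper_half" using G mob_upper_half[OF J'] by blast
    show "mob (minv J) (G \<zeta>) \<in> L_tr" if "\<zeta> \<in> cbox z z'" "Im \<zeta> = Im z" for \<zeta>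
      using G that J(2) by blast
    show "mob (minv J) (G \<zeta>) \<in> mob B ` L_tr" if "\<zeta> \<in> cbox z z'" "Im \<zeta> = Im z'" for \<zeta>
    proof -
      have "G \<zeta> \<in> mob (mmul J B) ` L_tr" using G that by blast
      then obtain l where l: "l \<in> L_tr" "G \<zeta> = mob (mmul J B) l" by blast
      hence "l \<in> upper_half" using LH by blast
      hence "mob (minv J) (G \<zeta>) = mob B l"
        using l J B by (simp add: mob_mmul mob_minv mob_upper_half)
      thus ?thesis using l by blast
    qed
  qed
qed

text \<open>A common end point of the geodesics is infinity or 0. The second case is turned into the
  first by -1 / \<tau>, which preserves the imaginary half axis.\<close>

lemma strip_map_parallel:
  assumes det: "mdet B = 1" and Q: "geod B = 1" and n: "n > (0 :: real)"
  obtains z z' G where "strip_map B z z' G" "rect_ratio z z' = 1 / n"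
proof -
  obtain p q r s where B: "B = (p, q, r, s)" by (cases B)
  have d: "p * s - q * r = 1" using det by (simp add: B mdet_def)
  have "\<bar>p * s + q * r\<bar> = 1" using Q by (simp add: B geod_def)
  hence "q * r = 0 \<or> p * s = 0" using d by linarith
  then consider "r * s = 0" | "p * q = 0" by auto
  thus ?thesis
  proof cases
    case 1
    thus ?thesis using strip_map_parallel_vertical[OF det[unfolded B] 1 n] that B by metis
  next
    case 2
    define J :: rmat where "J = (0, - 1, 1, 0)"
    have J: "mdet J = 1" by (simp add: J_def mdet_def)
    have JL: "mob (minv J) ` L_tr \<subseteq> L_tr"
    proof
      fix x assume "x \<in> mob (minv J) ` L_tr"
      then obtain \<tau> where \<tau>: "\<tau> \<in> L_tr" "x = - 1 / \<tau>" by (auto simp: J_def minv_def mob_def)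
      have "Im x > 0" using Im_S[of \<tau>] \<tau> by (simp add: L_tr_def del: minus_divide_left)
      moreover have "Re x = 0" using \<tau> by (simp add: L_tr_def Re_divide)
      ultimately show "x \<in> L_tr" by (simp add: L_tr_def)
    qed
    have JB: "mmul J B = (- r, - s, p, q)" by (simp add: J_def B mmul_def)
    have "mdet (- r, - s, p, q) = 1" using d by (simp add: mdet_def algebra_simps)
    then obtain z z' G where "strip_map (- r, - s, p, q) z z' G" "rect_ratio z z' = 1 / n"
      using strip_map_parallel_vertical[OF _ 2 n] by metis
    thus ?thesis using strip_map_compose[of J B z z' G] J JL det that unfolding JB by blast
  qed
qed

definition conj_mat :: "rmat \<Rightarrow> rmat \<Rightarrow> rmat" where
  "conj_mat C W = mmul (minv C) (mmul W C)"

lemma extremal_length_geod: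
  fixes w :: word
  assumes C: "mdet C = 1" and bl: "boundary_lift A (mob C ` L_tr) g" and iL: "\<i> \<in> mob C ` L_tr"
  defines "Q \<equiv> geod (conj_mat C (word_mat w))" and "X \<equiv> extremal_length A (bv_class A (word_path w))"
  shows "Q = 1 \<Longrightarrow> X = 0"
    and "Q > 1 \<Longrightarrow> ereal (ln Q / pi) \<le> X" and "Q > 1 \<Longrightarrow> X \<le> ereal (2 * ln (2 * Q) / pi)"
proof -
  define W where "W = word_mat w"
  define B where "B = conj_mat C W"
  have W: "mdet W = 1" using deck_word_mat by (simp add: W_def deck_def)
  have C': "mdet (minv C) = 1" using C by (simp add: mdet_minv)
  have WC: "mdet (mmul W C) = 1" using W C by (simp add: mdet_mmul)
  have B: "mdet B = 1" using W C C' by (simp add: B_def conj_mat_def mdet_mmul)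
  have LH: "L_tr \<subseteq> upper_half" by (auto simp: L_tr_def upper_half_def)
  have conjB: "mob B l = mob (minv C) (mob W (mob C l))" "mob C (mob B l) = mob W (mob C l)" if "l \<in> upper_half" for l
  proof -
    show e: "mob B l = mob (minv C) (mob W (mob C l))"
      using that C WC by (simp add: B_def conj_mat_def mob_mmul)
    have "mob W (mob C l) \<in> upper_half" using that W C by (simp add: mob_upper_half)
    thus "mob C (mob B l) = mob W (mob C l)" unfolding e by (rule mob_minv(2)[OF C])
  qed
  have up: "X \<le> ereal (rect_ratio z z')" if "strip_map B z z' G" for z z' G
    unfolding X_def
  proof (rule represents_lift[OF bl iL])
    note G = that[unfolded strip_map_def]
    have boxsub: "box z z' \<subseteq> cbox z z'" by (rule box_subset_cbox)
    show "Re z < Re z'" "Im z < Im z'" using G by auto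
    show "continuous_on (cbox z z') (\<lambda>\<zeta>. mob C (G \<zeta>))"
      by (rule continuous_on_compose2[OF continuous_mob[OF C]]) (use G in auto)
    have "(mob C \<circ> G) holomorphic_on box z z'"
      by (rule holomorphic_on_compose_gen[OF _ holomorphic_mob[OF C]]) (use G boxsub in auto)
    thus "(\<lambda>\<zeta>. mob C (G \<zeta>)) holomorphic_on box z z'" by (simp add: o_def)
    show "(\<lambda>\<zeta>. mob C (G \<zeta>)) ` cbox z z' \<subseteq> upper_half" using G mob_upper_half[OF C] by blast
    show "mob C (G \<zeta>) \<in> mob C ` L_tr" if "\<zeta> \<in> cbox z z'" "Im \<zeta> = Im z" for \<zeta> using G that by blast
    show "mob C (G \<zeta>) \<in> mob (word_mat w) ` mob C ` L_tr" if z: "\<zeta> \<in> cbox z z'" "Im \<zeta> = Im z'" for \<zeta>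
    proof -
      have "G \<zeta> \<in> mob B ` L_tr" using G z by blast
      then obtain l where l: "l \<in> L_tr" "G \<zeta> = mob B l" by blast
      hence "mob C (G \<zeta>) = mob W (mob C l)" using conjB(2) LH by auto
      thus ?thesis using l by (auto simp: W_def)
    qed
  qed
  have low: "\<exists>G. strip_map B z z' G"
    if zz: "Re z < Re z'" "Im z < Im z'" and f: "f holomorphic_on box z z'" "represents A (bv_class A (word_path w)) z z' f" for z z' f
  proof -
    obtain G where G: "continuous_on (cbox z z') G" "G holomorphic_on box z z'" "G ` cbox z z' \<subseteq> upper_half"
      "\<And>\<zeta>. \<zeta> \<in> cbox z z' \<Longrightarrow> Im \<zeta> = Im z \<Longrightarrow> G \<zeta> \<in> mob C ` L_tr"
      "\<And>\<zeta>. \<zeta> \<in> cbox z z' \<Longrightarrow> Im \<zeta> = Im z' \<Longrightarrow> G \<zeta> \<in> mob (word_mat w) ` mob C ` L_tr"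
      using rectangle_lift[OF bl iL zz f] by blast
    have boxsub: "box z z' \<subseteq> cbox z z'" by (rule box_subset_cbox)
    have "strip_map B z z' (\<lambda>\<zeta>. mob (minv C) (G \<zeta>))"
      unfolding strip_map_def
    proof (intro conjI ballI impI zz)
      show "continuous_on (cbox z z') (\<lambda>\<zeta>. mob (minv C) (G \<zeta>))"
        by (rule continuous_on_compose2[OF continuous_mob[OF C'] G(1,3)])
      have "(mob (minv C) \<circ> G) holomorphic_on box z z'"
        by (rule holomorphic_on_compose_gen[OF G(2) holomorphic_mob[OF C']]) (use G(3) boxsub in blast)
      thus "(\<lambda>\<zeta>. mob (minv C) (G \<zeta>)) holomorphic_on box z z'" by (simp add: o_def)
      show "(\<lambda>\<zeta>. mob (minv C) (G \<zeta>)) ` cbox z z' \<subseteq> upper_half" using G(3) mob_upper_half[OF C'] by blast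
      show "mob (minv C) (G \<zeta>) \<in> L_tr" if "\<zeta> \<in> cbox z z'" "Im \<zeta> = Im z" for \<zeta>
        using G(4)[OF that] mob_minv(1)[OF C] LH by auto
      show "mob (minv C) (G \<zeta>) \<in> mob B ` L_tr" if "\<zeta> \<in> cbox z z'" "Im \<zeta> = Im z'" for \<zeta>
        using G(5)[OF that] conjB(1) LH by (force simp: W_def)
    qed
    thus ?thesis by blast
  qed
  have QB: "Q = geod B" by (simp add: Q_def B_def W_def)
  have nonneg: "0 \<le> X"
    unfolding X_def extremal_length_def by (rule Inf_greatest) (auto simp: rect_ratio_def)
  show "X = 0" if "Q = 1"
  proof (rule antisym[OF _ nonneg], rule ereal_le_epsilon2)
    fix e :: real assume e: "e > 0"
    have "geod B = 1" "1 / e > 0" using that e QB by simp_all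
    from strip_map_parallel[OF B this] obtain z z' G where "strip_map B z z' G" "rect_ratio z z' = 1 / (1 / e)"
      by blast
    thus "X \<le> 0 + ereal e" using up[of z z' G] by simp
  qed
  show "ereal (ln Q / pi) \<le> X" if "Q > 1"
    unfolding X_def extremal_length_def
  proof (rule Inf_greatest, clarify)
    fix z z' f assume "Re z < Re z'" "Im z < Im z'" "f holomorphic_on box z z'" "represents A (bv_class A (word_path w)) z z' f"
    then obtain G where "strip_map B z z' G" using low by blast
    thus "ereal (ln Q / pi) \<le> ereal (rect_ratio z z')" using strip_map_lower[OF B] that QB by simp
  qed
  show "X \<le> ereal (2 * ln (2 * Q) / pi)" if "Q > 1"
  proof -
    have "geod B > 1" using that QB by simp
    from strip_map_upper[OF B this] obtain z z' G
      where "strip_map B z z' G" "rect_ratio z z' \<le> 2 * ln (2 * geod B) / pi" by blast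
    thus ?thesis using up[of z z' G] QB by (meson ereal_less_eq(3) order_trans)
  qed
qed

subsection \<open>Syllables as blocks of the sequence of powers\<close>

text \<open>Half-open intervals of positions. Runs and singletons become one kind, the maximal
  intervals of constant power +1 or -1, a singleton being one of length 1.\<close>

definition seg :: "int list \<Rightarrow> nat \<Rightarrow> nat \<Rightarrow> bool" where
  "seg ns i j \<longleftrightarrow> i < j \<and> j \<le> length ns \<and>
     ((j = Suc i \<and> \<bar>ns ! i\<bar> \<ge> 2) \<or>
      (\<exists>e\<in>{1, -1}. (\<forall>k\<in>{i..<j}. ns ! k = e) \<and> (i > 0 \<longrightarrow> ns ! (i - 1) \<noteq> e) \<and> (j < length ns \<longrightarrow> ns ! j \<noteq> e)))"

lemma seg_runI:
  assumes "i < j" "j \<le> length ns" "e \<in> {1, -1}" "\<forall>k\<in>{i..<j}. ns ! k = e"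
    "i > 0 \<longrightarrow> ns ! (i - 1) \<noteq> e" "j < length ns \<longrightarrow> ns ! j \<noteq> e"
  shows "seg ns i j"
proof -
  have "\<exists>e\<in>{1, -1}. (\<forall>k\<in>{i..<j}. ns ! k = e) \<and> (i > 0 \<longrightarrow> ns ! (i - 1) \<noteq> e) \<and> (j < length ns \<longrightarrow> ns ! j \<noteq> e)"
    by (rule bexI[OF _ assms(3)]) (intro conjI assms(4-6))
  thus ?thesis using assms(1,2) by (simp only: seg_def) simp
qed

lemma segE:
  assumes "seg ns i j"
  obtains "j = Suc i" "\<bar>ns ! i\<bar> \<ge> 2"
  | e where "e \<in> {1, -1}" "\<forall>k\<in>{i..<j}. ns ! k = e" "i > 0 \<longrightarrow> ns ! (i - 1) \<noteq> e" "j < length ns \<longrightarrow> ns ! j \<noteq> e"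
proof -
  from assms have "(j = Suc i \<and> \<bar>ns ! i\<bar> \<ge> 2) \<or> (\<exists>e\<in>{1, -1}. (\<forall>k\<in>{i..<j}. ns ! k = e) \<and>
      (i > 0 \<longrightarrow> ns ! (i - 1) \<noteq> e) \<and> (j < length ns \<longrightarrow> ns ! j \<noteq> e))"
    by (simp only: seg_def)
  thus ?thesis by (elim disjE bexE conjE) (rule that; assumption)+
qed

lemma syllables_seg: "syllables w = {{i..<j} | i j. seg (map snd w) i j}"
proof
  show "syllables w \<subseteq> {{i..<j} | i j. seg (map snd w) i j}"
  proof
    fix S assume "S \<in> syllables w"
    then consider "S \<in> big_syllables w" | "S \<in> run_syllables w" | "S \<in> singleton_syllables w"
      by (auto simp: syllables_def)
    thus "S \<in> {{i..<j} | i j. seg (map snd w) i j}"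
    proof cases
      case 1
      then obtain k where k: "S = {k}" "k < length w" "\<bar>power_at w k\<bar> \<ge> 2" by (auto simp: big_syllables_def)
      hence "S = {k..<Suc k}" "seg (map snd w) k (Suc k)" by (auto simp: seg_def)
      thus ?thesis by blast
    next
      case 2
      then obtain i j e where ij: "S = {i..j}" "i < j" "j < length w" "e \<in> {1, -1}" "\<forall>k\<in>{i..j}. power_at w k = e"
        "i > 0 \<longrightarrow> power_at w (i - 1) \<noteq> e" "Suc j < length w \<longrightarrow> power_at w (Suc j) \<noteq> e"
        unfolding run_syllables_def by blast
      hence "seg (map snd w) i (Suc j)" unfolding seg_def by (intro conjI disjI2 bexI[of _ e]) auto
      moreover have "S = {i..<Suc j}" using ij by auto
      ultimately show ?thesis by blast
    next
      case 3
      then obtain k where k: "S = {k}" "k < length w" "power_at w k \<in> {1, -1}"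
         "k > 0 \<longrightarrow> power_at w (k - 1) \<noteq> power_at w k" "Suc k < length w \<longrightarrow> power_at w (Suc k) \<noteq> power_at w k"
        unfolding singleton_syllables_def by blast
      hence "seg (map snd w) k (Suc k)" unfolding seg_def by (intro conjI disjI2 bexI[of _ "power_at w k"]) auto
      moreover have "S = {k..<Suc k}" using k by auto
      ultimately show ?thesis by blast
    qed
  qed
  show "{{i..<j} | i j. seg (map snd w) i j} \<subseteq> syllables w"
  proof clarify
    fix i j assume s: "seg (map snd w) i j"
    hence ij: "i < j" "j \<le> length w" by (auto simp: seg_def)
    from s consider "j = Suc i" "\<bar>map snd w ! i\<bar> \<ge> 2" | e where "e \<in> {1, -1}" "\<forall>k\<in>{i..<j}. map snd w ! k = e"
        "i > 0 \<longrightarrow> map snd w ! (i - 1) \<noteq> e" "j < length w \<longrightarrow> map snd w ! j \<noteq> e"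
      unfolding seg_def length_map by blast
    thus "{i..<j} \<in> syllables w"
    proof cases
      case 1
      hence "{i..<j} = {i}" by auto
      thus ?thesis using 1 ij by (auto simp: syllables_def big_syllables_def)
    next
      case 2
      have all: "power_at w k = e" if "k \<in> {i..<j}" for k using 2(2) that ij by auto
      have left: "i > 0 \<longrightarrow> power_at w (i - 1) \<noteq> e" using 2(3) ij by auto
      have right: "j < length w \<longrightarrow> power_at w j \<noteq> e" using 2(4) by auto
      show ?thesis
      proof (cases "j = Suc i")
        case True
        hence "{i..<j} = {i}" by auto
        moreover have "{i} \<in> singleton_syllables w"
          unfolding singleton_syllables_def using all[of i] left right 2(1) ij True by auto
        ultimately show ?thesis by (simp add: syllables_def)
      next
        case False
        then obtain j' where j': "j = Suc j'" "i < j'" using ij by (cases j) auto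
        have "{i..j'} \<in> run_syllables w"
          unfolding run_syllables_def mem_Collect_eq
          by (intro exI[of _ i] exI[of _ j'] conjI refl bexI[of _ e]) (use all left right 2(1) ij j' in auto)
        moreover have "{i..<j} = {i..j'}" using j' by auto
        ultimately show ?thesis by (simp add: syllables_def)
      qed
    qed
  qed
qed

definition segs :: "int list \<Rightarrow> nat set set" where
  "segs ns = {{i..<j} | i j. seg ns i j}"

definition Lam :: "int list \<Rightarrow> real" where
  "Lam ns = (\<Sum>S\<in>segs ns. ln (1 + real_of_int (\<Sum>k\<in>S. \<bar>ns ! k\<bar>)))"

lemma Lambda_Lam: "Lambda w = Lam (map snd w)"
  unfolding Lambda_def Lam_def segs_def syllables_seg
proof (rule sum.cong[OF HOL.refl])
  fix S assume "S \<in> {{i..<j} | i j. seg (map snd w) i j}"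
  then obtain i j where "S = {i..<j}" "j \<le> length w" by (auto simp: seg_def)
  hence "syllable_deg w S = (\<Sum>k\<in>S. \<bar>map snd w ! k\<bar>)"
    unfolding syllable_deg_def by (intro sum.cong) auto
  thus "ln (1 + real_of_int (syllable_deg w S)) = ln (1 + real_of_int (\<Sum>k\<in>S. \<bar>map snd w ! k\<bar>))" by simp
qed

lemma finite_segs: "finite (segs ns)"
proof -
  have "segs ns \<subseteq> Pow {..<length ns}" by (auto simp: segs_def seg_def)
  thus ?thesis by (rule finite_subset) simp
qed

lemma Lam_Nil: "Lam [] = 0"
  by (simp add: Lam_def segs_def seg_def)

text \<open>The condition that \<open>a\<close> is the first syllable of \<open>a @ b\<close>;
  maximality concerns only the right end, where it is a condition on the head of
  \<open>b\<close>.\<close>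

definition block :: "int list \<Rightarrow> int list \<Rightarrow> bool" where
  "block a b \<longleftrightarrow> (\<exists>n. a = [n] \<and> \<bar>n\<bar> \<ge> 2) \<or>
     (\<exists>e\<in>{1, -1}. a \<noteq> [] \<and> set a = {e} \<and> (b \<noteq> [] \<longrightarrow> hd b \<noteq> e))"

text \<open>No syllable crosses the end of a block, since a run of \<open>a\<close> cannot be
  continued by the head of \<open>b\<close> and a power of modulus at least 2 belongs to no
  run.\<close>

lemma seg_append:
  assumes "block a b"
  shows "seg (a @ b) i j \<longleftrightarrow> (i = 0 \<and> j = length a) \<or> (i \<ge> length a \<and> seg b (i - length a) (j - length a))"
    (is "?L \<longleftrightarrow> ?R")
proof -
  define k where "k = length a"
  have k0: "k > 0" using assms by (auto simp: block_def k_def)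
  have nA: "(a @ b) ! x = a ! x" if "x < k" for x using that by (simp add: nth_append k_def)
  have nB: "(a @ b) ! x = b ! (x - k)" if "x \<ge> k" for x using that by (simp add: nth_append k_def)
  have hb: "b \<noteq> [] \<Longrightarrow> hd b = b ! 0" by (rule hd_conv_nth)
  from assms consider (big) n where "a = [n]" "\<bar>n\<bar> \<ge> 2"
    | (run) e where "e \<in> {1, -1}" "set a = {e}" "b \<noteq> [] \<longrightarrow> hd b \<noteq> e"
    unfolding block_def by blast
  \<comment> \<open>Left maximality of a run that starts \<open>b\<close>: it is vacuous in
    \<open>b\<close> alone but a condition on the last power of \<open>a\<close> in the joined
    list.\<close>
  hence last_ne: "(a @ b) ! (k - 1) \<noteq> e'" if "b \<noteq> []" "e' = b ! 0" "e' \<in> {1, -1}" for e'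
  proof cases
    case big thus ?thesis using that by (auto simp: k_def)
  next
    case run
    have "a ! (k - 1) \<in> set a" using k0 by (auto simp: k_def)
    hence "a ! (k - 1) = e" using run by simp
    thus ?thesis using run(3) that hb nA[of "k - 1"] k0 by auto
  qed
  show ?thesis
  proof
    assume L: ?L
    hence ij: "i < j" "j \<le> k + length b" by (auto simp: seg_def k_def)
    show ?R
    proof (cases "i < k")
      case True
      from \<open>block a b\<close> consider (big) n where "a = [n]" "\<bar>n\<bar> \<ge> 2"
        | (run) e where "e \<in> {1, -1}" "set a = {e}" "b \<noteq> [] \<longrightarrow> hd b \<noteq> e"
        unfolding block_def by blast
      thus ?thesis
      proof cases
        case big
        hence "i = 0" "k = 1" using True by (auto simp: k_def)
        moreover have "j = Suc 0"
        proof (rule ccontr)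
          assume "j \<noteq> Suc 0"
          then obtain e where "e \<in> {1, -1}" "(a @ b) ! 0 = e" using L \<open>i = 0\<close> unfolding seg_def by auto
          thus False using big by auto
        qed
        ultimately show ?thesis by (simp add: k_def)
      next
        case run
        have all: "(a @ b) ! x = e" if "x < k" for x
          using nA[OF that] run(2) that nth_mem[of x a] by (auto simp: k_def)
        have "\<not> \<bar>(a @ b) ! i\<bar> \<ge> 2" using all[OF True] run(1) by auto
        then obtain e' where e': "\<forall>x\<in>{i..<j}. (a @ b) ! x = e'" "i > 0 \<longrightarrow> (a @ b) ! (i - 1) \<noteq> e'"
           "j < length (a @ b) \<longrightarrow> (a @ b) ! j \<noteq> e'"
          using L unfolding seg_def by blast
        have "e' = e" using e'(1) all[OF True] ij(1) by auto
        have "i = 0"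
        proof (rule ccontr)
          assume "i \<noteq> 0"
          hence "i - 1 < k" "0 < i" using True by auto
          thus False using e'(2) all[of "i - 1"] \<open>e' = e\<close> by simp
        qed
        moreover have "j = k"
        proof (rule ccontr)
          assume "j \<noteq> k"
          then consider "j < k" | "j > k" by linarith
          thus False
          proof cases
            case 1
            thus False using e'(3) all[of j] \<open>e' = e\<close> by (simp add: k_def)
          next
            case 2
            hence "(a @ b) ! k = e" using e'(1) \<open>e' = e\<close> \<open>i = 0\<close> by auto
            moreover have "b \<noteq> []" using 2 ij by auto
            ultimately show False using run(3) hb nB[of k] by simp
          qed
        qed
        ultimately show ?thesis by (simp add: k_def)
      qed
    next
      case False
      have "seg b (i - k) (j - k)"
      proof -
        have range: "i - k < j - k" "j - k \<le> length b" using ij False by auto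
        from L show ?thesis
        proof (cases rule: segE)
          case 1
          thus ?thesis using range nB[of i] False by (simp add: seg_def Suc_diff_le)
        next
          case (2 e)
          have "\<forall>x\<in>{i - k..<j - k}. b ! x = e"
          proof
            fix x assume "x \<in> {i - k..<j - k}"
            hence "x + k \<in> {i..<j}" using False by auto
            thus "b ! x = e" using 2(2) nB[of "x + k"] by auto
          qed
          moreover have "i - k > 0 \<longrightarrow> b ! (i - k - 1) \<noteq> e"
          proof
            assume "i - k > 0"
            hence "k \<le> i - 1" "i > 0" "i - 1 - k = i - k - 1" by auto
            thus "b ! (i - k - 1) \<noteq> e" using 2(3) nB[of "i - 1"] by simp
          qed
          moreover have "j - k < length b \<longrightarrow> b ! (j - k) \<noteq> e"
            using 2(4) nB[of j] False ij by (auto simp: k_def)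
          ultimately show ?thesis by (rule seg_runI[OF range 2(1)])
        qed
      qed
      thus ?thesis using False by (simp add: k_def)
    qed
  next
    assume ?R
    thus ?L
    proof
      assume ij: "i = 0 \<and> j = length a"
      from \<open>block a b\<close> show ?L
        unfolding block_def
      proof
        assume "\<exists>n. a = [n] \<and> 2 \<le> \<bar>n\<bar>"
        thus ?L using ij by (auto simp: seg_def)
      next
        assume "\<exists>e\<in>{1, -1}. a \<noteq> [] \<and> set a = {e} \<and> (b \<noteq> [] \<longrightarrow> hd b \<noteq> e)"
        then obtain e where e: "e \<in> {1, -1}" "a \<noteq> []" "set a = {e}" "b \<noteq> [] \<longrightarrow> hd b \<noteq> e" by blast
        have "\<forall>x\<in>{i..<j}. (a @ b) ! x = e"
        proof
          fix x assume "x \<in> {i..<j}"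
          hence "x < k" using ij by (simp add: k_def)
          thus "(a @ b) ! x = e" using nA[of x] e(3) nth_mem[of x a] by (auto simp: k_def)
        qed
        moreover have "j < length (a @ b) \<longrightarrow> (a @ b) ! j \<noteq> e"
          using e(4) ij nB[of j] hb by (auto simp: k_def)
        ultimately show ?L using ij e unfolding seg_def by (intro conjI disjI2 bexI[of _ e]) auto
      qed
    next
      assume R: "length a \<le> i \<and> seg b (i - length a) (j - length a)"
      hence ik: "k \<le> i" "seg b (i - k) (j - k)" by (simp_all add: k_def)
      hence range: "i < j" "j \<le> length (a @ b)" by (auto simp: seg_def k_def)
      from ik(2) show ?L
      proof (cases rule: segE)
        case 1
        hence "j = Suc i" using ik(1) range by linarith
        thus ?thesis using 1(2) nB[OF ik(1)] range by (simp add: seg_def)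
      next
        case (2 e)
        have "\<forall>x\<in>{i..<j}. (a @ b) ! x = e"
        proof
          fix x assume x: "x \<in> {i..<j}"
          hence "x - k \<in> {i - k..<j - k}" using ik(1) by auto
          thus "(a @ b) ! x = e" using 2(2) nB[of x] x ik(1) by auto
        qed
        moreover have "i > 0 \<longrightarrow> (a @ b) ! (i - 1) \<noteq> e"
        proof (cases "i = k")
          case True
          have "j - k \<le> length b" "k < j" using ik(2) range True by (auto simp: seg_def)
          hence bn: "b \<noteq> []" by auto
          have "b ! 0 = e" using 2(2) True \<open>k < j\<close> by auto
          thus ?thesis using last_ne[OF bn, of e] 2(1) True by simp
        next
          case False
          hence "i - 1 \<ge> k" "i - k > 0" "i - 1 - k = i - k - 1" using ik(1) by auto
          thus ?thesis using 2(3) nB[of "i - 1"] by simp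
        qed
        moreover have "j < length (a @ b) \<longrightarrow> (a @ b) ! j \<noteq> e"
          using 2(4) nB[of j] ik(1) range by (auto simp: k_def)
        ultimately show ?thesis by (rule seg_runI[OF range 2(1)])
      qed
    qed
  qed
qed

lemma segs_append:
  assumes "block a b"
  shows "segs (a @ b) = insert {0..<length a} ((\<lambda>S. (+) (length a) ` S) ` segs b)"
proof
  let ?k = "length a"
  have sh: "(+) ?k ` {i..<j} = {i + ?k..<j + ?k}" for i j
    by (simp add: image_add_atLeastLessThan add.commute)
  show "segs (a @ b) \<subseteq> insert {0..<?k} ((\<lambda>S. (+) ?k ` S) ` segs b)"
  proof
    fix S assume "S \<in> segs (a @ b)"
    then obtain i j where S: "S = {i..<j}" "seg (a @ b) i j" by (auto simp: segs_def)
    from S(2) have "(i = 0 \<and> j = ?k) \<or> (i \<ge> ?k \<and> seg b (i - ?k) (j - ?k))" by (simp add: seg_append[OF assms])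
    thus "S \<in> insert {0..<?k} ((\<lambda>S. (+) ?k ` S) ` segs b)"
    proof
      assume h: "i \<ge> ?k \<and> seg b (i - ?k) (j - ?k)"
      hence "i - ?k < j - ?k" by (simp add: seg_def)
      hence "S = (+) ?k ` {i - ?k..<j - ?k}" unfolding sh S(1) using h by auto
      moreover have "{i - ?k..<j - ?k} \<in> segs b" using h by (auto simp: segs_def)
      ultimately show ?thesis by blast
    qed (use S in auto)
  qed
  show "insert {0..<?k} ((\<lambda>S. (+) ?k ` S) ` segs b) \<subseteq> segs (a @ b)"
  proof
    fix S assume "S \<in> insert {0..<?k} ((\<lambda>S. (+) ?k ` S) ` segs b)"
    then consider "S = {0..<?k}" | i j where "seg b i j" "S = (+) ?k ` {i..<j}" by (auto simp: segs_def)
    thus "S \<in> segs (a @ b)"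
    proof cases
      case 1
      have "seg (a @ b) 0 ?k" by (simp add: seg_append[OF assms])
      thus ?thesis using 1 unfolding segs_def by blast
    next
      case 2
      have "seg (a @ b) (i + ?k) (j + ?k)" using 2(1) by (simp add: seg_append[OF assms])
      thus ?thesis using 2(2) sh unfolding segs_def by blast
    qed
  qed
qed

lemma Lam_append:
  assumes "block a b"
  shows "Lam (a @ b) = ln (1 + real_of_int (\<Sum>x\<leftarrow>a. \<bar>x\<bar>)) + Lam b"
proof -
  let ?k = "length a"
  let ?f = "\<lambda>ns S. ln (1 + real_of_int (\<Sum>k\<in>S. \<bar>ns ! k\<bar>))"
  have k0: "?k > 0" using assms by (auto simp: block_def)
  have notin: "{0..<?k} \<notin> (\<lambda>S. (+) ?k ` S) ` segs b"
  proof
    assume "{0..<?k} \<in> (\<lambda>S. (+) ?k ` S) ` segs b"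
    then obtain S where "{0..<?k} = (+) ?k ` S" by blast
    moreover have "0 \<in> {0..<?k}" using k0 by simp
    ultimately show False using k0 by auto
  qed
  have inj: "inj_on (\<lambda>S. (+) ?k ` S) (segs b)" by (intro inj_onI) (simp add: inj_image_eq_iff)
  have "Lam (a @ b) = ?f (a @ b) {0..<?k} + (\<Sum>S\<in>(\<lambda>S. (+) ?k ` S) ` segs b. ?f (a @ b) S)"
    unfolding Lam_def segs_append[OF assms] using notin finite_segs by (intro sum.insert) auto
  also have "(\<Sum>S\<in>(\<lambda>S. (+) ?k ` S) ` segs b. ?f (a @ b) S) = Lam b"
  proof -
    have "(\<Sum>k\<in>(+) ?k ` S. \<bar>(a @ b) ! k\<bar>) = (\<Sum>k\<in>S. \<bar>b ! k\<bar>)" for S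
      by (subst sum.reindex) (auto simp: nth_append intro!: inj_onI)
    thus ?thesis unfolding Lam_def sum.reindex[OF inj] o_def by simp
  qed
  also have "(\<Sum>k\<in>{0..<?k}. \<bar>(a @ b) ! k\<bar>) = (\<Sum>x\<leftarrow>a. \<bar>x\<bar>)"
    by (simp add: sum_list_sum_nth nth_append)
  finally show ?thesis .
qed

lemma Lam_big: "\<bar>n\<bar> \<ge> 2 \<Longrightarrow> Lam (n # ns) = ln (1 + real_of_int \<bar>n\<bar>) + Lam ns"
  using Lam_append[of "[n]" ns] by (simp add: block_def)

text \<open>An empty run is included, with contribution ln 1 = 0; this is convenient when a word may
  or may not begin with a run.\<close>

lemma Lam_run:
  assumes "e \<in> {1, -1}" "ns \<noteq> [] \<longrightarrow> hd ns \<noteq> e"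
  shows "Lam (replicate k e @ ns) = ln (1 + real k) + Lam ns"
proof (cases k)
  case (Suc m)
  have "block (replicate k e) ns" unfolding block_def using assms Suc by (intro disjI2 bexI[of _ e]) auto
  moreover have "(\<Sum>x\<leftarrow>replicate k e. \<bar>x\<bar>) = int k"
    using assms(1) by (auto simp: sum_list_replicate)
  ultimately show ?thesis using Lam_append[of "replicate k e" ns] by simp
qed simp

text \<open>Induction over syllables instead of terms, since the growth of a run is visible only
  when the run is taken as a whole.\<close>

lemma block_list_induct [consumes 1, case_names Nil big run]:
  assumes "0 \<notin> set ns"
    and Nil: "P []"
    and big: "\<And>n ns. \<bar>n\<bar> \<ge> 2 \<Longrightarrow> 0 \<notin> set ns \<Longrightarrow> P ns \<Longrightarrow> P (n # ns)"
    and run: "\<And>e k ns. e \<in> {1, -1 :: int} \<Longrightarrow> 0 \<notin> set ns \<Longrightarrow> (ns \<noteq> [] \<longrightarrow> hd ns \<noteq> e) \<Longrightarrow> P ns \<Longrightarrow> P (replicate (Suc k) e @ ns)"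
  shows "P ns"
  using assms(1)
proof (induction ns rule: length_induct)
  case (1 ns)
  show ?case
  proof (cases ns)
    case Nil
    thus ?thesis using \<open>P []\<close> by simp
  next
    case (Cons n ms)
    show ?thesis
    proof (cases "\<bar>n\<bar> \<ge> 2")
      case True
      thus ?thesis using 1 big Cons by simp
    next
      case False
      hence n: "n \<in> {1, -1}" using 1(2) Cons by auto
      define a where "a = takeWhile (\<lambda>x. x = n) ms"
      define b where "b = dropWhile (\<lambda>x. x = n) ms"
      have ms: "ms = a @ b" by (simp add: a_def b_def)
      have "a = replicate (length a) n"
        unfolding a_def by (induction ms) auto
      hence ns: "ns = replicate (Suc (length a)) n @ b" using Cons ms by simp
      have "b \<noteq> [] \<longrightarrow> hd b \<noteq> n" unfolding b_def using hd_dropWhile[of "\<lambda>x. x = n" ms] by auto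
      moreover have "P b" using 1 ms Cons by (auto simp: less_Suc_eq_le)
      moreover have "0 \<notin> set b" using 1(2) ms Cons by auto
      ultimately show ?thesis using run[OF n, of b "length a"] ns by simp
    qed
  qed
qed

lemma Lam_nonneg: "0 \<notin> set ns \<Longrightarrow> Lam ns \<ge> 0"
proof (induction rule: block_list_induct)
  case (run e k ns)
  have "ln (1 + real (Suc k)) \<ge> 0" by simp
  thus ?case using run Lam_run[OF run(1,3), of "Suc k"] by linarith
qed (auto simp: Lam_Nil Lam_big)

lemma Lam_ge_ln2:
  assumes "0 \<notin> set ns" "ns \<noteq> []"
  shows "Lam ns \<ge> ln 2"
  using assms
proof (induction rule: block_list_induct)
  case (big n ns)
  have "ln 2 \<le> ln (1 + real_of_int \<bar>n\<bar>)" using big(1) by (subst ln_le_cancel_iff) auto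
  thus ?case using Lam_big[OF big(1), of ns] Lam_nonneg[OF big(2)] by linarith
next
  case (run e k ns)
  have "ln 2 \<le> ln (1 + real (Suc k))" by (subst ln_le_cancel_iff) auto
  thus ?case using Lam_run[OF run(1,3), of "Suc k"] Lam_nonneg[OF run(2)] by linarith
qed auto

subsection \<open>Growth of the matrix entries\<close>

text \<open>The action of the product of the matrices (2n, -1; 1, 0) on a column vector. The head of
  the list is the leftmost factor and acts last.\<close>

primrec chain :: "real \<times> real \<Rightarrow> int list \<Rightarrow> real \<times> real" where
  "chain v [] = v"
| "chain v (n # ns) = (2 * of_int n * fst (chain v ns) - snd (chain v ns), fst (chain v ns))"

lemma chain_append: "chain v (a @ b) = chain (chain v b) a"
  by (induction a) auto

lemma int_abs_ge_1: "n \<noteq> 0 \<Longrightarrow> 1 \<le> \<bar>real_of_int n\<bar>"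
  by linarith

lemma chain_step_bound:
  fixes x y :: real
  assumes "\<bar>y\<bar> \<le> \<bar>x\<bar>"
  shows "(2 * \<bar>of_int n\<bar> - 1) * \<bar>x\<bar> \<le> \<bar>2 * of_int n * x - y\<bar>"
proof -
  have "\<bar>2 * of_int n * x\<bar> = 2 * \<bar>of_int n\<bar> * \<bar>x\<bar>" by (simp add: abs_mult)
  hence "2 * \<bar>of_int n\<bar> * \<bar>x\<bar> - \<bar>y\<bar> \<le> \<bar>2 * of_int n * x - y\<bar>" by (metis abs_triangle_ineq2)
  thus ?thesis using assms by (simp add: algebra_simps)
qed

text \<open>The cone |y| <= |x| is preserved and the first coordinate does not shrink in it, because
  2 |n| - 1 is at least 1.\<close>

lemma chain_dominant:
  assumes "0 \<notin> set ns" "\<bar>snd v\<bar> \<le> \<bar>fst v\<bar>"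
  shows "\<bar>snd (chain v ns)\<bar> \<le> \<bar>fst (chain v ns)\<bar> \<and> \<bar>fst v\<bar> \<le> \<bar>fst (chain v ns)\<bar>"
  using assms(1)
proof (induction ns)
  case (Cons n ns)
  let ?x = "fst (chain v ns)"
  have IH: "\<bar>snd (chain v ns)\<bar> \<le> \<bar>?x\<bar>" "\<bar>fst v\<bar> \<le> \<bar>?x\<bar>" using Cons by auto
  have "1 * \<bar>?x\<bar> \<le> (2 * \<bar>of_int n\<bar> - 1) * \<bar>?x\<bar>"
    using int_abs_ge_1[of n] Cons(2) by (intro mult_right_mono) auto
  thus ?case using chain_step_bound[OF IH(1), of n] IH by simp
qed (use assms(2) in auto)

text \<open>The step for a power e of modulus 1 is e times a unipotent matrix, so apart from the
  sign e^k its powers are linear in k.\<close>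

lemma chain_replicate:
  assumes "e \<in> {1, -1}"
  shows "chain (x, y) (replicate k e) =
    (of_int e ^ k * ((real k + 1) * x - of_int e * real k * y), of_int e ^ k * (of_int e * real k * x - (real k - 1) * y))"
proof (induction k)
  case (Suc k)
  from assms consider "e = 1" | "e = - 1" by auto
  thus ?case using Suc by cases (auto simp: algebra_simps)
qed auto

text \<open>Directly after a power different from \<open>e\<close>, the ratio \<open>e * y / x\<close> stays away from the fixed
  point \<open>1\<close> of the parabolic step \<open>t \<mapsto> 1 / (2 - t)\<close>.\<close>

lemma chain_ratio:
  assumes "0 \<notin> set (n # ns)" "e \<in> {1, -1}" "n \<noteq> e" "\<bar>snd v\<bar> \<le> \<bar>fst v\<bar>"
  defines "x \<equiv> fst (chain v (n # ns))" and "y \<equiv> snd (chain v (n # ns))"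
  shows "3 * (of_int e * x * y) \<le> x\<^sup>2" and "\<bar>n\<bar> \<ge> 2 \<Longrightarrow> 3 * \<bar>y\<bar> \<le> \<bar>x\<bar>"
    and "n = - e \<Longrightarrow> of_int e * x * y \<le> - y\<^sup>2"
proof -
  define u where "u = fst (chain v ns)"
  define w where "w = snd (chain v ns)"
  have uw: "\<bar>w\<bar> \<le> \<bar>u\<bar>" using chain_dominant[of ns v] assms by (simp add: u_def w_def)
  have x: "x = 2 * of_int n * u - w" and y: "y = u" by (simp_all add: x_def y_def u_def w_def)
  have e: "\<bar>of_int e :: real\<bar> = 1" "(of_int e :: real) * of_int e = 1" using assms(2) by auto
  show big: "3 * \<bar>y\<bar> \<le> \<bar>x\<bar>" if "\<bar>n\<bar> \<ge> 2"
  proof -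
    have "2 \<le> \<bar>real_of_int n\<bar>" using that by linarith
    hence "3 * \<bar>u\<bar> \<le> (2 * \<bar>of_int n\<bar> - 1) * \<bar>u\<bar>" by (intro mult_right_mono) auto
    thus ?thesis using chain_step_bound[OF uw, of n] x y by simp
  qed
  show neg: "of_int e * x * y \<le> - y\<^sup>2" if "n = - e"
  proof -
    have "\<bar>of_int e * (u * w)\<bar> = \<bar>u\<bar> * \<bar>w\<bar>" using e by (simp add: abs_mult)
    also have "\<dots> \<le> \<bar>u\<bar> * \<bar>u\<bar>" using uw by (intro mult_left_mono) auto
    finally have "- (of_int e * (u * w)) \<le> u\<^sup>2" by (simp add: power2_eq_square)
    moreover have "of_int e * x * y = - 2 * (of_int e * of_int e) * u\<^sup>2 - of_int e * (u * w)"
      unfolding x y that by (simp add: power2_eq_square algebra_simps)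
    ultimately show ?thesis using e y by simp
  qed
  show "3 * (of_int e * x * y) \<le> x\<^sup>2"
  proof (cases "\<bar>n\<bar> \<ge> 2")
    case True
    have "of_int e * x * y \<le> \<bar>of_int e * x * y\<bar>" by simp
    also have "\<dots> = \<bar>x\<bar> * \<bar>y\<bar>" using e by (simp add: abs_mult)
    finally have "3 * (of_int e * x * y) \<le> \<bar>x\<bar> * (3 * \<bar>y\<bar>)" by simp
    also have "\<dots> \<le> \<bar>x\<bar> * \<bar>x\<bar>" using big[OF True] by (intro mult_left_mono) auto
    finally show ?thesis by (simp add: power2_eq_square)
  next
    case False
    hence "n = - e" using assms(1,2,3) by auto
    from neg[OF this] show ?thesis using zero_le_power2[of x] zero_le_power2[of y] by linarith
  qed
qed

text \<open>The hypothesis limits the loss \<open>e * k * x * y\<close> to a third of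
  \<open>k * x\<^sup>2\<close>, so the entry grows at least by the factor 1 + 2 k / 3. Only the
  square of this factor dominates 1 + k.\<close>

lemma run_growth:
  fixes x y :: real
  assumes "3 * (e * x * y) \<le> x\<^sup>2" "0 \<le> k"
  shows "(1 + k) * x\<^sup>2 \<le> ((k + 1) * x - e * k * y)\<^sup>2"
proof (cases "x = 0")
  case False
  define z where "z = (k + 1) * x - e * k * y"
  have "k * (3 * (e * x * y)) \<le> k * x\<^sup>2" using assms by (intro mult_left_mono)
  hence "(1 + 2 * k / 3) * x\<^sup>2 \<le> z * x" by (simp add: z_def power2_eq_square algebra_simps)
  also have "z * x \<le> \<bar>z\<bar> * \<bar>x\<bar>" by (metis abs_ge_self abs_mult)
  finally have "((1 + 2 * k / 3) * \<bar>x\<bar>) * \<bar>x\<bar> \<le> \<bar>z\<bar> * \<bar>x\<bar>" by (simp add: power2_eq_square mult.assoc)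
  hence "(1 + 2 * k / 3) * \<bar>x\<bar> \<le> \<bar>z\<bar>" using False by (simp add: mult_le_cancel_right_pos)
  hence "((1 + 2 * k / 3) * \<bar>x\<bar>)\<^sup>2 \<le> \<bar>z\<bar>\<^sup>2" using assms(2) by (intro power_mono) auto
  hence "(1 + 2 * k / 3)\<^sup>2 * x\<^sup>2 \<le> z\<^sup>2" by (simp add: power_mult_distrib)
  moreover have "(1 + k) * x\<^sup>2 \<le> (1 + 2 * k / 3)\<^sup>2 * x\<^sup>2"
  proof (rule mult_right_mono)
    have "(1 + 2 * k / 3)\<^sup>2 = 1 + 4 * k / 3 + 4 * (k * k) / 9" by (simp add: power2_eq_square algebra_simps)
    thus "1 + k \<le> (1 + 2 * k / 3)\<^sup>2" using assms(2) zero_le_square[of k] by linarith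
  qed simp
  ultimately show ?thesis by (simp add: z_def)
qed simp

text \<open>Each syllable multiplies the square of the first coordinate at least by 1 + degree. The
  last power acts first, so the start vector must satisfy the ratio condition with respect to it if
  it is +1 or -1.\<close>

lemma chain_growth:
  assumes "0 \<notin> set ns" "\<bar>snd v\<bar> \<le> \<bar>fst v\<bar>"
    and "ns \<noteq> [] \<Longrightarrow> last ns \<in> {1, -1} \<Longrightarrow> 3 * (of_int (last ns) * fst v * snd v) \<le> (fst v)\<^sup>2"
  shows "exp (Lam ns) * (fst v)\<^sup>2 \<le> (fst (chain v ns))\<^sup>2"
  using assms(1,3)
proof (induction rule: block_list_induct)
  case Nil
  thus ?case by (simp add: Lam_Nil)
next
  case (big n ns)
  let ?x = "fst (chain v ns)"
  have IH: "exp (Lam ns) * (fst v)\<^sup>2 \<le> ?x\<^sup>2"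
  proof (rule big.IH)
    assume "ns \<noteq> []" "last ns \<in> {1, -1}"
    thus "3 * (of_int (last ns) * fst v * snd v) \<le> (fst v)\<^sup>2" using big.prems by simp
  qed
  have n: "2 \<le> \<bar>real_of_int n\<bar>" using big(1) by linarith
  have "(1 + \<bar>of_int n\<bar>) * \<bar>?x\<bar> \<le> (2 * \<bar>of_int n\<bar> - 1) * \<bar>?x\<bar>" using n by (intro mult_right_mono) auto
  also have "\<dots> \<le> \<bar>fst (chain v (n # ns))\<bar>"
    using chain_step_bound[of "snd (chain v ns)" ?x n] chain_dominant[OF big(2) assms(2)] by simp
  finally have "((1 + \<bar>of_int n\<bar>) * \<bar>?x\<bar>)\<^sup>2 \<le> \<bar>fst (chain v (n # ns))\<bar>\<^sup>2" by (intro power_mono) auto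
  hence a: "(1 + \<bar>of_int n\<bar>)\<^sup>2 * ?x\<^sup>2 \<le> (fst (chain v (n # ns)))\<^sup>2" unfolding power_mult_distrib power2_abs .
  have "exp (Lam (n # ns)) * (fst v)\<^sup>2 = (1 + \<bar>of_int n\<bar>) * (exp (Lam ns) * (fst v)\<^sup>2)"
    using n by (simp add: Lam_big[OF big(1)] exp_add)
  also have "\<dots> \<le> (1 + \<bar>of_int n\<bar>) * ?x\<^sup>2" using IH by (intro mult_left_mono) auto
  also have "\<dots> \<le> (1 + \<bar>of_int n\<bar>)\<^sup>2 * ?x\<^sup>2"
    using n by (intro mult_right_mono) (auto simp: power2_eq_square algebra_simps)
  finally show ?case using a by linarith
next
  case (run e k ns)
  define x where "x = fst (chain v ns)"
  define y where "y = snd (chain v ns)"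
  have IH: "exp (Lam ns) * (fst v)\<^sup>2 \<le> x\<^sup>2"
    unfolding x_def
  proof (rule run.IH)
    assume "ns \<noteq> []" "last ns \<in> {1, -1}"
    thus "3 * (of_int (last ns) * fst v * snd v) \<le> (fst v)\<^sup>2" using run.prems by (simp add: last_append)
  qed
  \<comment> \<open>A run that acts first relies on the hypothesis on the start vector; any other
    run follows a different power.\<close>
  have good: "3 * (of_int e * x * y) \<le> x\<^sup>2"
  proof (cases ns)
    case Nil
    have "last (replicate (Suc k) e @ ns) = e" unfolding Nil append_Nil2 by (rule last_replicate) simp
    thus ?thesis using run.prems run(1) Nil by (simp add: x_def y_def)
  next
    case (Cons n ms)
    show ?thesis
      unfolding x_def y_def Cons
      by (rule chain_ratio(1)) (use run Cons assms(2) in auto)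
  qed
  have "chain v (replicate (Suc k) e @ ns) = chain (x, y) (replicate (Suc k) e)"
    unfolding chain_append x_def y_def by simp
  hence "fst (chain v (replicate (Suc k) e @ ns)) = of_int e ^ Suc k * ((real (Suc k) + 1) * x - of_int e * real (Suc k) * y)"
    by (simp only: chain_replicate[OF run(1)] fst_conv)
  moreover have "(real_of_int e ^ Suc k)\<^sup>2 = 1" using run(1) by (auto simp: power_mult[symmetric] power_even_eq)
  ultimately have sq: "(fst (chain v (replicate (Suc k) e @ ns)))\<^sup>2 = ((real (Suc k) + 1) * x - of_int e * real (Suc k) * y)\<^sup>2"
    by (simp only: power_mult_distrib mult_1)
  have "exp (Lam (replicate (Suc k) e @ ns)) * (fst v)\<^sup>2 = (1 + real (Suc k)) * (exp (Lam ns) * (fst v)\<^sup>2)"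
    unfolding Lam_run[OF run(1,3)] exp_add by (subst exp_ln) auto
  also have "\<dots> \<le> (1 + real (Suc k)) * x\<^sup>2" using IH by (intro mult_left_mono) auto
  also have "\<dots> \<le> ((real (Suc k) + 1) * x - of_int e * real (Suc k) * y)\<^sup>2"
    by (rule run_growth[OF good]) simp
  finally show ?case unfolding sq .
qed

text \<open>For a syllable of degree d the absolute values of the coefficients in either coordinate
  add up to at most 1 + 2 d, which is at most the square of 1 + d; hence the factor 2 in the
  exponent.\<close>

lemma chain_upper:
  assumes "0 \<notin> set ns" "\<bar>fst v\<bar> \<le> 1" "\<bar>snd v\<bar> \<le> 1"
  shows "\<bar>fst (chain v ns)\<bar> \<le> exp (2 * Lam ns) \<and> \<bar>snd (chain v ns)\<bar> \<le> exp (2 * Lam ns)"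
  using assms(1)
proof (induction rule: block_list_induct)
  case Nil
  thus ?case using assms by (simp add: Lam_Nil)
next
  case (big n ns)
  define N where "N = exp (2 * Lam ns)"
  define x where "x = fst (chain v ns)"
  define y where "y = snd (chain v ns)"
  have xy: "\<bar>x\<bar> \<le> N" "\<bar>y\<bar> \<le> N" using big.IH by (auto simp: x_def y_def N_def)
  have "exp (2 * Lam (n # ns)) = (1 + \<bar>of_int n\<bar>)\<^sup>2 * N"
  proof -
    have "exp (2 * ln (1 + real_of_int \<bar>n\<bar>)) = (exp (ln (1 + real_of_int \<bar>n\<bar>)))\<^sup>2" by (rule exp_double)
    thus ?thesis by (simp add: Lam_big[OF big(1)] ring_distribs exp_add N_def)
  qed
  moreover have "\<bar>2 * of_int n * x - y\<bar> \<le> (1 + \<bar>of_int n\<bar>)\<^sup>2 * N"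
  proof -
    have "\<bar>2 * of_int n * x - y\<bar> \<le> 2 * \<bar>of_int n\<bar> * \<bar>x\<bar> + \<bar>y\<bar>"
      using abs_triangle_ineq4[of "2 * of_int n * x" y] by (simp add: abs_mult)
    also have "\<dots> \<le> 2 * \<bar>of_int n\<bar> * N + N" using xy by (intro add_mono mult_left_mono) auto
    also have "\<dots> = (1 + 2 * \<bar>of_int n\<bar>) * N" by (simp add: algebra_simps)
    also have "\<dots> \<le> (1 + \<bar>of_int n\<bar>)\<^sup>2 * N" by (intro mult_right_mono) (auto simp: power2_eq_square algebra_simps N_def)
    finally show ?thesis .
  qed
  moreover have "\<bar>x\<bar> \<le> (1 + \<bar>of_int n\<bar>)\<^sup>2 * N"
  proof -
    have "1 * N \<le> (1 + \<bar>of_int n\<bar>)\<^sup>2 * N" by (intro mult_right_mono) (auto simp: power2_eq_square algebra_simps N_def)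
    thus ?thesis using xy by linarith
  qed
  ultimately show ?case by (simp add: x_def y_def)
next
  case (run e k ns)
  define N where "N = exp (2 * Lam ns)"
  define x where "x = fst (chain v ns)"
  define y where "y = snd (chain v ns)"
  define m where "m = real (Suc k)"
  have m: "m \<ge> 1" by (simp add: m_def)
  have N0: "N \<ge> 0" by (simp add: N_def)
  have xy: "\<bar>x\<bar> \<le> N" "\<bar>y\<bar> \<le> N" using run.IH by (auto simp: x_def y_def N_def)
  have L: "exp (2 * Lam (replicate (Suc k) e @ ns)) = (1 + m)\<^sup>2 * N"
  proof -
    have "exp (2 * ln (1 + m)) = (exp (ln (1 + m)))\<^sup>2" by (rule exp_double)
    thus ?thesis unfolding Lam_run[OF run(1,3)] m_def[symmetric] using m by (simp add: ring_distribs exp_add N_def)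
  qed
  have "chain v (replicate (Suc k) e @ ns) = chain (x, y) (replicate (Suc k) e)"
    unfolding chain_append x_def y_def by simp
  hence c: "chain v (replicate (Suc k) e @ ns) =
     (of_int e ^ Suc k * ((m + 1) * x - of_int e * m * y), of_int e ^ Suc k * (of_int e * m * x - (m - 1) * y))"
    unfolding chain_replicate[OF run(1)] m_def .
  have e: "\<bar>real_of_int e\<bar> = 1" using run(1) by auto
  have pe: "\<bar>real_of_int e ^ Suc k * z\<bar> = \<bar>z\<bar>" for z using e by (simp only: abs_mult power_abs power_one mult_1)
  have le: "a * N + b * N \<le> (1 + m)\<^sup>2 * N" if "a + b \<le> 1 + 2 * m" for a b
  proof -
    have "(1 + m)\<^sup>2 = 1 + 2 * m + m * m" by (simp add: power2_eq_square algebra_simps)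
    hence "a + b \<le> (1 + m)\<^sup>2" using that zero_le_square[of m] by linarith
    hence "(a + b) * N \<le> (1 + m)\<^sup>2 * N" using N0 by (rule mult_right_mono)
    thus ?thesis by (simp add: algebra_simps)
  qed
  have "\<bar>(m + 1) * x - of_int e * m * y\<bar> \<le> (m + 1) * \<bar>x\<bar> + m * \<bar>y\<bar>"
    using abs_triangle_ineq4[of "(m + 1) * x" "of_int e * m * y"] m e by (simp add: abs_mult)
  also have "\<dots> \<le> (m + 1) * N + m * N" using xy m by (intro add_mono mult_left_mono) auto
  also have "\<dots> \<le> (1 + m)\<^sup>2 * N" by (rule le) simp
  finally have 1: "\<bar>(m + 1) * x - of_int e * m * y\<bar> \<le> (1 + m)\<^sup>2 * N" .
  have "\<bar>of_int e * m * x - (m - 1) * y\<bar> \<le> m * \<bar>x\<bar> + (m - 1) * \<bar>y\<bar>"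
    using abs_triangle_ineq4[of "of_int e * m * x" "(m - 1) * y"] m e by (simp add: abs_mult)
  also have "\<dots> \<le> m * N + (m - 1) * N" using xy m by (intro add_mono mult_left_mono) auto
  also have "\<dots> \<le> (1 + m)\<^sup>2 * N" by (rule le) simp
  finally have 2: "\<bar>of_int e * m * x - (m - 1) * y\<bar> \<le> (1 + m)\<^sup>2 * N" .
  show ?case unfolding c L fst_conv snd_conv pe using 1 2 by blast
qed

subsection \<open>The matrix of a reduced word\<close>

definition chain_mat :: "int list \<Rightarrow> rmat" where
  "chain_mat ns = (fst (chain (1, 0) ns), fst (chain (0, 1) ns), snd (chain (1, 0) ns), snd (chain (0, 1) ns))"

lemma chain_linear:
  "fst (chain (a, b) ns) = a * fst (chain (1, 0) ns) + b * fst (chain (0, 1) ns)"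
  "snd (chain (a, b) ns) = a * snd (chain (1, 0) ns) + b * snd (chain (0, 1) ns)"
  by (induction ns) (simp_all add: algebra_simps)

lemma mdet_chain_mat: "mdet (chain_mat ns) = 1"
  by (induction ns) (simp_all add: chain_mat_def mdet_def algebra_simps)

text \<open>The rotation \<open>(0, -1, 1, 0)\<close> exchanges the matrices of the two generators, so up to this rotation
  and a sign the matrix of a word is a product of one factor per power, whichever generators occur.\<close>

definition sym_class :: "rmat \<Rightarrow> rmat set" where
  "sym_class = (\<lambda>(p, q, r, s). {(p, q, r, s), (- p, - q, - r, - s), (q, - p, s, - r), (- q, p, - s, r)})"

definition rot_left :: "rmat \<Rightarrow> rmat" where
  "rot_left = (\<lambda>(p, q, r, s). (- r, - s, p, q))"

lemma gen_mat_sym_class: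
  shows "M \<in> sym_class (p, q, r, s) \<Longrightarrow>
      mmul (gen_mat A1 n) M \<in> sym_class (rot_left (2 * of_int n * p - r, 2 * of_int n * q - s, p, q))"
    and "M \<in> sym_class (rot_left (p, q, r, s)) \<Longrightarrow>
      mmul (gen_mat A2 n) M \<in> sym_class (2 * of_int n * p - r, 2 * of_int n * q - s, p, q)"
  unfolding sym_class_def rot_left_def prod.case
  by (elim insertE emptyE; simp add: mmul_def gen_mat_def algebra_simps)+

text \<open>Neighbouring terms use different generators, so the rotation enters at every step and
  the two forms alternate.\<close>

lemma word_mat_chain:
  assumes "successively (\<lambda>s t. fst s \<noteq> fst t) w" "w \<noteq> []"
  shows "word_mat w \<in> sym_class (if fst (hd w) = A2 then chain_mat (map snd w) else rot_left (chain_mat (map snd w)))"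
  using assms
proof (induction w)
  case (Cons t w)
  obtain g n where t: "t = (g, n)" by (cases t)
  show ?case
  proof (cases "w = []")
    case True
    thus ?thesis
      by (cases g) (simp_all add: t gen_mat_def mmul_def mid_def chain_mat_def sym_class_def rot_left_def)
  next
    case False
    obtain p q r s where D: "chain_mat (map snd w) = (p, q, r, s)" by (cases "chain_mat (map snd w)")
    have D': "chain_mat (map snd (t # w)) = (2 * of_int n * p - r, 2 * of_int n * q - s, p, q)"
      using D by (auto simp: chain_mat_def t)
    have s: "successively (\<lambda>s t. fst s \<noteq> fst t) w" "g \<noteq> fst (hd w)"
      using Cons(2) False by (auto simp: successively_Cons t)
    have IH: "word_mat w \<in> sym_class (if fst (hd w) = A2 then (p, q, r, s) else rot_left (p, q, r, s))"
      using Cons.IH[OF s(1) False] unfolding D .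
    show ?thesis
    proof (cases g)
      case A1
      hence "fst (hd w) = A2" using s(2) by (cases "fst (hd w)") auto
      hence "word_mat w \<in> sym_class (p, q, r, s)" using IH by simp
      from gen_mat_sym_class(1)[OF this, of n] show ?thesis unfolding D' by (simp add: A1 t)
    next
      case A2
      hence "fst (hd w) = A1" using s(2) by (cases "fst (hd w)") auto
      hence "word_mat w \<in> sym_class (rot_left (p, q, r, s))" using IH by simp
      from gen_mat_sym_class(2)[OF this, of n] show ?thesis unfolding D' by (simp add: A2 t)
    qed
  qed
qed auto

text \<open>The analogue of \<open>geod\<close> for the unit half circle, over which the imaginary axis \<open>i\<real>\<close>
  is parametrised by the covering.\<close>

definition geod_pb :: "rmat \<Rightarrow> real" where
  "geod_pb = (\<lambda>(p, q, r, s). \<bar>p\<^sup>2 + s\<^sup>2 - q\<^sup>2 - r\<^sup>2\<bar> / 2)"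

lemma geod_sym_class:
  assumes "M \<in> sym_class N"
  shows "geod M = geod N" "geod_pb M = geod_pb N"
proof -
  obtain p q r s where N: "N = (p, q, r, s)" by (cases N)
  have a: "\<bar>q * - r + - p * s\<bar> = \<bar>p * s + q * r\<bar>" "\<bar>- q * r + p * - s\<bar> = \<bar>p * s + q * r\<bar>"
    using abs_minus_cancel[of "p * s + q * r"] by simp_all
  have b: "\<bar>q\<^sup>2 + r\<^sup>2 - p\<^sup>2 - s\<^sup>2\<bar> = \<bar>p\<^sup>2 + s\<^sup>2 - q\<^sup>2 - r\<^sup>2\<bar>" by linarith
  have "geod M = geod N \<and> geod_pb M = geod_pb N"
    using assms a b unfolding N sym_class_def prod.case geod_def geod_pb_def
    by (elim insertE emptyE) simp_all
  thus "geod M = geod N" "geod_pb M = geod_pb N" by auto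
qed

lemma geod_rot_left: "geod (rot_left N) = geod N" "geod_pb (rot_left N) = geod_pb N"
proof -
  obtain p q r s where N: "N = (p, q, r, s)" by (cases N)
  have "- r * q + - s * p = - (p * s + q * r)" by simp
  hence "\<bar>- r * q + - s * p\<bar> = \<bar>p * s + q * r\<bar>" by (simp only: abs_minus_cancel)
  thus "geod (rot_left N) = geod N" by (simp add: N rot_left_def geod_def)
  have "\<bar>(- r)\<^sup>2 + q\<^sup>2 - (- s)\<^sup>2 - p\<^sup>2\<bar> = \<bar>p\<^sup>2 + s\<^sup>2 - q\<^sup>2 - r\<^sup>2\<bar>" unfolding power2_minus by linarith
  thus "geod_pb (rot_left N) = geod_pb N" by (simp add: N rot_left_def geod_pb_def)
qed

lemma geod_word_mat:
  assumes "reduced_word w"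
  shows "geod (word_mat w) = geod (chain_mat (map snd w))" "geod_pb (word_mat w) = geod_pb (chain_mat (map snd w))"
proof -
  have s: "successively (\<lambda>s t. fst s \<noteq> fst t) w" using assms by (simp add: reduced_word_def)
  have "geod (word_mat w) = geod (chain_mat (map snd w)) \<and> geod_pb (word_mat w) = geod_pb (chain_mat (map snd w))"
  proof (cases "w = []")
    case True
    thus ?thesis by (simp add: chain_mat_def mid_def)
  next
    case False
    show ?thesis
      using geod_sym_class[OF word_mat_chain[OF s False]] geod_rot_left by (auto split: if_splits)
  qed
  thus "geod (word_mat w) = geod (chain_mat (map snd w))" "geod_pb (word_mat w) = geod_pb (chain_mat (map snd w))" by auto
qed

lemma chain_mat_upper:
  assumes "0 \<notin> set ns"
  shows "geod (chain_mat ns) \<le> 2 * exp (4 * Lam ns)" "geod_pb (chain_mat ns) \<le> 2 * exp (4 * Lam ns)"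
proof -
  obtain p q r s where D: "chain_mat ns = (p, q, r, s)" by (cases "chain_mat ns")
  define N where "N = exp (2 * Lam ns)"
  have le: "\<bar>p\<bar> \<le> N" "\<bar>q\<bar> \<le> N" "\<bar>r\<bar> \<le> N" "\<bar>s\<bar> \<le> N"
    using chain_upper[OF assms, of "(1, 0)"] chain_upper[OF assms, of "(0, 1)"] D by (auto simp: chain_mat_def N_def)
  have N2: "N * N = exp (4 * Lam ns)" by (simp add: N_def exp_add[symmetric])
  have pr: "\<bar>x * y\<bar> \<le> N * N" if "\<bar>x\<bar> \<le> N" "\<bar>y\<bar> \<le> N" for x y
    unfolding abs_mult using that by (intro mult_mono) auto
  show "geod (chain_mat ns) \<le> 2 * exp (4 * Lam ns)"
    using pr[OF le(1,4)] pr[OF le(2,3)] abs_triangle_ineq[of "p * s" "q * r"] by (simp add: D geod_def N2)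
  show "geod_pb (chain_mat ns) \<le> 2 * exp (4 * Lam ns)"
  proof -
    have "p * p \<le> exp (4 * Lam ns)" "q * q \<le> exp (4 * Lam ns)" "r * r \<le> exp (4 * Lam ns)" "s * s \<le> exp (4 * Lam ns)"
      using pr[OF le(1) le(1)] pr[OF le(2) le(2)] pr[OF le(3) le(3)] pr[OF le(4) le(4)] by (simp_all add: N2)
    hence "\<bar>p * p + s * s - q * q - r * r\<bar> \<le> 4 * exp (4 * Lam ns)"
      using zero_le_square[of p] zero_le_square[of q] zero_le_square[of r] zero_le_square[of s] by linarith
    thus ?thesis by (simp add: D geod_pb_def power2_eq_square)
  qed
qed

text \<open>By the determinant the quantity is |2 p s - 1|, at least |p| as soon as |p| and |s| are
  at least 1. The entry p grows from the harmless start vector (1, 0), and |s| is at least 1 because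
  there are two terms.\<close>

lemma geod_chain_mat_lower:
  assumes nz: "0 \<notin> set ns" and len: "length ns \<ge> 2"
  shows "exp (Lam ns) \<le> (geod (chain_mat ns))\<^sup>2"
proof -
  obtain p q r s where D: "chain_mat ns = (p, q, r, s)" by (cases "chain_mat ns")
  have d: "p * s - q * r = 1" using mdet_chain_mat[of ns] by (simp add: D mdet_def)
  have p: "p = fst (chain (1, 0) ns)" and s: "s = snd (chain (0, 1) ns)" using D by (auto simp: chain_mat_def)
  have p2: "exp (Lam ns) \<le> p\<^sup>2" using chain_growth[OF nz, of "(1, 0)"] by (simp add: p)
  have p1: "\<bar>p\<bar> \<ge> 1" using chain_dominant[OF nz, of "(1, 0)"] by (simp add: p)
  obtain n m ms' where "ns = n # m # ms'" using len by (metis Suc_le_length_iff numeral_2_eq_2)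
  then obtain ms where ns: "ns = n # ms" "ms \<noteq> []" by blast
  define b where "b = butlast ms"
  have ms: "ms = b @ [last ms]" using ns(2) by (simp add: b_def)
  have "s = fst (chain (0, 1) ms)" by (simp add: s ns)
  \<comment> \<open>The term that acts first takes (0, 1) to (-1, 0), which lies in the preserved
    cone.\<close>
  also have "chain (0, 1) ms = chain (- 1, 0) b" by (subst ms) (simp add: chain_append)
  finally have "\<bar>s\<bar> \<ge> 1" using chain_dominant[of b "(- 1, 0)"] nz ns(1) ms
    by (metis UnI1 abs_minus_cancel abs_one abs_zero fst_conv list.set_intros(2) set_append snd_conv zero_le_one)
  hence "\<bar>p\<bar> * 1 \<le> \<bar>p\<bar> * \<bar>s\<bar>" by (intro mult_left_mono) auto
  hence "\<bar>p\<bar> \<le> \<bar>p * s\<bar>" by (simp add: abs_mult)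
  moreover have "p * s + q * r = 2 * (p * s) - 1" using d by simp
  ultimately have "\<bar>p\<bar> \<le> geod (chain_mat ns)" using p1 by (simp add: D geod_def)
  hence "\<bar>p\<bar>\<^sup>2 \<le> (geod (chain_mat ns))\<^sup>2" by (intro power_mono) auto
  thus ?thesis using p2 by simp
qed

text \<open>The quadratic form factors as (p + q) (p - q) - (r + s) (r - s). The vectors (1, 1) and
  (1, -1) that appear span the fixed lines of the steps with powers +1 and -1, which accounts for
  the exceptional words.\<close>

lemma geod_pb_chain: "geod_pb (chain_mat ns) =
   \<bar>fst (chain (1, 1) ns) * fst (chain (1, - 1) ns) - snd (chain (1, 1) ns) * snd (chain (1, - 1) ns)\<bar> / 2"
  unfolding chain_linear[of 1 1] chain_linear[of 1 "- 1"]
  by (simp add: chain_mat_def geod_pb_def power2_eq_square algebra_simps)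

lemma geod_pb_replicate:
  assumes "e \<in> {1, -1}"
  shows "geod_pb (chain_mat (replicate k e)) = 1"
proof -
  have "(real_of_int e ^ k) * (real_of_int e ^ k) = 1" using assms by (auto simp: power_mult_distrib[symmetric])
  hence *: "(real_of_int e ^ k * a) * (real_of_int e ^ k * b) = a * b" for a b by (metis mult.assoc mult.left_commute mult_1)
  show ?thesis
    unfolding geod_pb_chain chain_replicate[OF assms] fst_conv snd_conv *
    using assms by (auto simp: algebra_simps)
qed

lemma abs_le_of_mult_le:
  fixes c a t :: real
  assumes "c * a\<^sup>2 \<le> t * a" "a \<noteq> 0"
  shows "c * \<bar>a\<bar> \<le> \<bar>t\<bar>"
proof -
  have "(c * \<bar>a\<bar>) * \<bar>a\<bar> = c * a\<^sup>2" by (simp add: power2_eq_square)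
  also have "\<dots> \<le> t * a" by fact
  also have "\<dots> \<le> \<bar>t\<bar> * \<bar>a\<bar>" by (metis abs_ge_self abs_mult)
  finally show ?thesis using assms(2) by (simp add: mult_le_cancel_right_pos)
qed

text \<open>The leading run is split off, as it acts last and its growth must be seen in the
  bilinear expression itself. On the rest, one of the start vectors (1, 1) and (1, -1) grows as
  required, while for the other a fixed lower bound is enough.\<close>

lemma geod_pb_chain_mat_lower:
  assumes nz: "0 \<notin> set ns" and ne: "\<And>e. e \<in> {1, -1} \<Longrightarrow> \<exists>n\<in>set ns. n \<noteq> e"
  shows "exp (Lam ns) \<le> (geod_pb (chain_mat ns))\<^sup>2"
proof -
  have nsn: "ns \<noteq> []" using ne[of 1] by auto
  \<comment> \<open>The run may be empty, but only if the first power has modulus at least 2; the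
    choice e = 1 is then arbitrary.\<close>
  obtain k e rest where ns: "ns = replicate k e @ rest" "e \<in> {1, -1}" "rest \<noteq> []" "hd rest \<noteq> e"
    and k0: "k = 0 \<Longrightarrow> \<bar>hd rest\<bar> \<ge> 2"
  proof (cases "\<bar>hd ns\<bar> \<ge> 2")
    case True
    show ?thesis by (rule that[of 0 1 ns]) (use True nsn in auto)
  next
    case False
    define e where "e = hd ns"
    have e: "e \<in> {1, -1}" using False nz nsn hd_in_set[OF nsn] unfolding e_def by (cases "hd ns = 0") auto
    define a where "a = takeWhile (\<lambda>x. x = e) ns"
    define b where "b = dropWhile (\<lambda>x. x = e) ns"
    have "a = replicate (length a) e" unfolding a_def by (induction ns) auto
    moreover have "ns = a @ b" by (simp add: a_def b_def)
    ultimately have "ns = replicate (length a) e @ b" by simp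
    moreover have "b \<noteq> []" unfolding b_def using ne[OF e] by auto
    moreover have "hd b \<noteq> e" using hd_dropWhile[of "\<lambda>x. x = e" ns] \<open>b \<noteq> []\<close> by (auto simp: b_def)
    moreover have "length a \<noteq> 0" using nsn by (cases ns) (auto simp: a_def e_def)
    ultimately show ?thesis using that e by blast
  qed
  obtain n rs where rest: "rest = n # rs" using ns(3) by (cases rest) auto
  have nzr: "0 \<notin> set rest" using nz ns(1) by auto
  have n: "n \<noteq> e" "n \<noteq> 0" using ns(4) nzr rest by auto
  define x1 where "x1 = fst (chain (1, 1) rest)"
  define y1 where "y1 = snd (chain (1, 1) rest)"
  define x2 where "x2 = fst (chain (1, - 1) rest)"
  define y2 where "y2 = snd (chain (1, - 1) rest)"
  define \<epsilon> where "\<epsilon> = real_of_int e"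
  define K where "K = real k"
  define E where "E = exp (Lam rest)"
  \<comment> \<open>The bilinear expression after the leading run; its quadratic terms in
    \<open>K\<close> cancel because the step is parabolic.\<close>
  define T where "T = 2 * K * ((x1 - \<epsilon> * y1) * (x2 - \<epsilon> * y2)) + (x1 * x2 - y1 * y2)"
  have \<epsilon>: "\<epsilon> * \<epsilon> = 1" using ns(2) by (auto simp: \<epsilon>_def)
  have geodT: "geod_pb (chain_mat ns) = \<bar>T\<bar> / 2"
  proof -
    have "(\<epsilon> ^ k) * (\<epsilon> ^ k) = 1" using \<epsilon> by (simp add: power_mult_distrib[symmetric])
    hence *: "(\<epsilon> ^ k * a) * (\<epsilon> ^ k * b) = a * b" for a b by (metis mult.assoc mult.left_commute mult_1)
    have c: "chain (1, 1) ns = chain (x1, y1) (replicate k e)" "chain (1, - 1) ns = chain (x2, y2) (replicate k e)"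
      by (simp_all add: ns(1) chain_append x1_def y1_def x2_def y2_def)
    have "fst (chain (1, 1) ns) * fst (chain (1, - 1) ns) - snd (chain (1, 1) ns) * snd (chain (1, - 1) ns)
       = ((K + 1) * x1 - \<epsilon> * K * y1) * ((K + 1) * x2 - \<epsilon> * K * y2) - (\<epsilon> * K * x1 - (K - 1) * y1) * (\<epsilon> * K * x2 - (K - 1) * y2)"
      unfolding c chain_replicate[OF ns(2)] fst_conv snd_conv \<epsilon>_def[symmetric] K_def[symmetric] * ..
    also have "\<dots> = T + (\<epsilon> * \<epsilon> - 1) * (K * K * y1 * y2 - K * K * x1 * x2 - 2 * K * y1 * y2)"
      by (simp add: T_def algebra_simps)
    also have "\<dots> = T" by (simp add: \<epsilon>)
    finally show ?thesis unfolding geod_pb_chain by simp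
  qed
  have K: "K \<ge> 0" by (simp add: K_def)
  have LamE: "exp (Lam ns) = (1 + K) * E"
    unfolding ns(1) using Lam_run[OF ns(2), of rest k] ns(4) K by (simp add: exp_add E_def K_def)
  have dom: "\<bar>y1\<bar> \<le> \<bar>x1\<bar>" "\<bar>x1\<bar> \<ge> 1" "\<bar>y2\<bar> \<le> \<bar>x2\<bar>" "\<bar>x2\<bar> \<ge> 1"
    using chain_dominant[OF nzr, of "(1, 1)"] chain_dominant[OF nzr, of "(1, - 1)"] by (auto simp: x1_def y1_def x2_def y2_def)
  have xn: "x1 \<noteq> 0" "x2 \<noteq> 0" "x1 * x2 \<noteq> 0" using dom by auto
  \<comment> \<open>The start vector is chosen with sign opposite to the power that acts first; if
    that power has modulus at least 2, there is no condition.\<close>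
  have big: "E \<le> x1\<^sup>2 \<or> E \<le> x2\<^sup>2"
  proof (cases "last rest = 1")
    case True
    have "exp (Lam rest) * (fst (1 :: real, - 1 :: real))\<^sup>2 \<le> (fst (chain (1, - 1) rest))\<^sup>2"
      by (rule chain_growth[OF nzr]) (use True in auto)
    thus ?thesis by (simp add: E_def x2_def)
  next
    case False
    have "exp (Lam rest) * (fst (1 :: real, 1 :: real))\<^sup>2 \<le> (fst (chain (1, 1) rest))\<^sup>2"
      by (rule chain_growth[OF nzr]) (use False in auto)
    thus ?thesis by (simp add: E_def x1_def)
  qed
  have prod: "c\<^sup>2 * E \<le> (x1 * x2)\<^sup>2" if "c \<ge> 0" "\<bar>x1\<bar> \<ge> c" "\<bar>x2\<bar> \<ge> c" for c
  proof -
    have c2: "c\<^sup>2 \<le> x1\<^sup>2" "c\<^sup>2 \<le> x2\<^sup>2" using that by (auto simp: abs_le_square_iff[symmetric])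
    have E0: "E \<ge> 0" by (simp add: E_def)
    from big show ?thesis
    proof
      assume "E \<le> x1\<^sup>2"
      hence "c\<^sup>2 * E \<le> x2\<^sup>2 * x1\<^sup>2" using c2 E0 by (intro mult_mono) auto
      thus ?thesis by (simp add: power_mult_distrib mult.commute)
    next
      assume "E \<le> x2\<^sup>2"
      hence "c\<^sup>2 * E \<le> x1\<^sup>2 * x2\<^sup>2" using c2 E0 by (intro mult_mono) auto
      thus ?thesis by (simp add: power_mult_distrib)
    qed
  qed
  \<comment> \<open>It remains to compare |T| with |x1 x2| by a factor \<open>c\<close> and to bound
    both entries below by \<open>d\<close>. The 4 compensates the division of T by 2.\<close>
  have sq: "(1 + K) * E \<le> (\<bar>T\<bar> / 2)\<^sup>2" if T: "c * \<bar>x1 * x2\<bar> \<le> \<bar>T\<bar>" "c \<ge> 0" and d: "d \<ge> 0" "\<bar>x1\<bar> \<ge> d" "\<bar>x2\<bar> \<ge> d"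
    and cd: "4 * (1 + K) \<le> c\<^sup>2 * d\<^sup>2" for c d
  proof -
    have E0: "E \<ge> 0" by (simp add: E_def)
    have "4 * (1 + K) * E \<le> (c\<^sup>2 * d\<^sup>2) * E" using cd E0 by (rule mult_right_mono)
    also have "\<dots> = c\<^sup>2 * (d\<^sup>2 * E)" by simp
    also have "\<dots> \<le> c\<^sup>2 * (x1 * x2)\<^sup>2" using prod[OF d] by (intro mult_left_mono) auto
    also have "\<dots> = (c * \<bar>x1 * x2\<bar>)\<^sup>2" by (simp add: power_mult_distrib abs_mult)
    also have "\<dots> \<le> \<bar>T\<bar>\<^sup>2" using T by (intro power_mono) auto
    finally have "4 * (1 + K) * E \<le> T\<^sup>2" by simp
    moreover have "(\<bar>T\<bar> / 2)\<^sup>2 = T\<^sup>2 / 4" by (simp add: power_divide)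
    ultimately show ?thesis by linarith
  qed
  have Txx: "T * (x1 * x2) = 2 * K * (((x1 - \<epsilon> * y1) * x1) * ((x2 - \<epsilon> * y2) * x2)) + (x1 * x2)\<^sup>2 - (y1 * x1) * (y2 * x2)"
    by (simp add: T_def power2_eq_square algebra_simps)
  have "(1 + K) * E \<le> (\<bar>T\<bar> / 2)\<^sup>2"
  proof (cases "\<bar>n\<bar> \<ge> 2")
    case True
    have th: "3 * \<bar>y1\<bar> \<le> \<bar>x1\<bar>" "3 * \<bar>y2\<bar> \<le> \<bar>x2\<bar>"
      unfolding x1_def y1_def x2_def y2_def rest
      using chain_ratio(2)[of n rs e "(1, 1)"] chain_ratio(2)[of n rs e "(1, - 1)"] nzr rest ns(2) n True by auto
    have rs0: "0 \<notin> set rs" using nzr rest by auto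
    \<comment> \<open>The second coordinates are earlier first coordinates and thus at least 1 in
      modulus. The value 3 makes up for the factor 8/9, which alone would not suffice for
      \<open>K = 0\<close>.\<close>
    have d3: "\<bar>x1\<bar> \<ge> 3" "\<bar>x2\<bar> \<ge> 3"
      using th chain_dominant[OF rs0, of "(1, 1)"] chain_dominant[OF rs0, of "(1, - 1)"] by (auto simp: y1_def y2_def rest)
    have z: "(2 / 3) * x\<^sup>2 \<le> (x - \<epsilon> * y) * x" if "3 * \<bar>y\<bar> \<le> \<bar>x\<bar>" for x y
    proof -
      have "\<epsilon> * y * x \<le> \<bar>\<epsilon> * y * x\<bar>" by simp
      also have "\<dots> = \<bar>y\<bar> * \<bar>x\<bar>" using ns(2) by (auto simp: abs_mult \<epsilon>_def)
      also have "\<dots> \<le> (\<bar>x\<bar> / 3) * \<bar>x\<bar>" using that by (intro mult_right_mono) auto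
      finally show ?thesis by (simp add: power2_eq_square algebra_simps)
    qed
    have "(2 / 3 * x1\<^sup>2) * (2 / 3 * x2\<^sup>2) \<le> ((x1 - \<epsilon> * y1) * x1) * ((x2 - \<epsilon> * y2) * x2)"
    proof (rule mult_mono[OF z[OF th(1)] z[OF th(2)]])
      show "0 \<le> (x1 - \<epsilon> * y1) * x1" using z[OF th(1)] zero_le_power2[of x1] by linarith
    qed simp
    hence "2 * K * ((2 / 3 * x1\<^sup>2) * (2 / 3 * x2\<^sup>2)) \<le> 2 * K * (((x1 - \<epsilon> * y1) * x1) * ((x2 - \<epsilon> * y2) * x2))"
      using K by (intro mult_left_mono) auto
    moreover have "(2 / 3 * x1\<^sup>2) * (2 / 3 * x2\<^sup>2) = 4 / 9 * (x1 * x2)\<^sup>2" by (simp add: power_mult_distrib)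
    ultimately have "2 * K * (4 / 9 * (x1 * x2)\<^sup>2) \<le> 2 * K * (((x1 - \<epsilon> * y1) * x1) * ((x2 - \<epsilon> * y2) * x2))"
      by (simp only:)
    moreover have "(y1 * x1) * (y2 * x2) \<le> (1 / 9) * (x1 * x2)\<^sup>2"
    proof -
      have "(y1 * x1) * (y2 * x2) \<le> \<bar>(y1 * x1) * (y2 * x2)\<bar>" by simp
      also have "\<dots> = (\<bar>y1\<bar> * \<bar>y2\<bar>) * \<bar>x1 * x2\<bar>" by (simp add: abs_mult)
      also have "\<dots> \<le> ((\<bar>x1\<bar> / 3) * (\<bar>x2\<bar> / 3)) * \<bar>x1 * x2\<bar>" using th by (intro mult_right_mono mult_mono) auto
      also have "\<dots> = (1 / 9) * (\<bar>x1 * x2\<bar> * \<bar>x1 * x2\<bar>)" by (simp add: abs_mult)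
      also have "\<bar>x1 * x2\<bar> * \<bar>x1 * x2\<bar> = (x1 * x2)\<^sup>2" by (metis abs_mult_self_eq power2_eq_square)
      finally show ?thesis .
    qed
    moreover have "(8 / 9 * (1 + K)) * X \<le> 2 * K * P + X - Y" if "2 * K * (4 / 9 * X) \<le> 2 * K * P" "Y \<le> 1 / 9 * X" for P X Y
    proof -
      have "2 * K * (4 / 9 * X) = 8 / 9 * (K * X)" "2 * K * P = 2 * (K * P)" "(8 / 9 * (1 + K)) * X = 8 / 9 * X + 8 / 9 * (K * X)"
        by (simp_all add: algebra_simps)
      with that show ?thesis by linarith
    qed
    ultimately have "(8 / 9 * (1 + K)) * (x1 * x2)\<^sup>2 \<le> T * (x1 * x2)"
      unfolding Txx by blast
    hence "(8 / 9 * (1 + K)) * \<bar>x1 * x2\<bar> \<le> \<bar>T\<bar>" using xn by (intro abs_le_of_mult_le) auto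
    thus ?thesis
    proof (rule sq[of "8 / 9 * (1 + K)" 3])
      have "1 * (1 + K) \<le> (1 + K) * (1 + K)" using K by (intro mult_right_mono) auto
      moreover have sq9: "(8 / 9 * (1 + K))\<^sup>2 * 3\<^sup>2 = 64 / 9 * ((1 + K) * (1 + K))" by (simp add: power2_eq_square algebra_simps)
      moreover have "4 * a \<le> 64 / 9 * b" if "1 * a \<le> b" "0 \<le> a" for a b :: real using that by linarith
      ultimately show "4 * (1 + K) \<le> (8 / 9 * (1 + K))\<^sup>2 * 3\<^sup>2" unfolding sq9 using K by (metis add_nonneg_nonneg zero_le_one)
    qed (use K d3 in auto)
  next
    case False
    hence ne': "n = - e" using n ns(2) by auto
    have "k \<noteq> 0" using k0 False rest by auto
    \<comment> \<open>For \<open>K = 0\<close> the comparison of \<open>(2 * K + 1)\<^sup>2\<close>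
      with \<open>4 * (1 + K)\<close> would fail, so a nonempty leading run is essential
      here.\<close>
    hence K1: "K \<ge> 1" by (simp add: K_def)
    have z: "x1\<^sup>2 + y1\<^sup>2 \<le> (x1 - \<epsilon> * y1) * x1" "x2\<^sup>2 + y2\<^sup>2 \<le> (x2 - \<epsilon> * y2) * x2"
    proof -
      have a: "\<epsilon> * x1 * y1 \<le> - y1\<^sup>2" "\<epsilon> * x2 * y2 \<le> - y2\<^sup>2"
        unfolding x1_def y1_def x2_def y2_def rest \<epsilon>_def
        using chain_ratio(3)[of n rs e "(1, 1)"] chain_ratio(3)[of n rs e "(1, - 1)"] nzr rest ns(2) n ne' by auto
      thus "x1\<^sup>2 + y1\<^sup>2 \<le> (x1 - \<epsilon> * y1) * x1" "x2\<^sup>2 + y2\<^sup>2 \<le> (x2 - \<epsilon> * y2) * x2"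
        by (simp_all add: power2_eq_square algebra_simps)
    qed
    define R where "R = (x1 * y2)\<^sup>2 + (y1 * x2)\<^sup>2"
    have "(x1 * x2)\<^sup>2 + R \<le> (x1\<^sup>2 + y1\<^sup>2) * (x2\<^sup>2 + y2\<^sup>2)"
      by (simp add: R_def power_mult_distrib algebra_simps)
    also have "\<dots> \<le> ((x1 - \<epsilon> * y1) * x1) * ((x2 - \<epsilon> * y2) * x2)"
    proof (rule mult_mono[OF z])
      show "0 \<le> (x1 - \<epsilon> * y1) * x1" using z(1) zero_le_power2[of x1] zero_le_power2[of y1] by linarith
    qed simp
    finally have "2 * K * ((x1 * x2)\<^sup>2 + R) \<le> 2 * K * (((x1 - \<epsilon> * y1) * x1) * ((x2 - \<epsilon> * y2) * x2))"
      using K by (intro mult_left_mono) auto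
    moreover have "(y1 * x1) * (y2 * x2) \<le> R"
    proof -
      have "2 * ((x1 * y2) * (y1 * x2)) \<le> R" using sum_squares_bound[of "x1 * y2" "y1 * x2"] by (simp add: R_def)
      moreover have "R \<ge> 0" by (simp add: R_def)
      moreover have "(y1 * x1) * (y2 * x2) = (x1 * y2) * (y1 * x2)" by simp
      ultimately show ?thesis by linarith
    qed
    moreover have "1 * R \<le> 2 * K * R" using K1 by (intro mult_right_mono) (auto simp: R_def)
    ultimately have "(2 * K + 1) * (x1 * x2)\<^sup>2 \<le> T * (x1 * x2)"
      unfolding Txx by (simp add: algebra_simps)
    hence "(2 * K + 1) * \<bar>x1 * x2\<bar> \<le> \<bar>T\<bar>" using xn by (intro abs_le_of_mult_le) auto
    thus ?thesis
    proof (rule sq[of "2 * K + 1" 1])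
      have kk: "K \<le> K * K" using K1 mult_right_mono[OF K1 K] by simp
      have eq41: "(2 * K + 1)\<^sup>2 * 1\<^sup>2 = 4 * (K * K) + 4 * K + 1" by (simp add: power2_eq_square algebra_simps)
      have "1 \<le> K * K" using K1 kk by (rule order_trans)
      moreover have "4 * (1 + K) \<le> 4 * X + 4 * K + 1" if "1 \<le> X" for X using that by simp
      ultimately have "4 * (1 + K) \<le> 4 * (K * K) + 4 * K + 1" by blast
      thus "4 * (1 + K) \<le> (2 * K + 1)\<^sup>2 * 1\<^sup>2" by (simp only: eq41)
    qed (use K dom in auto)
  qed
  thus ?thesis unfolding LamE geodT .
qed

subsection \<open>The two extremal lengths\<close>

text \<open>Origin of the constants: the first hypothesis gives ln Q at least L / 2, and the third
  gives ln (2 Q) at most 2 ln 2 + 4 L, hence at most 6 L as L is at least ln 2.\<close>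

lemma geod_numeric_bounds:
  assumes "exp L \<le> Q\<^sup>2" "0 \<le> Q" "Q \<le> 2 * exp (4 * L)" "ln 2 \<le> L"
  shows "Q > 1" "1 / (2 * pi) * L \<le> ln Q / pi" "2 * ln (2 * Q) / pi \<le> 12 / pi * L"
proof -
  have "2 \<le> exp L" using assms(4) by (metis exp_le_cancel_iff exp_ln zero_less_numeral)
  hence "1\<^sup>2 < Q\<^sup>2" using assms(1) by simp
  thus Q: "Q > 1" using assms(2) by (rule power_less_imp_less_base)
  have "ln (exp L) \<le> ln (Q\<^sup>2)" using assms(1) by (subst ln_le_cancel_iff) (use Q in auto)
  hence "L \<le> 2 * ln Q" using Q by (simp add: ln_realpow)
  thus "1 / (2 * pi) * L \<le> ln Q / pi" by (simp add: field_simps)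
  have "ln (2 * Q) \<le> ln (2 * (2 * exp (4 * L)))" using assms(3) Q by (subst ln_le_cancel_iff) auto
  also have "\<dots> = ln 2 + (ln 2 + 4 * L)" by (simp only: ln_mult_pos ln_exp zero_less_numeral zero_less_mult_iff exp_gt_zero simp_thms)
  also have "\<dots> \<le> 6 * L" using assms(4) by simp
  finally show "2 * ln (2 * Q) / pi \<le> 12 / pi * L" by (simp add: field_simps)
qed

lemma geod_nonneg: "0 \<le> geod M" "0 \<le> geod_pb M"
  by (cases M; simp add: geod_def geod_pb_def)+

lemma conj_mat_mid: "conj_mat mid W = W"
  by (cases W) (simp add: conj_mat_def mmul_def minv_def mid_def)

text \<open>The hyperbolic rotation by a right angle about \<i>, which takes the imaginary axis to
  the unit half circle.\<close>

definition C_pb :: rmat where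
  "C_pb = (1 / sqrt 2, - 1 / sqrt 2, 1 / sqrt 2, 1 / sqrt 2)"

lemma mdet_C_pb: "mdet C_pb = 1"
  by (simp add: mdet_def C_pb_def)

lemma geod_conj_C_pb: "geod (conj_mat C_pb W) = geod_pb W"
proof -
  obtain p q r s where W: "W = (p, q, r, s)" by (cases W)
  define c :: real where "c = 1 / sqrt 2"
  have cc: "c * c = 1 / 2" by (simp add: c_def)
  have C: "C_pb = (c, - c, c, c)" by (simp add: C_pb_def c_def)
  have e: "conj_mat C_pb W = ((c * c) * (p + q + r + s), (c * c) * (q - p + s - r), (c * c) * (r + s - p - q), (c * c) * (p - q - r + s))"
    by (simp add: conj_mat_def C W mmul_def minv_def algebra_simps)
  have half: "1 / 2 * (p + q + r + s) * (1 / 2 * (p - q - r + s)) + 1 / 2 * (q - p + s - r) * (1 / 2 * (r + s - p - q))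
      = (p * p + s * s - q * q - r * r) / 2"
    by (simp add: field_simps)
  show ?thesis
    unfolding e cc unfolding geod_def geod_pb_def W prod.case power2_eq_square half by simp
qed

lemma image_C_pb: "mob C_pb ` L_tr = L_pb"
proof -
  have iff: "norm (mob C_pb \<tau>) = 1 \<longleftrightarrow> Re \<tau> = 0" if \<tau>: "\<tau> \<in> upper_half" for \<tau>
  proof -
    have nz: "\<tau> + 1 \<noteq> 0" using real_linear_form_nonzero[OF \<tau>, of 1 1] by simp
    have "mob C_pb \<tau> = (of_real (1 / sqrt 2) * (\<tau> - 1)) / (of_real (1 / sqrt 2) * (\<tau> + 1))"
      by (simp add: mob_def C_pb_def diff_divide_distrib add_divide_distrib)
    hence "mob C_pb \<tau> = (\<tau> - 1) / (\<tau> + 1)" by simp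
    hence "norm (mob C_pb \<tau>) = 1 \<longleftrightarrow> norm (\<tau> - 1) = norm (\<tau> + 1)" using nz by (auto simp: norm_divide)
    also have "\<dots> \<longleftrightarrow> (norm (\<tau> - 1))\<^sup>2 = (norm (\<tau> + 1))\<^sup>2" by (simp add: power2_eq_iff_nonneg)
    also have "\<dots> \<longleftrightarrow> (Re \<tau> - 1)\<^sup>2 = (Re \<tau> + 1)\<^sup>2" by (simp add: cmod_power2)
    also have "\<dots> \<longleftrightarrow> Re \<tau> = 0" by (simp add: power2_eq_square algebra_simps)
    finally show ?thesis .
  qed
  show ?thesis
  proof
    show "mob C_pb ` L_tr \<subseteq> L_pb"
    proof
      fix x assume "x \<in> mob C_pb ` L_tr"
      then obtain \<tau> where \<tau>: "\<tau> \<in> L_tr" "x = mob C_pb \<tau>" by blast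
      hence "\<tau> \<in> upper_half" "Re \<tau> = 0" by (auto simp: L_tr_def upper_half_def)
      thus "x \<in> L_pb" using iff[of \<tau>] mob_upper_half[OF mdet_C_pb, of \<tau>] \<tau>(2) by (simp add: L_pb_def upper_half_def)
    qed
    show "L_pb \<subseteq> mob C_pb ` L_tr"
    proof
      fix x assume x: "x \<in> L_pb"
      hence xH: "x \<in> upper_half" by (simp add: L_pb_def upper_half_def)
      define \<tau> where "\<tau> = mob (minv C_pb) x"
      have \<tau>H: "\<tau> \<in> upper_half" unfolding \<tau>_def by (rule mob_upper_half) (simp_all add: mdet_minv mdet_C_pb xH)
      have e: "mob C_pb \<tau> = x" unfolding \<tau>_def by (rule mob_minv(2)[OF mdet_C_pb xH])
      have "Re \<tau> = 0" using iff[OF \<tau>H] x by (simp add: e L_pb_def)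
      hence "\<tau> \<in> L_tr" using \<tau>H by (simp add: L_tr_def upper_half_def)
      thus "x \<in> mob C_pb ` L_tr" using e by blast
    qed
  qed
qed

lemma lambda_tr_geod:
  defines "Q \<equiv> \<lambda>w. geod (word_mat w)"
  shows "Q w = 1 \<Longrightarrow> lambda_tr w = 0" "Q w > 1 \<Longrightarrow> ereal (ln (Q w) / pi) \<le> lambda_tr w"
    "Q w > 1 \<Longrightarrow> lambda_tr w \<le> ereal (2 * ln (2 * Q w) / pi)"
proof -
  obtain g where g: "boundary_lift interval_tr (mob mid ` L_tr) g" using boundary_lift_tr by auto
  have i: "\<i> \<in> mob mid ` L_tr" by (simp add: L_tr_def)
  show "Q w = 1 \<Longrightarrow> lambda_tr w = 0" "Q w > 1 \<Longrightarrow> ereal (ln (Q w) / pi) \<le> lambda_tr w"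
    "Q w > 1 \<Longrightarrow> lambda_tr w \<le> ereal (2 * ln (2 * Q w) / pi)"
    using extremal_length_geod[OF mdet_mid g i, of w]
    unfolding conj_mat_mid lambda_tr_def class_tr_def Q_def by blast+
qed

lemma lambda_pb_geod:
  defines "Q \<equiv> \<lambda>w. geod_pb (word_mat w)"
  shows "Q w = 1 \<Longrightarrow> lambda_pb w = 0" "Q w > 1 \<Longrightarrow> ereal (ln (Q w) / pi) \<le> lambda_pb w"
    "Q w > 1 \<Longrightarrow> lambda_pb w \<le> ereal (2 * ln (2 * Q w) / pi)"
proof -
  obtain g where g: "boundary_lift axis_pb (mob C_pb ` L_tr) g" using boundary_lift_pb image_C_pb by auto
  have i: "\<i> \<in> mob C_pb ` L_tr" by (simp add: image_C_pb L_pb_def)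
  show "Q w = 1 \<Longrightarrow> lambda_pb w = 0" "Q w > 1 \<Longrightarrow> ereal (ln (Q w) / pi) \<le> lambda_pb w"
    "Q w > 1 \<Longrightarrow> lambda_pb w \<le> ereal (2 * ln (2 * Q w) / pi)"
    using extremal_length_geod[OF mdet_C_pb g i, of w]
    unfolding geod_conj_C_pb lambda_pb_def class_pb_def Q_def by blast+
qed

theorem theorem1:
  shows "\<exists>C\<^sub>p C\<^sub>m :: real. C\<^sub>p > 0 \<and> C\<^sub>m > 0 \<and>
    (\<forall>w. reduced_word w \<longrightarrow>
      (if \<exists>g n. w = gen_power g n
       then lambda_tr w = 0
       else ereal (C\<^sub>m * Lambda w) \<le> lambda_tr w \<and> lambda_tr w \<le> ereal (C\<^sub>p * Lambda w)) \<and>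
      (if \<exists>e \<in> {1, -1}. \<forall>t \<in> set w. snd t = e
       then lambda_pb w = 0
       else ereal (C\<^sub>m * Lambda w) \<le> lambda_pb w \<and> lambda_pb w \<le> ereal (C\<^sub>p * Lambda w)))"
proof (rule exI[of _ "12 / pi"], rule exI[of _ "1 / (2 * pi)"], intro conjI allI impI)
  fix w assume w: "reduced_word w"
  define ns where "ns = map snd w"
  have nz: "0 \<notin> set ns" using w by (auto simp: reduced_word_def ns_def)
  note geod_w = geod_word_mat[OF w, folded ns_def]
  show "if \<exists>g n. w = gen_power g n then lambda_tr w = 0
    else ereal (1 / (2 * pi) * Lambda w) \<le> lambda_tr w \<and> lambda_tr w \<le> ereal (12 / pi * Lambda w)"
  proof (cases "\<exists>g n. w = gen_power g n")
    case True
    then obtain g n where "w = gen_power g n" by blast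
    \<comment> \<open>The matrix of a single power is triangular: it fixes 0 or infinity, an end
      point of the imaginary axis.\<close>
    hence "geod (word_mat w) = 1"
      by (cases g) (auto simp: gen_power_def geod_def mid_def mmul_def gen_mat_def)
    thus ?thesis using True lambda_tr_geod(1) by simp
  next
    case False
    have "length ns \<ge> 2"
    proof (rule ccontr)
      assume "\<not> length ns \<ge> 2"
      hence "length w < 2" by (simp add: ns_def)
      hence "length w = 0 \<or> length w = Suc 0" by linarith
      then consider "w = []" | g n where "w = [(g, n)]" by (auto simp: length_Suc_conv)
      thus False
      proof cases
        case 1
        hence "w = gen_power A1 0" by (simp add: gen_power_def)
        thus False using False by blast
      next
        case 2
        hence "w = gen_power g n" using nz by (simp add: gen_power_def ns_def)
        thus False using False by blast
      qed
    qed
    moreover from this have "ns \<noteq> []" by auto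
    ultimately have "exp (Lam ns) \<le> (geod (word_mat w))\<^sup>2" "geod (word_mat w) \<le> 2 * exp (4 * Lam ns)" "ln 2 \<le> Lam ns"
      unfolding geod_w using geod_chain_mat_lower[OF nz] chain_mat_upper(1)[OF nz] Lam_ge_ln2[OF nz] by auto
    note b = geod_numeric_bounds[OF this(1) geod_nonneg(1) this(2,3)]
    have "ereal (1 / (2 * pi) * Lambda w) \<le> lambda_tr w"
      by (rule order_trans[OF _ lambda_tr_geod(2)[OF b(1)]]) (use b(2) in \<open>simp add: Lambda_Lam ns_def\<close>)
    moreover have "lambda_tr w \<le> ereal (12 / pi * Lambda w)"
      by (rule order_trans[OF lambda_tr_geod(3)[OF b(1)]]) (use b(3) in \<open>simp add: Lambda_Lam ns_def\<close>)
    ultimately show ?thesis using False by simp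
  qed
  show "if \<exists>e\<in>{1, -1}. \<forall>t\<in>set w. snd t = e then lambda_pb w = 0
    else ereal (1 / (2 * pi) * Lambda w) \<le> lambda_pb w \<and> lambda_pb w \<le> ereal (12 / pi * Lambda w)"
  proof (cases "\<exists>e\<in>{1, -1}. \<forall>t\<in>set w. snd t = e")
    case True
    then obtain e where e: "e \<in> {1, -1}" "\<forall>t\<in>set w. snd t = e" by blast
    \<comment> \<open>The empty word belongs to this case as well, with a run of length 0.\<close>
    have "ns = replicate (length ns) e" using e(2) by (intro replicate_eqI) (auto simp: ns_def)
    hence "geod_pb (word_mat w) = 1" using geod_pb_replicate[OF e(1)] geod_w(2) by metis
    thus ?thesis using True lambda_pb_geod(1) by simp
  next
    case False
    have ne: "\<exists>n\<in>set ns. n \<noteq> e" if "e \<in> {1, -1}" for e using False that by (auto simp: ns_def)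
    from ne[of 1] have "ns \<noteq> []" by auto
    hence "exp (Lam ns) \<le> (geod_pb (word_mat w))\<^sup>2" "geod_pb (word_mat w) \<le> 2 * exp (4 * Lam ns)" "ln 2 \<le> Lam ns"
      unfolding geod_w using geod_pb_chain_mat_lower[OF nz ne] chain_mat_upper(2)[OF nz] Lam_ge_ln2[OF nz] by auto
    note b = geod_numeric_bounds[OF this(1) geod_nonneg(2) this(2,3)]
    have "ereal (1 / (2 * pi) * Lambda w) \<le> lambda_pb w"
      by (rule order_trans[OF _ lambda_pb_geod(2)[OF b(1)]]) (use b(2) in \<open>simp add: Lambda_Lam ns_def\<close>)
    moreover have "lambda_pb w \<le> ereal (12 / pi * Lambda w)"
      by (rule order_trans[OF lambda_pb_geod(3)[OF b(1)]]) (use b(3) in \<open>simp add: Lambda_Lam ns_def\<close>)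
    ultimately show ?thesis by (simp only: if_not_P[OF False] simp_thms)
  qed
qed auto

end
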